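(* Let $f\in\mathbb{K}[[X]][Y]$ be a quasi-ordinary irreducible Weierstrass polynomial of characteristic $(h_1,\dots,h_s)$, let $1\le k\le s$, and let $g\in\mathbb{K}[[X]][Y]$ be a Weierstrass polynomial such that $\deg g\le\deg f_{k+1}$ and $\mathrm{cont}_A(f,g)>\mathrm{cont}_A(f,f_k)$ (i.e. $\mathrm{cont}_A(f,g)\subsetneq\mathrm{cont}_A(f,f_k)$). Then $g$ is an irreducible quasi-ordinary polynomial of characteristic $(h_1,\dots,h_k)$ and $\deg g=\deg f_{k+1}$. Moreover, if $k\le s-1$ and $\mathrm{cont}_A(f,g)\ge\mathrm{cont}_A(f,f_{k+1})$, then $\mathrm{cont}_A(f,g)=\mathrm{cont}_A(f,f_{k+1})$.
   Context: $\mathbb{K}$ is an algebraically closed field of characteristic zero; $\mathbb{K}[[X]]=\mathbb{K}[[X_1,\dots,X_d]]$, $X^q=X_1^{q_1}\cdots X_d^{q_d}$. A monic polynomial in $\mathbb{K}[[X]][Y]$ is quasi-ordinary if its discriminant equals $u(X)X^q$ with $u(0)\ne0$, and Weierstrass if its non-leading coefficients vanish at $0$. Roots of a quasi-ordinary polynomial lie in $\mathbb{K}[[X_1^{1/m},\dots,X_d^{1/m}]]$; for distinct roots $\alpha_i-\alpha_j=u_{ij}X^{\lambda_{ij}}$, $u_{ij}(0)\ne0$, and for irreducible quasi-ordinary $f$ these exponents form an increasing sequence $h_1<\dots<h_s$ (partial order $q\le q'\iff q'-q\in\mathbb{Q}^d_{\ge0}$), the characteristic of $f$. For $1\le r\le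 s$ and a root $\alpha$ of $f$, $\mathrm{trunc}_r(\alpha)$ is obtained from $\alpha$ by omitting all terms $X^a$ with $a\ge h_r$, and $f_r\in\mathbb{K}[[X]][Y]$ is the minimal polynomial of $\mathrm{trunc}_r(\alpha)$ over the fraction field of $\mathbb{K}[[X]]$ (independent of $\alpha$); set $f_{s+1}=f$. For a power series, $\Delta$ denotes its Newton polytope (convex hull of $\bigcup_{c_a\ne0}(a+\mathbb{R}^d_{\ge0})$). The logarithmic distance is $\mathrm{cont}_A(f,g)=\frac{1}{\deg f\deg g}\Delta(\mathrm{Res}(f,g))$, and Newton polytopes are ordered by $\Delta_1\ge\Delta_2$ iff $\Delta_1\subset\Delta_2$ ($>$ meaning $\ge$ and $\ne$). *)

theory Defs
  imports "HOL-Analysis.Analysis" "Subresultants.Resultant_Prelim"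
begin

text \<open>The variables are indexed by a finite type 'd (so d = CARD('d) is arbitrary but fixed).
  A power series is given by its coefficient function on exponent vectors in N^d.\<close>

datatype ('a, 'd) mps = MPS (mps_nth: "('d \<Rightarrow> nat) \<Rightarrow> 'a")

lemma mps_eqI: "(\<And>n. mps_nth f n = mps_nth g n) \<Longrightarrow> f = g"
  by (cases f, cases g) auto

lemma finite_le_fun_nat: "finite {a :: 'd::finite \<Rightarrow> nat. a \<le> n}"
proof -
  have "{a :: 'd \<Rightarrow> nat. a \<le> n} = PiE UNIV (\<lambda>i. {..n i})"
    by (auto simp: le_fun_def PiE_def extensional_def)
  thus ?thesis by (simp add: finite_PiE)
qed

definition mps_times :: "('a::comm_ring_1, 'd::finite) mps \<Rightarrow> ('a, 'd) mps \<Rightarrow> ('a, 'd) mps" where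
  "mps_times f g = MPS (\<lambda>n. \<Sum>a\<in>{a. a \<le> n}. mps_nth f a * mps_nth g (\<lambda>i. n i - a i))"

definition mps_one :: "('a::comm_ring_1, 'd) mps" where
  "mps_one = MPS (\<lambda>n. if n = (\<lambda>_. 0) then 1 else 0)"

lemma mps_nth_times:
  "mps_nth (mps_times f g) n = (\<Sum>a\<in>{a. a \<le> n}. mps_nth f a * mps_nth g (\<lambda>i. n i - a i))"
  by (simp add: mps_times_def)

lemma mps_times_assoc:
  fixes f g h :: "('a::comm_ring_1, 'd::finite) mps"
  shows "mps_times (mps_times f g) h = mps_times f (mps_times g h)"
proof (rule mps_eqI)
  fix n :: "'d \<Rightarrow> nat"
  let ?A = "Sigma {a. a \<le> n} (\<lambda>a. {b. b \<le> a})"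
  let ?B = "Sigma {b. b \<le> n} (\<lambda>b. {c. c \<le> (\<lambda>i. n i - b i)})"
  have "mps_nth (mps_times (mps_times f g) h) n =
      (\<Sum>a\<in>{a. a \<le> n}. (\<Sum>b\<in>{b. b \<le> a}. mps_nth f b * mps_nth g (\<lambda>i. a i - b i))
          * mps_nth h (\<lambda>i. n i - a i))"
    by (simp only: mps_nth_times)
  also have "\<dots> = (\<Sum>(a,b)\<in>?A. mps_nth f b * mps_nth g (\<lambda>i. a i - b i) * mps_nth h (\<lambda>i. n i - a i))"
    by (subst sum.Sigma[symmetric]) (auto simp: finite_le_fun_nat sum_distrib_right)
  also have "\<dots> = (\<Sum>(b,c)\<in>?B. mps_nth f b * mps_nth g c * mps_nth h (\<lambda>i. n i - b i - c i))"
    apply (rule sum.reindex_bij_witness[where i = "\<lambda>(b,c). (\<lambda>i. b i + c i, b)"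
        and j = "\<lambda>(a,b). (b, \<lambda>i. a i - b i)"])
    apply (auto simp: le_fun_def fun_eq_iff mult.assoc split: prod.splits)
    apply ((drule_tac x=x in spec)+, arith)+
    done
  also have "\<dots> = (\<Sum>b\<in>{b. b \<le> n}. mps_nth f b *
        (\<Sum>c\<in>{c. c \<le> (\<lambda>i. n i - b i)}. mps_nth g c * mps_nth h (\<lambda>i. n i - b i - c i)))"
    by (subst sum.Sigma[symmetric]) (auto simp: finite_le_fun_nat sum_distrib_left mult.assoc)
  also have "\<dots> = mps_nth (mps_times f (mps_times g h)) n"
    by (simp only: mps_nth_times)
  finally show "mps_nth (mps_times (mps_times f g) h) n = mps_nth (mps_times f (mps_times g h)) n" .
qed

lemma mps_times_commute:
  fixes f g :: "('a::comm_ring_1, 'd::finite) mps"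
  shows "mps_times f g = mps_times g f"
proof (rule mps_eqI)
  fix n :: "'d \<Rightarrow> nat"
  show "mps_nth (mps_times f g) n = mps_nth (mps_times g f) n"
    unfolding mps_nth_times
    by (rule sum.reindex_bij_witness[where i = "\<lambda>a i. n i - a i" and j = "\<lambda>a i. n i - a i"])
       (auto simp: le_fun_def fun_eq_iff mult.commute)
qed

lemma mps_one_times:
  fixes f :: "('a::comm_ring_1, 'd::finite) mps"
  shows "mps_times mps_one f = f"
proof (rule mps_eqI)
  fix n :: "'d \<Rightarrow> nat"
  have "mps_nth (mps_times mps_one f) n = (\<Sum>a\<in>{a. a \<le> n}. if a = (\<lambda>_. 0) then mps_nth f (\<lambda>i. n i - a i) else 0)"
    unfolding mps_nth_times by (auto simp: mps_one_def intro!: sum.cong)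
  also have "\<dots> = mps_nth f n"
    by (subst sum.delta) (auto simp: finite_le_fun_nat[unfolded le_fun_def] le_fun_def)
  finally show "mps_nth (mps_times mps_one f) n = mps_nth f n" .
qed

lemma mps_times_distrib:
  fixes f g h :: "('a::comm_ring_1, 'd::finite) mps"
  shows "mps_times (MPS (\<lambda>n. mps_nth f n + mps_nth g n)) h =
         MPS (\<lambda>n. mps_nth (mps_times f h) n + mps_nth (mps_times g h) n)"
  by (simp add: mps_times_def distrib_right sum.distrib)

instantiation mps :: (comm_ring_1, finite) comm_ring_1
begin

definition zero_mps_def: "0 = MPS (\<lambda>_. 0)"
definition one_mps_def: "1 = mps_one"
definition plus_mps_def: "f + g = MPS (\<lambda>n. mps_nth f n + mps_nth g n)"
definition minus_mps_def: "f - g = MPS (\<lambda>n. mps_nth f n - mps_nth g n)"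
definition uminus_mps_def: "- f = MPS (\<lambda>n. - mps_nth f n)"
definition times_mps_def: "f * g = mps_times f g"

instance
proof
  fix a b c :: "('a, 'b) mps"
  show "a * b * c = a * (b * c)" unfolding times_mps_def by (rule mps_times_assoc)
  show "a * b = b * a" by (simp add: times_mps_def mps_times_commute)
  show "1 * a = a" by (simp add: times_mps_def one_mps_def mps_one_times)
  show "a + b + c = a + (b + c)" by (simp add: plus_mps_def add.assoc)
  show "a + b = b + a" by (simp add: plus_mps_def add.commute)
  show "0 + a = a" by (cases a) (simp add: plus_mps_def zero_mps_def)
  show "- a + a = 0" by (simp add: plus_mps_def uminus_mps_def zero_mps_def)
  show "a - b = a + - b" by (simp add: plus_mps_def uminus_mps_def minus_mps_def)
  show "(a + b) * c = a * c + b * c"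
    by (simp add: plus_mps_def times_mps_def mps_times_distrib)
  show "(0::('a,'b) mps) \<noteq> 1"
    by (auto simp: zero_mps_def one_mps_def mps_one_def fun_eq_iff)
qed

end

definition mps_const_coeff :: "('a, 'd) mps \<Rightarrow> 'a" where
  "mps_const_coeff u = mps_nth u (\<lambda>_. 0)"

definition mps_monom :: "('d \<Rightarrow> nat) \<Rightarrow> ('a::{zero,one}, 'd) mps" where
  "mps_monom q = MPS (\<lambda>n. if n = q then 1 else 0)"

text \<open>Substitution X_i := T_i^m; the roots of f(X,Y) in K[[X^(1/m)]] are exactly the roots
  of f(T^m,Y) in K[[T]], a term T^e corresponding to X^(e/m).\<close>
definition ramify :: "nat \<Rightarrow> ('a::zero, 'd) mps \<Rightarrow> ('a, 'd) mps" where
  "ramify m a = MPS (\<lambda>e. if (\<forall>i. m dvd e i) then mps_nth a (\<lambda>i. e i div m) else 0)"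

definition deriv_Y :: "('a::comm_semiring_1) poly \<Rightarrow> 'a poly" where
  "deriv_Y f = Poly (map (\<lambda>i. of_nat (Suc i) * coeff f (Suc i)) [0..<degree f])"

definition discriminant :: "('a::comm_ring_1) poly \<Rightarrow> 'a" where
  "discriminant f = (-1) ^ (degree f * (degree f - 1) div 2) * resultant f (deriv_Y f)"

definition weierstrass :: "('a::comm_ring_1, 'd::finite) mps poly \<Rightarrow> bool" where
  "weierstrass f \<longleftrightarrow> lead_coeff f = 1 \<and>
     (\<forall>i < degree f. mps_const_coeff (coeff f i) = 0)"

definition quasi_ordinary :: "('a::comm_ring_1, 'd::finite) mps poly \<Rightarrow> bool" where
  "quasi_ordinary f \<longleftrightarrow> lead_coeff f = 1 \<and>
     (\<exists>u q. discriminant f = u * mps_monom q \<and> mps_const_coeff u \<noteq> 0)"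

text \<open>alpha is a root of f in K[[X^(1/m)]] (represented in K[[T]], X = T^m).\<close>
definition is_root_ram :: "nat \<Rightarrow> ('a::comm_ring_1, 'd::finite) mps poly \<Rightarrow> ('a, 'd) mps \<Rightarrow> bool" where
  "is_root_ram m f \<alpha> \<longleftrightarrow> m > 0 \<and> poly (map_poly (ramify m) f) \<alpha> = 0"

definition root_diff_exps :: "('a::comm_ring_1, 'd::finite) mps poly \<Rightarrow> ('d \<Rightarrow> rat) set" where
  "root_diff_exps f = {lam. \<exists>m \<alpha> \<beta> u e. is_root_ram m f \<alpha> \<and> is_root_ram m f \<beta> \<and> \<alpha> \<noteq> \<beta> \<and>
       \<alpha> - \<beta> = u * mps_monom e \<and> mps_const_coeff u \<noteq> 0 \<and>
       lam = (\<lambda>i. of_nat (e i) / of_nat m)}"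

definition has_characteristic :: "('a::comm_ring_1, 'd::finite) mps poly \<Rightarrow> ('d \<Rightarrow> rat) list \<Rightarrow> bool" where
  "has_characteristic f hs \<longleftrightarrow> sorted_wrt (<) hs \<and> set hs = root_diff_exps f"

definition trunc_ram :: "nat \<Rightarrow> ('d \<Rightarrow> rat) \<Rightarrow> ('a::zero, 'd) mps \<Rightarrow> ('a, 'd) mps" where
  "trunc_ram m h \<alpha> = MPS (\<lambda>e. if h \<le> (\<lambda>i. of_nat (e i) / of_nat m) then 0 else mps_nth \<alpha> e)"

text \<open>p = f_r: the minimal polynomial (monic, of least degree among nonzero polynomials with
  coefficients in K[[X]], equivalently in its fraction field after clearing denominators)
  of trunc_r(alpha), for a root alpha of f.\<close>
definition is_f_r :: "('a::comm_ring_1, 'd::finite) mps poly \<Rightarrow> ('d \<Rightarrow> rat) list \<Rightarrow> nat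
     \<Rightarrow> ('a, 'd) mps poly \<Rightarrow> bool" where
  "is_f_r f hs r p \<longleftrightarrow> lead_coeff p = 1 \<and>
     (\<exists>m \<alpha>. is_root_ram m f \<alpha> \<and>
        is_root_ram m p (trunc_ram m (hs ! (r - 1)) \<alpha>) \<and>
        (\<forall>q. q \<noteq> 0 \<and> is_root_ram m q (trunc_ram m (hs ! (r - 1)) \<alpha>) \<longrightarrow> degree p \<le> degree q))"

definition newton_polytope :: "('a::zero, 'd::finite) mps \<Rightarrow> (real ^ 'd) set" where
  "newton_polytope \<phi> = convex hull
     (\<Union>a\<in>{a. mps_nth \<phi> a \<noteq> 0}. {x. \<forall>i. real (a i) \<le> vec_nth x i})"

definition contA :: "('a::comm_ring_1, 'd::finite) mps poly \<Rightarrow> ('a, 'd) mps poly \<Rightarrow> (real ^ 'd) set" where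
  "contA f g = (\<lambda>x. (1 / (real (degree f) * real (degree g))) *\<^sub>R x) ` newton_polytope (resultant f g)"

end

theory Submission
  imports Defs
begin

text \<open>
  Let \<open>X = T^m\<close> with \<open>m\<close> large enough for a root \<open>x\<close> of \<open>f\<close> to be a power series in \<open>T\<close>. Tuples of \<open>m\<close>-th roots of
  unity act on \<open>K[[T]]\<close> with invariant ring \<open>K[[X]]\<close>, so irreducible polynomials having a root in \<open>K[[T]]\<close> are
  products of \<open>Y - y\<close> over orbits, and \<open>f\<^sub>r\<close> is the orbit polynomial of the truncated root.
  Products of powers of the \<open>f\<^sub>i\<close> with \<open>i \<le> k\<close> form a \<open>K[[X]]\<close>-basis of the polynomials of
  degree less than \<open>deg f\<^sub>k\<^sub>+\<^sub>1\<close>; at \<open>x\<close> they are units times monomials whose exponents are distinct modulo \<open>m\<close>.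
  Expanding \<open>g\<close> in this basis, no minimal exponents can cancel. If \<open>deg g\<close> is smaller than
  \<open>deg f\<^sub>k\<^sub>+\<^sub>1\<close> the leading term therefore prevents \<open>g\<close> from being closer to \<open>f\<close> than \<open>f\<^sub>k\<close>. If the degrees agree, then
  after the substitution of \<open>Y\<close> by the truncated root plus \<open>T^h Z\<close>, where \<open>h\<close> corresponds to \<open>h\<^sub>k\<close>, the reduction of \<open>g\<close> is
  \<open>a Z^n + b Z^j\<close> with \<open>j < n\<close>, and the coefficient of \<open>x\<close> at \<open>T^h\<close> is a nonzero, hence
  simple, root of it. Hensel's lemma lifts it to a root of \<open>g\<close> that shares with \<open>x\<close> all terms up to \<open>T^h\<close>; its
  orbit has at least \<open>deg g\<close> elements, so \<open>g\<close> is its orbit polynomial. No existence theorem for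
  roots of quasi-ordinary polynomials is needed.
\<close>

text \<open>Exponent vectors are only partially ordered, so a series has in general no leading term
  and no single valuation measures contact. Containment in an orthant, however, only involves the
  orders along the single variables. These add under products and agree at all conjugates, so
  containment of \<open>cont_A(f,g)\<close> in \<open>cont_A(f,f_k)\<close> yields, coordinate by
  coordinate, that every exponent \<open>a\<close> of \<open>g(x)\<close> has
  \<open>a / deg g\<close> at least \<open>b / deg f_k\<close>, where \<open>b\<close> is the
  exponent of \<open>f_k(x)\<close>. Strictness says that the exponent attaining equality everywhere
  is absent from \<open>g(x)\<close>. On the other side stands an upper bound: the quotients of the
  exponent of \<open>f_r(x)\<close> by \<open>deg f_r\<close> are averages over the whole group and
  increase with \<open>r\<close>, so no basis product of degree \<open>t\<close> has an exponent
  exceeding \<open>t b / deg f_k\<close>. For degrees below \<open>deg f_{k+1}\<close> the two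
  bounds meet at the top term, which is then present. The final claim is this same argument one
  level higher, where the degree \<open>deg f_{k+1}\<close> is again too small.\<close>

section \<open>Coefficients of products and initial exponents\<close>

lemma mps_nth_0 [simp]: "mps_nth 0 e = 0"
  by (simp add: zero_mps_def)

lemma mps_nth_1: "mps_nth 1 e = (if e = (\<lambda>_. 0) then 1 else 0)"
  by (simp add: one_mps_def mps_one_def)

lemma mps_nth_add [simp]: "mps_nth (f + g) e = mps_nth f e + mps_nth g e"
  by (simp add: plus_mps_def)

lemma mps_nth_diff [simp]: "mps_nth (f - g) e = mps_nth f e - mps_nth g e"
  by (simp add: minus_mps_def)

lemma mps_nth_uminus [simp]: "mps_nth (- f) e = - mps_nth f e"
  by (simp add: uminus_mps_def)

lemma mps_nth_mult:
  "mps_nth (f * g) n = (\<Sum>a\<in>{a. a \<le> n}. mps_nth f a * mps_nth g (\<lambda>i. n i - a i))"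
  by (simp add: times_mps_def mps_nth_times)

lemma mps_nth_sum: "mps_nth (sum f A) e = (\<Sum>x\<in>A. mps_nth (f x) e)"
  by (induction A rule: infinite_finite_induct) auto

lemma mps_eq_0_iff: "f = 0 \<longleftrightarrow> (\<forall>e. mps_nth f e = 0)"
  by (auto intro: mps_eqI)

lemma mps_nth_mult_nonzeroE:
  assumes "mps_nth (f * g) n \<noteq> 0"
  obtains a b where "mps_nth f a \<noteq> 0" "mps_nth g b \<noteq> 0" "n = (\<lambda>i. a i + b i)"
proof -
  from assms obtain a where "a \<le> n" "mps_nth f a * mps_nth g (\<lambda>i. n i - a i) \<noteq> 0"
    unfolding mps_nth_mult by (metis (mono_tags, lifting) mem_Collect_eq sum.neutral)
  moreover from \<open>a \<le> n\<close> have "n = (\<lambda>i. a i + (n i - a i))" by (auto simp: le_fun_def)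
  ultimately show ?thesis by (intro that[of a "\<lambda>i. n i - a i"]) auto
qed

lemma mps_nth_monom_mult:
  "mps_nth (f * mps_monom q) e = (if q \<le> e then mps_nth f (\<lambda>i. e i - q i) else 0)"
proof -
  have "mps_nth (f * mps_monom q) e
      = mps_nth (mps_monom q * f) e" by (simp add: mult.commute)
  also have "\<dots> = (\<Sum>a\<in>{a. a \<le> e}. if a = q then mps_nth f (\<lambda>i. e i - q i) else 0)"
    unfolding mps_nth_mult by (intro sum.cong) (auto simp: mps_monom_def)
  also have "\<dots> = (if q \<le> e then mps_nth f (\<lambda>i. e i - q i) else 0)"
    by (subst sum.delta) (auto simp: finite_le_fun_nat)
  finally show ?thesis .
qed

lemma mps_monom_0: "mps_monom (\<lambda>_. 0) = 1"
  by (rule mps_eqI) (auto simp: mps_nth_1 mps_monom_def)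

lemma mps_monom_mult:
  "mps_monom a * mps_monom b = (mps_monom (\<lambda>i. a i + b i) :: ('a::comm_ring_1, 'd::finite) mps)"
proof (rule mps_eqI)
  fix e
  have "b \<le> e \<and> (\<lambda>i. e i - b i) = a \<longleftrightarrow> e = (\<lambda>i. a i + b i)"
    unfolding le_fun_def fun_eq_iff by (metis add_diff_cancel_right' le_add2 le_add_diff_inverse2)
  thus "mps_nth (mps_monom a * mps_monom b :: ('a, 'd) mps) e = mps_nth (mps_monom (\<lambda>i. a i + b i)) e"
    unfolding mps_nth_monom_mult by (auto simp: mps_monom_def)
qed

lemma mps_factor_monom:
  fixes f :: "('a::comm_ring_1, 'd::finite) mps"
  assumes "\<And>e. mps_nth f e \<noteq> 0 \<Longrightarrow> q \<le> e"
  shows "f = MPS (\<lambda>e. mps_nth f (\<lambda>i. e i + q i)) * mps_monom q"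
proof (rule mps_eqI)
  fix e
  have "q \<le> e \<Longrightarrow> (\<lambda>i. e i - q i + q i) = e" by (auto simp: le_fun_def)
  thus "mps_nth f e = mps_nth (MPS (\<lambda>e. mps_nth f (\<lambda>i. e i + q i)) * mps_monom q) e"
    using assms[of e] by (auto simp: mps_nth_monom_mult)
qed

text \<open>The weights are powers of a natural number that avoids finitely many polynomial roots.\<close>

lemma separating_weight:
  fixes A :: "('d::finite \<Rightarrow> nat) set"
  assumes "finite A"
  obtains c :: "'d \<Rightarrow> nat" where "inj_on (\<lambda>a. \<Sum>i\<in>UNIV. c i * a i) A"
proof -
  obtain idx :: "'d \<Rightarrow> nat" where idx: "inj idx"
    using finite_imp_inj_to_nat_seg[of "UNIV :: 'd set"] by auto
  \<comment> \<open>An exponent vector becomes the coefficient vector of an integer polynomial, so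
    that the weighted sum with weights \<open>x ^ idx i\<close> is its value at
    \<open>x\<close>.\<close>
  define p :: "('d \<Rightarrow> nat) \<Rightarrow> int poly" where "p a = (\<Sum>i\<in>UNIV. monom (int (a i)) (idx i))" for a
  have coeff: "coeff (p a) (idx i) = int (a i)" for a i
  proof -
    have "coeff (p a) (idx i) = (\<Sum>j\<in>UNIV. if j = i then int (a i) else 0)"
      unfolding p_def coeff_sum by (intro sum.cong) (use idx in \<open>auto simp: inj_def\<close>)
    thus ?thesis by simp
  qed
  define R where "R = (\<Union>(a, b)\<in>{(a, b). a \<in> A \<and> b \<in> A \<and> a \<noteq> b}. {x. poly (p a - p b) x = 0})"
  have "finite R"
    unfolding R_def
  proof (rule finite_UN_I)
    show "finite {(a, b). a \<in> A \<and> b \<in> A \<and> a \<noteq> b}"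
      by (rule finite_subset[of _ "A \<times> A"]) (use assms in auto)
    fix ab assume "ab \<in> {(a, b). a \<in> A \<and> b \<in> A \<and> a \<noteq> b}"
    then obtain a b where ab: "ab = (a, b)" "a \<noteq> b" by auto
    then obtain i where "a i \<noteq> b i" by auto
    hence "coeff (p a - p b) (idx i) \<noteq> 0" by (simp add: coeff)
    hence "p a - p b \<noteq> 0" by (metis coeff_0)
    hence "finite {x. poly (p a - p b) x = 0}" by (rule poly_roots_finite)
    thus "finite (case ab of (a, b) \<Rightarrow> {x. poly (p a - p b) x = 0})"
      by (simp only: ab(1) prod.case)
  qed
  moreover have "infinite (range int)" by (simp add: range_inj_infinite)
  ultimately obtain x where x: "int x \<notin> R" by (meson finite_subset image_subset_iff)
  have ev: "poly (p a) (int x) = int (\<Sum>i\<in>UNIV. x ^ idx i * a i)" for a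
    by (simp add: p_def poly_sum poly_monom mult.commute)
  have "inj_on (\<lambda>a. \<Sum>i\<in>UNIV. x ^ idx i * a i) A"
  proof (rule inj_onI, rule ccontr)
    fix a b assume "a \<in> A" "b \<in> A" "(\<Sum>i\<in>UNIV. x ^ idx i * a i) = (\<Sum>i\<in>UNIV. x ^ idx i * b i)" "a \<noteq> b"
    hence "poly (p a - p b) (int x) = 0" by (simp only: poly_diff ev diff_self)
    hence "int x \<in> R" unfolding R_def using \<open>a \<in> A\<close> \<open>b \<in> A\<close> \<open>a \<noteq> b\<close> by blast
    with x show False by simp
  qed
  thus ?thesis by (rule that)
qed

lemma finite_exponents_of_degree: "finite {a :: 'd::finite \<Rightarrow> nat. (\<Sum>i\<in>UNIV. a i) = n}"
proof (rule finite_subset)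
  show "{a :: 'd \<Rightarrow> nat. (\<Sum>i\<in>UNIV. a i) = n} \<subseteq> {a. a \<le> (\<lambda>_. n)}"
    by (auto simp: le_fun_def intro: member_le_sum)
qed (rule finite_le_fun_nat)

text \<open>The coefficient of the product at \<open>a + b\<close> is a product of two nonzero
  coefficients once \<open>a + b\<close> splits in only one way. Three successive minimisations
  achieve this: the weight \<open>w\<close>, the total degree, which leaves finitely many exponents
  even where \<open>w\<close> vanishes, and a weight separating those. By linearity any other
  splitting would be minimal in all three respects.\<close>

lemma mps_initial_exponents:
  fixes f g :: "('a::idom, 'd::finite) mps" and w :: "'d \<Rightarrow> nat"
  assumes "f \<noteq> 0" "g \<noteq> 0"
  obtains a b where "mps_nth f a \<noteq> 0" "mps_nth g b \<noteq> 0"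
    "\<And>a'. mps_nth f a' \<noteq> 0 \<Longrightarrow> (\<Sum>i\<in>UNIV. w i * a i) \<le> (\<Sum>i\<in>UNIV. w i * a' i)"
    "\<And>b'. mps_nth g b' \<noteq> 0 \<Longrightarrow> (\<Sum>i\<in>UNIV. w i * b i) \<le> (\<Sum>i\<in>UNIV. w i * b' i)"
    "mps_nth (f * g) (\<lambda>i. a i + b i) \<noteq> 0"
proof -
  define W where "W a = (\<Sum>i\<in>UNIV. w i * a i)" for a :: "'d \<Rightarrow> nat"
  define T where "T a = (\<Sum>i\<in>UNIV. a i)" for a :: "'d \<Rightarrow> nat"
  have pre: "\<exists>S s t. finite S \<and> S \<noteq> {} \<and> S = {a. mps_nth h a \<noteq> 0 \<and> W a = s \<and> T a = t} \<and>
      (\<forall>a. mps_nth h a \<noteq> 0 \<longrightarrow> s \<le> W a) \<and> (\<forall>a. mps_nth h a \<noteq> 0 \<and> W a = s \<longrightarrow> t \<le> T a)"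
    if h: "h \<noteq> 0" for h :: "('a, 'd) mps"
  proof -
    from h obtain e where e: "mps_nth h e \<noteq> 0" by (auto simp: mps_eq_0_iff)
    define s where "s = (LEAST s. \<exists>a. mps_nth h a \<noteq> 0 \<and> W a = s)"
    have s: "\<exists>a. mps_nth h a \<noteq> 0 \<and> W a = s" unfolding s_def by (rule LeastI_ex) (use e in auto)
    define t where "t = (LEAST t. \<exists>a. mps_nth h a \<noteq> 0 \<and> W a = s \<and> T a = t)"
    have t: "\<exists>a. mps_nth h a \<noteq> 0 \<and> W a = s \<and> T a = t"
      unfolding t_def by (rule LeastI_ex) (use s in auto)
    have "finite {a. mps_nth h a \<noteq> 0 \<and> W a = s \<and> T a = t}"
      by (rule finite_subset[OF _ finite_exponents_of_degree[of t]]) (auto simp: T_def)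
    moreover have "\<forall>a. mps_nth h a \<noteq> 0 \<longrightarrow> s \<le> W a" unfolding s_def by (auto intro!: Least_le)
    moreover have "\<forall>a. mps_nth h a \<noteq> 0 \<and> W a = s \<longrightarrow> t \<le> T a" unfolding t_def by (auto intro!: Least_le)
    ultimately show ?thesis using t by blast
  qed
  obtain A s t where A: "finite A" "A \<noteq> {}" "A = {a. mps_nth f a \<noteq> 0 \<and> W a = s \<and> T a = t}"
      "\<forall>a. mps_nth f a \<noteq> 0 \<longrightarrow> s \<le> W a" "\<forall>a. mps_nth f a \<noteq> 0 \<and> W a = s \<longrightarrow> t \<le> T a"
    using pre[OF assms(1)] by blast
  obtain B s' t' where B: "finite B" "B \<noteq> {}" "B = {a. mps_nth g a \<noteq> 0 \<and> W a = s' \<and> T a = t'}"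
      "\<forall>a. mps_nth g a \<noteq> 0 \<longrightarrow> s' \<le> W a" "\<forall>a. mps_nth g a \<noteq> 0 \<and> W a = s' \<longrightarrow> t' \<le> T a"
    using pre[OF assms(2)] by blast
  \<comment> \<open>Separating the exponents of \<open>f\<close> alone is enough, since
    \<open>a'\<close> determines \<open>b'\<close>.\<close>
  obtain c :: "'d \<Rightarrow> nat" where c: "inj_on (\<lambda>a. \<Sum>i\<in>UNIV. c i * a i) A"
    using separating_weight[OF A(1)] .
  define L where "L a = (\<Sum>i\<in>UNIV. c i * a i)" for a :: "'d \<Rightarrow> nat"
  obtain a where a: "a \<in> A" "\<And>a'. a' \<in> A \<Longrightarrow> L a \<le> L a'"
    using A(1,2) by (metis (no_types, lifting) arg_min_if_finite(1) arg_min_least)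
  obtain b where b: "b \<in> B" "\<And>b'. b' \<in> B \<Longrightarrow> L b \<le> L b'"
    using B(1,2) by (metis (no_types, lifting) arg_min_if_finite(1) arg_min_least)
  let ?n = "\<lambda>i. a i + b i"
  have "mps_nth (f * g) ?n = (\<Sum>a'\<in>{a'. a' \<le> ?n}. if a' = a then mps_nth f a * mps_nth g b else 0)"
    unfolding mps_nth_mult
  proof (intro sum.cong refl)
    fix a' assume a': "a' \<in> {a'. a' \<le> ?n}"
    define b' where "b' = (\<lambda>i. ?n i - a' i)"
    have sum: "a i + b i = a' i + b' i" for i using a' by (auto simp: b'_def le_fun_def)
    have lin: "(\<Sum>i\<in>UNIV. v i * a i) + (\<Sum>i\<in>UNIV. v i * b i) =
        (\<Sum>i\<in>UNIV. v i * a' i) + (\<Sum>i\<in>UNIV. v i * b' i)" for v :: "'d \<Rightarrow> nat"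
      by (simp add: sum.distrib[symmetric] distrib_left[symmetric] sum)
    have "a' = a" if nz: "mps_nth f a' \<noteq> 0" "mps_nth g b' \<noteq> 0"
    proof -
      have "W a + W b = W a' + W b'" using lin[of w] by (simp add: W_def)
      moreover have "s \<le> W a'" "s' \<le> W b'" "W a = s" "W b = s'" using A B a b nz by auto
      ultimately have W: "W a' = s" "W b' = s'" by auto
      have "T a + T b = T a' + T b'" using lin[of "\<lambda>_. 1"] by (simp add: T_def)
      moreover have "t \<le> T a'" "t' \<le> T b'" "T a = t" "T b = t'" using A B a b nz W by auto
      ultimately have "T a' = t" "T b' = t'" by auto
      hence in': "a' \<in> A" "b' \<in> B" using A B W nz by auto
      have "L a + L b = L a' + L b'" using lin[of c] by (simp add: L_def)
      moreover have "L a \<le> L a'" "L b \<le> L b'" using a b in' by auto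
      ultimately have "L a = L a'" by auto
      thus ?thesis using c a(1) in' by (auto simp: inj_on_def L_def)
    qed
    thus "mps_nth f a' * mps_nth g (\<lambda>i. ?n i - a' i) =
        (if a' = a then mps_nth f a * mps_nth g b else 0)"
      by (auto simp: b'_def)
  qed
  also have "\<dots> = mps_nth f a * mps_nth g b"
    by (subst sum.delta) (use finite_le_fun_nat[of ?n] in \<open>auto simp: le_fun_def\<close>)
  also have "\<dots> \<noteq> 0" using a b A B by auto
  finally have "mps_nth (f * g) ?n \<noteq> 0" .
  thus ?thesis using that[of a b] a(1) b(1) A B unfolding W_def by auto
qed

instance mps :: (idom, finite) idom
proof
  fix a b :: "('a, 'b) mps"
  assume "a \<noteq> 0" "b \<noteq> 0"
  thus "a * b \<noteq> 0" by (metis mps_initial_exponents[of a b] mps_nth_0)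
qed

lemma mps_nth_of_nat: "mps_nth (of_nat n :: ('a::comm_ring_1, 'd::finite) mps) e =
    (if e = (\<lambda>_. 0) then of_nat n else 0)"
  by (induction n) (auto simp: mps_nth_1)

instance mps :: ("{comm_ring_1, ring_char_0}", finite) ring_char_0
proof
  show "inj (of_nat :: nat \<Rightarrow> ('a, 'b) mps)"
  proof (rule injI)
    fix x y :: nat assume "(of_nat x :: ('a, 'b) mps) = of_nat y"
    from arg_cong[OF this, of "\<lambda>f. mps_nth f (\<lambda>_. 0)"] show "x = y" by (simp add: mps_nth_of_nat)
  qed
qed

section \<open>Series that are a unit times a monomial\<close>

text \<open>The coefficient form of "unit times monomial", the shape required of discriminants and
  of root differences; in this form it is easily transported along the group action and the
  substitution \<open>X = T^m\<close>.\<close>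

definition dominant :: "('a::zero, 'd) mps \<Rightarrow> ('d \<Rightarrow> nat) \<Rightarrow> bool" where
  "dominant f q \<longleftrightarrow> mps_nth f q \<noteq> 0 \<and> (\<forall>e. mps_nth f e \<noteq> 0 \<longrightarrow> q \<le> e)"

lemma dominant_iff:
  fixes f :: "('a::comm_ring_1, 'd::finite) mps"
  shows "dominant f q \<longleftrightarrow> (\<exists>u. f = u * mps_monom q \<and> mps_const_coeff u \<noteq> 0)"
proof
  assume "dominant f q"
  thus "\<exists>u. f = u * mps_monom q \<and> mps_const_coeff u \<noteq> 0"
    using mps_factor_monom[of f q]
    by (intro exI[of _ "MPS (\<lambda>e. mps_nth f (\<lambda>i. e i + q i))"])
       (auto simp: dominant_def mps_const_coeff_def)
next
  assume "\<exists>u. f = u * mps_monom q \<and> mps_const_coeff u \<noteq> 0"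
  thus "dominant f q"
    by (auto simp: dominant_def mps_nth_monom_mult mps_const_coeff_def split: if_splits)
qed

lemma dominant_unique: "dominant f q \<Longrightarrow> dominant f q' \<Longrightarrow> q = q'"
  by (auto simp: dominant_def intro: antisym)

lemma dominant_nonzero: "dominant f q \<Longrightarrow> f \<noteq> 0"
  by (auto simp: dominant_def)

lemma mps_const_coeff_simps [simp]:
  "mps_const_coeff 0 = 0" "mps_const_coeff 1 = 1"
  "mps_const_coeff (f + g) = mps_const_coeff f + mps_const_coeff g"
  "mps_const_coeff (f - g) = mps_const_coeff f - mps_const_coeff g"
  "mps_const_coeff (- f) = - mps_const_coeff f"
  by (auto simp: mps_const_coeff_def mps_nth_1)

lemma mps_const_coeff_mult [simp]:
  fixes f g :: "('a::comm_ring_1, 'd::finite) mps"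
  shows "mps_const_coeff (f * g) = mps_const_coeff f * mps_const_coeff g"
proof -
  have "{a :: 'd \<Rightarrow> nat. a \<le> (\<lambda>_. 0)} = {\<lambda>_. 0}" by (auto simp: le_fun_def)
  thus ?thesis by (simp add: mps_const_coeff_def mps_nth_mult)
qed

lemma mps_const_coeff_hom:
  "comm_ring_hom (mps_const_coeff :: ('a::comm_ring_1, 'd::finite) mps \<Rightarrow> 'a)"
  by unfold_locales simp_all

lemma dominant_mult:
  fixes f g :: "('a::idom, 'd::finite) mps"
  assumes "dominant f a" "dominant g b"
  shows "dominant (f * g) (\<lambda>i. a i + b i)"
proof -
  from assms obtain u v where "f = u * mps_monom a" "g = v * mps_monom b"
    "mps_const_coeff u \<noteq> 0" "mps_const_coeff v \<noteq> 0" by (auto simp: dominant_iff)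
  thus ?thesis unfolding dominant_iff
    by (intro exI[of _ "u * v"]) (auto simp: mps_monom_mult[symmetric] mult_ac)
qed

lemma dominant_one: "dominant (1 :: ('a::comm_ring_1, 'd::finite) mps) (\<lambda>_. 0)"
  by (auto simp: dominant_def mps_nth_1 le_fun_def)

lemma dominant_prod:
  fixes f :: "'b \<Rightarrow> ('a::idom, 'd::finite) mps"
  assumes "finite A" "\<And>x. x \<in> A \<Longrightarrow> dominant (f x) (e x)"
  shows "dominant (\<Prod>x\<in>A. f x) (\<lambda>i. \<Sum>x\<in>A. e x i)"
  using assms
proof (induction A)
  case empty
  show ?case by (simp add: dominant_one)
next
  case (insert x A)
  thus ?case using dominant_mult[of "f x" "e x"] by simp
qed

text \<open>With the indicator of \<open>i\<close> as weight, this is the additivity of the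
  \<open>T_i\<close>-adic order.\<close>

lemma mps_min_coordinate:
  fixes f g :: "('a::idom, 'd::finite) mps"
  assumes "f \<noteq> 0" "g \<noteq> 0"
  obtains a b where "mps_nth f a \<noteq> 0" "mps_nth g b \<noteq> 0"
    "\<And>a'. mps_nth f a' \<noteq> 0 \<Longrightarrow> a i \<le> a' i" "\<And>b'. mps_nth g b' \<noteq> 0 \<Longrightarrow> b i \<le> b' i"
    "mps_nth (f * g) (\<lambda>i. a i + b i) \<noteq> 0"
proof -
  have *: "(\<Sum>j\<in>UNIV. (if j = i then 1 else 0) * a j) = a i" for a :: "'d \<Rightarrow> nat"
  proof -
    have "(\<Sum>j\<in>UNIV. (if j = i then 1 else 0) * a j) = (\<Sum>j\<in>UNIV. if j = i then a j else 0)"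
      by (intro sum.cong) auto
    thus ?thesis by simp
  qed
  show ?thesis
    by (rule mps_initial_exponents[OF assms, of "\<lambda>j. if j = i then 1 else 0"],
        rule that) (simp_all only: * not_False_eq_True)
qed

text \<open>Some splitting \<open>q = a + b\<close> uses exponents of both factors, so
  \<open>a\<close> and \<open>b\<close> are at least the orders of \<open>f\<close> and
  \<open>g\<close> in each variable. These orders add up to at least \<open>q\<close>, hence
  \<open>a\<close> attains all orders of \<open>f\<close> at once.\<close>

lemma dominant_factor:
  fixes f g :: "('a::idom, 'd::finite) mps"
  assumes dom: "dominant (f * g) q"
  obtains e where "dominant f e"
proof -
  have nz: "f \<noteq> 0" "g \<noteq> 0" using dominant_nonzero[OF dom] by auto
  from dom have "mps_nth (f * g) q \<noteq> 0" by (simp add: dominant_def)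
  then obtain a b where ab: "mps_nth f a \<noteq> 0" "mps_nth g b \<noteq> 0" "q = (\<lambda>i. a i + b i)"
    by (rule mps_nth_mult_nonzeroE)
  have "a i \<le> e i" if e: "mps_nth f e \<noteq> 0" for e i
  proof -
    obtain a' b' where 1: "mps_nth f a' \<noteq> 0" "mps_nth g b' \<noteq> 0"
      "\<And>x. mps_nth f x \<noteq> 0 \<Longrightarrow> a' i \<le> x i" "\<And>x. mps_nth g x \<noteq> 0 \<Longrightarrow> b' i \<le> x i"
      "mps_nth (f * g) (\<lambda>i. a' i + b' i) \<noteq> 0"
      by (rule mps_min_coordinate[OF nz, of i]) blast
    from 1(5) dom have "q \<le> (\<lambda>i. a' i + b' i)" by (simp add: dominant_def)
    hence "a i + b i \<le> a' i + b' i" unfolding ab(3) by (auto simp: le_fun_def)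
    moreover have "b' i \<le> b i" using 1 ab by auto
    moreover have "a' i \<le> e i" using 1 e by auto
    ultimately show ?thesis by linarith
  qed
  hence "dominant f a" using ab by (auto simp: dominant_def le_fun_def)
  thus ?thesis by (rule that)
qed

section \<open>Hensel's lemma for power series in several variables\<close>

lemma poly_taylor_2:
  fixes p :: "'a::idom poly"
  shows "\<exists>w. poly p (x + h) = poly p x + poly (pderiv p) x * h + w * h\<^sup>2"
proof (induction p)
  case 0
  show ?case by (intro exI[of _ 0]) simp
next
  case (pCons a p)
  then obtain w where w: "poly p (x + h) = poly p x + poly (pderiv p) x * h + w * h\<^sup>2" by blast
  have "poly (pCons a p) (x + h) = a + (x + h) * (poly p x + poly (pderiv p) x * h + w * h\<^sup>2)"
    by (simp only: poly_pCons w)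
  thus ?case
    by (intro exI[of _ "poly (pderiv p) x + x * w + h * w"])
       (simp add: pderiv_pCons algebra_simps power2_eq_square)
qed

text \<open>Membership in the \<open>n\<close>-th power of the maximal ideal, the filtration in
  which the iteration below converges.\<close>

definition ord_ge :: "nat \<Rightarrow> ('a::zero, 'd::finite) mps \<Rightarrow> bool" where
  "ord_ge n f \<longleftrightarrow> (\<forall>e. mps_nth f e \<noteq> 0 \<longrightarrow> n \<le> (\<Sum>i\<in>UNIV. e i))"

lemma ord_ge_add: "ord_ge n f \<Longrightarrow> ord_ge n g \<Longrightarrow> ord_ge n (f + g)"
  for f g :: "('a::comm_ring_1, 'd::finite) mps"
  by (force simp: ord_ge_def)

lemma ord_ge_uminus: "ord_ge n f \<Longrightarrow> ord_ge n (- f)"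
  for f :: "('a::comm_ring_1, 'd::finite) mps"
  by (auto simp: ord_ge_def)

lemma ord_ge_diff: "ord_ge n f \<Longrightarrow> ord_ge n g \<Longrightarrow> ord_ge n (f - g)"
  for f g :: "('a::comm_ring_1, 'd::finite) mps"
  by (force simp: ord_ge_def)

lemma ord_ge_mult: "ord_ge n f \<Longrightarrow> ord_ge k g \<Longrightarrow> ord_ge (n + k) (f * g)"
  for f g :: "('a::comm_ring_1, 'd::finite) mps"
  unfolding ord_ge_def
  by (auto elim!: mps_nth_mult_nonzeroE simp: sum.distrib add_mono)

lemma ord_ge_0: "ord_ge 0 f" by (simp add: ord_ge_def)

lemma ord_ge_mono: "ord_ge n f \<Longrightarrow> k \<le> n \<Longrightarrow> ord_ge k f"
  by (force simp: ord_ge_def)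

lemma ord_ge_1_iff: "ord_ge 1 f \<longleftrightarrow> mps_const_coeff f = 0"
proof
  assume "ord_ge 1 f"
  from this[unfolded ord_ge_def, rule_format, of "\<lambda>_. 0"] show "mps_const_coeff f = 0"
    by (auto simp: mps_const_coeff_def)
next
  assume *: "mps_const_coeff f = 0"
  show "ord_ge 1 f" unfolding ord_ge_def
  proof (intro allI impI)
    fix e assume "mps_nth f e \<noteq> 0"
    with * have "e \<noteq> (\<lambda>_. 0)" by (auto simp: mps_const_coeff_def)
    hence "(\<Sum>i\<in>UNIV. e i) \<noteq> 0" by (auto simp: fun_eq_iff)
    thus "1 \<le> (\<Sum>i\<in>UNIV. e i)" by linarith
  qed
qed

definition mps_const :: "'a::zero \<Rightarrow> ('a, 'd) mps" where
  "mps_const c = MPS (\<lambda>e. if e = (\<lambda>_. 0) then c else 0)"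

lemma mps_const_coeff_const [simp]: "mps_const_coeff (mps_const c) = c"
  by (simp add: mps_const_coeff_def mps_const_def)

text \<open>Newton iteration with the derivative frozen at its value on the reduction.\<close>

lemma mps_hensel:
  fixes p :: "('a::field, 'd::finite) mps poly"
  assumes root: "poly (map_poly mps_const_coeff p) c = 0"
    and simple: "poly (pderiv (map_poly mps_const_coeff p)) c \<noteq> 0"
  obtains z where "poly p z = 0" "mps_const_coeff z = c"
proof -
  interpret cc: comm_ring_hom "mps_const_coeff :: ('a, 'd) mps \<Rightarrow> 'a" by (rule mps_const_coeff_hom)
  interpret ccp: map_poly_comm_ring_hom "mps_const_coeff :: ('a, 'd) mps \<Rightarrow> 'a" ..
  have ev: "mps_const_coeff (poly q x) = poly (map_poly mps_const_coeff q) (mps_const_coeff x)"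
    for q :: "('a, 'd) mps poly" and x by simp
  have der: "map_poly mps_const_coeff (pderiv p) = pderiv (map_poly mps_const_coeff p)"
    by (rule poly_eqI) (simp add: coeff_pderiv coeff_map_poly mps_const_coeff_def[of "of_nat _"] mps_nth_of_nat)
  define s where "s = poly (pderiv (map_poly mps_const_coeff p)) c"
  have s: "s \<noteq> 0" using simple by (simp add: s_def)
  define t :: "('a, 'd) mps" where "t = mps_const (inverse s)"
  define z where "z = rec_nat (mps_const c :: ('a, 'd) mps) (\<lambda>_ x. x - t * poly p x)"
  have z0: "z 0 = mps_const c" and zS: "z (Suc n) = z n - t * poly p (z n)" for n
    by (simp_all add: z_def)
  have step: "mps_const_coeff (z n) = c \<and> ord_ge (Suc n) (poly p (z n))" for n
  proof (induction n)
    case 0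
    have "mps_const_coeff (poly p (z 0)) = 0" using root by (simp only: ev z0 mps_const_coeff_const)
    thus ?case using ord_ge_1_iff[of "poly p (z 0)"] by (simp add: z0)
  next
    case (Suc n)
    hence c: "mps_const_coeff (z n) = c" and o: "ord_ge (Suc n) (poly p (z n))" by auto
    define h where "h = - (t * poly p (z n))"
    have oh: "ord_ge (Suc n) h"
      unfolding h_def using ord_ge_uminus ord_ge_mult[OF ord_ge_0 o, of t] by simp
    have zh: "z (Suc n) = z n + h" by (simp add: zS h_def)
    obtain w where w: "poly p (z n + h) = poly p (z n) + poly (pderiv p) (z n) * h + w * h\<^sup>2"
      using poly_taylor_2 by blast
    have "poly p (z (Suc n)) = (1 - poly (pderiv p) (z n) * t) * poly p (z n) + w * (h * h)"
      unfolding zh w by (simp add: h_def algebra_simps power2_eq_square)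
    \<comment> \<open>\<open>t\<close> inverts the derivative up to a series without constant
      coefficient, so this term gains one order. The quadratic remainder has order at least
      \<open>2 (n + 1)\<close>, which also suffices.\<close>
    moreover have "ord_ge (1 + Suc n) ((1 - poly (pderiv p) (z n) * t) * poly p (z n))"
    proof (rule ord_ge_mult[OF _ o])
      have "mps_const_coeff (poly (pderiv p) (z n)) = s" by (simp only: ev c der s_def)
      thus "ord_ge 1 (1 - poly (pderiv p) (z n) * t)"
        unfolding ord_ge_1_iff using s by (simp add: t_def)
    qed
    moreover have "ord_ge (Suc (Suc n)) (w * (h * h))"
      using ord_ge_mult[OF ord_ge_0 ord_ge_mult[OF oh oh], of w] by (rule ord_ge_mono) simp
    ultimately have "ord_ge (Suc (Suc n)) (poly p (z (Suc n)))"
      using ord_ge_add by fastforce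
    moreover have "ord_ge 1 h" by (rule ord_ge_mono[OF oh]) simp
    hence "mps_const_coeff h = 0" by (simp only: ord_ge_1_iff)
    ultimately show ?case using c unfolding zh by simp
  qed
  have cauchy: "ord_ge (Suc n) (z (n + k) - z n)" for n k
  proof (induction k)
    case 0
    show ?case by (simp add: ord_ge_def)
  next
    case (Suc k)
    have "ord_ge (Suc n) (t * poly p (z (n + k)))"
      using ord_ge_mult[OF ord_ge_0 conjunct2[OF step[of "n + k"]], of t] by (rule ord_ge_mono) simp
    from ord_ge_diff[OF Suc this] show ?case by (simp add: zS algebra_simps)
  qed
  \<comment> \<open>Corrections made after stage \<open>n\<close> have order above \<open>n\<close>,
    so coefficients of total degree \<open>n\<close> are final from stage \<open>n\<close>
    on.\<close>
  define y where "y = MPS (\<lambda>e. mps_nth (z (\<Sum>i\<in>UNIV. e i)) e)"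
  have y: "ord_ge (Suc n) (y - z n)" for n
    unfolding ord_ge_def
  proof (intro allI impI, rule ccontr)
    fix e assume nz: "mps_nth (y - z n) e \<noteq> 0" and "\<not> Suc n \<le> (\<Sum>i\<in>UNIV. e i)"
    then obtain k where k: "n = (\<Sum>i\<in>UNIV. e i) + k" by (metis not_less_eq_eq le_iff_add)
    from nz cauchy[of "\<Sum>i\<in>UNIV. e i" k, folded k, unfolded ord_ge_def, rule_format, of e]
    show False by (auto simp: y_def)
  qed
  have "ord_ge (Suc n) (poly p y)" for n
  proof -
    define h where "h = y - z n"
    obtain w where w: "poly p (z n + h) = poly p (z n) + poly (pderiv p) (z n) * h + w * h\<^sup>2"
      using poly_taylor_2 by blast
    have "poly p y = poly p (z n) + (poly (pderiv p) (z n) + w * h) * h"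
      using w by (simp add: h_def algebra_simps power2_eq_square)
    moreover have "ord_ge (Suc n) ((poly (pderiv p) (z n) + w * h) * h)"
      using ord_ge_mult[OF ord_ge_0 y[of n], of "poly (pderiv p) (z n) + w * h"]
      by (simp add: h_def)
    ultimately show ?thesis using ord_ge_add step[of n] by metis
  qed
  hence "poly p y = 0" unfolding mps_eq_0_iff ord_ge_def using Suc_n_not_le_n by blast
  moreover have "ord_ge 1 (y - z 0)" using y[of 0] by simp
  hence "mps_const_coeff (y - z 0) = 0" by (simp only: ord_ge_1_iff)
  hence "mps_const_coeff y = c" by (simp add: z0)
  ultimately show ?thesis by (rule that)
qed

section \<open>Roots of unity, and tuples of them acting on power series\<close>

definition alg_closed_in :: "'a::comm_ring_1 itself \<Rightarrow> bool" where
  "alg_closed_in _ \<longleftrightarrow> (\<forall>p :: 'a poly. degree p > 0 \<longrightarrow> (\<exists>x. poly p x = 0))"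

lemma card_roots_eq_degree:
  fixes p :: "'a::field_char_0 poly"
  assumes "alg_closed_in TYPE('a)" "p \<noteq> 0"
    "\<And>x. poly p x = 0 \<Longrightarrow> poly (pderiv p) x \<noteq> 0"
  shows "card {x. poly p x = 0} = degree p"
  using assms(2,3)
proof (induction "degree p" arbitrary: p)
  case 0
  then obtain c where "p = [:c:]" "c \<noteq> 0" by (metis degree_eq_zeroE pCons_0_0)
  thus ?case by simp
next
  case (Suc n)
  obtain x where x: "poly p x = 0"
    using assms(1) Suc(2) unfolding alg_closed_in_def by (metis zero_less_Suc)
  then obtain q where p: "p = [:-x, 1:] * q" by (metis dvdE poly_eq_0_iff_dvd)
  have q0: "q \<noteq> 0" using Suc p by auto
  have der: "poly (pderiv p) y = poly q y + (y - x) * poly (pderiv q) y" for y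
    unfolding p pderiv_mult by (simp add: pderiv_pCons algebra_simps)
  have qx: "poly q x \<noteq> 0" using Suc.prems(2)[OF x] der[of x] by simp
  have deg: "degree p = Suc (degree q)"
    unfolding p using q0 by (subst degree_mult_eq) auto
  have roots: "poly p y = 0 \<longleftrightarrow> y = x \<or> poly q y = 0" for y
    unfolding p by (auto simp: algebra_simps)
  have "card {y. poly q y = 0} = degree q"
  proof (rule Suc.hyps(1))
    show "n = degree q" using deg Suc(2) by simp
    fix y assume y: "poly q y = 0"
    hence "poly p y = 0" using roots by blast
    from Suc.prems(2)[OF this] der[of y] y show "poly (pderiv q) y \<noteq> 0" by auto
  qed (use q0 in auto)
  moreover have "{y. poly p y = 0} = insert x {y. poly q y = 0}" using roots by auto
  ultimately show ?case using deg qx poly_roots_finite[OF q0] by simp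
qed

lemma finite_unity_roots: "m > 0 \<Longrightarrow> finite {z :: 'a::field. z ^ m = 1}"
proof -
  assume "m > 0"
  hence "coeff (monom 1 m - 1 :: 'a poly) m \<noteq> 0" by simp
  hence "monom 1 m - 1 \<noteq> (0 :: 'a poly)" by (metis coeff_0)
  from poly_roots_finite[OF this] show ?thesis by (simp add: poly_monom)
qed

lemma card_unity_roots:
  assumes "alg_closed_in TYPE('a::field_char_0)" "m > 0"
  shows "card {z :: 'a. z ^ m = 1} = m"
proof -
  let ?p = "monom 1 m - 1 :: 'a poly"
  have c: "coeff ?p m \<noteq> 0" using assms(2) by simp
  hence nz: "?p \<noteq> 0" by (metis coeff_0)
  have "degree ?p = m"
  proof (rule antisym)
    show "degree ?p \<le> m" by (rule degree_diff_le) (auto simp: degree_monom_le)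
  qed (use c le_degree in blast)
  moreover have "card {x. poly ?p x = 0} = degree ?p"
  proof (rule card_roots_eq_degree[OF assms(1) nz])
    fix x assume "poly ?p x = 0"
    hence "x ^ m = 1" by (simp add: poly_monom)
    hence "x \<noteq> 0" using assms(2) by (auto simp: power_0_left)
    thus "poly (pderiv ?p) x \<noteq> 0" using assms(2)
      by (simp add: pderiv_diff pderiv_monom poly_monom pderiv_1)
  qed
  ultimately show ?thesis by (simp add: poly_monom)
qed

text \<open>By Bezout, if the power \<open>e\<close> kills all \<open>m\<close>-th roots of unity,
  so does \<open>gcd m e\<close>; but only \<open>gcd m e\<close> elements are killed by it, fewer
  than \<open>m\<close> unless \<open>m\<close> divides \<open>e\<close>.\<close>

lemma unity_root_separating:
  assumes "alg_closed_in TYPE('a::field_char_0)" "m > 0" "\<not> m dvd e"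
  obtains z :: "'a::field_char_0" where "z ^ m = 1" "z ^ e \<noteq> 1"
proof (rule ccontr)
  assume "\<not> thesis"
  hence *: "z ^ e = 1" if "z ^ m = 1" for z :: 'a using that \<open>\<And>z. z ^ m = 1 \<Longrightarrow> z ^ e \<noteq> 1 \<Longrightarrow> thesis\<close> by blast
  obtain x y where xy: "m * x = e * y + gcd m e"
    using bezout_nat[of m e] assms(2) by auto
  have "z ^ gcd m e = 1" if z: "z ^ m = 1" for z :: 'a
  proof -
    have "(z ^ m) ^ x = (z ^ e) ^ y * z ^ gcd m e"
      unfolding power_mult[symmetric] xy power_add ..
    thus ?thesis using z *[OF z] by simp
  qed
  moreover have g: "gcd m e > 0" using assms(2) by simp
  ultimately have "card {z :: 'a. z ^ m = 1} \<le> card {z :: 'a. z ^ gcd m e = 1}"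
    by (intro card_mono finite_unity_roots) auto
  hence "m \<le> gcd m e" using card_unity_roots[OF assms(1)] assms(2) g by metis
  hence "gcd m e = m" using assms(2) by (metis dvd_imp_le gcd_dvd1 le_antisym)
  hence "m dvd e" by (metis gcd_dvd2)
  with assms(3) show False by simp
qed

text \<open>\<open>mu_group m\<close> plays the role of the Galois group of \<open>K((T))\<close> over \<open>K((X))\<close>, where \<open>X = T^m\<close>.\<close>

definition mu_group :: "nat \<Rightarrow> ('d \<Rightarrow> 'a::field) set" where
  "mu_group m = {s. \<forall>i. s i ^ m = 1}"

text \<open>The character through which the group acts on the monomial \<open>T^e\<close>. On
  \<open>mu_group m\<close> it depends on \<open>e\<close> only modulo \<open>m\<close>, so
  characters tell residue classes of exponents apart.\<close>

definition chi :: "('d::finite \<Rightarrow> 'a::field) \<Rightarrow> ('d \<Rightarrow> nat) \<Rightarrow> 'a" where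
  "chi s e = (\<Prod>i\<in>UNIV. s i ^ e i)"

definition act :: "('d::finite \<Rightarrow> 'a::field) \<Rightarrow> ('a, 'd) mps \<Rightarrow> ('a, 'd) mps" where
  "act s f = MPS (\<lambda>e. chi s e * mps_nth f e)"

lemma mps_nth_act [simp]: "mps_nth (act s f) e = chi s e * mps_nth f e"
  by (simp add: act_def)

lemma chi_zero [simp]: "chi s (\<lambda>_. 0) = 1"
  and chi_one [simp]: "chi (\<lambda>_. 1) e = 1"
  and chi_add: "chi s (\<lambda>i. a i + b i) = chi s a * chi s b"
  and chi_times: "chi (\<lambda>i. s i * t i) e = chi s e * chi t e"
  and chi_inverse: "chi (\<lambda>i. inverse (s i)) e = inverse (chi s e)"
  by (simp_all add: chi_def power_add power_mult_distrib prod.distrib power_inverse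
      prod_inversef[symmetric])

lemma chi_sum: "finite A \<Longrightarrow> chi s (\<lambda>i. \<Sum>x\<in>A. e x i) = (\<Prod>x\<in>A. chi s (e x))"
  by (induction A rule: finite_induct) (auto simp: chi_add)

lemma chi_scale: "chi s (\<lambda>i. n * e i) = chi s e ^ n"
  by (simp add: chi_def prod_power_distrib power_mult[symmetric] mult.commute)

lemma chi_multiple: "s \<in> mu_group m \<Longrightarrow> chi s (\<lambda>i. m * e i) = 1"
  by (simp add: chi_def mu_group_def power_mult)

lemma mu_group_one: "(\<lambda>_. 1) \<in> mu_group m"
  and mu_group_times: "s \<in> mu_group m \<Longrightarrow> t \<in> mu_group m \<Longrightarrow> (\<lambda>i. s i * t i) \<in> mu_group m"
  and mu_group_inverse: "s \<in> mu_group m \<Longrightarrow> (\<lambda>i. inverse (s i)) \<in> mu_group m"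
  by (auto simp: mu_group_def power_mult_distrib power_inverse)

lemma mu_group_nonzero: "s \<in> mu_group m \<Longrightarrow> m > 0 \<Longrightarrow> s i \<noteq> 0"
  by (auto simp: mu_group_def) (metis power_eq_0_iff zero_neq_one)

lemma chi_nonzero: "s \<in> mu_group m \<Longrightarrow> m > 0 \<Longrightarrow> chi s e \<noteq> 0"
  by (auto simp: chi_def mu_group_nonzero)

lemma finite_mu_group:
  assumes "m > 0"
  shows "finite (mu_group m :: ('d::finite \<Rightarrow> 'a::field) set)"
proof -
  have "(mu_group m :: ('d \<Rightarrow> 'a) set) = PiE UNIV (\<lambda>_. {z. z ^ m = 1})"
    by (auto simp: mu_group_def PiE_def extensional_def)
  thus ?thesis using finite_PiE[of UNIV "\<lambda>_ :: 'd. {z :: 'a. z ^ m = 1}"] finite_unity_roots[OF assms]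
    by simp
qed

lemma act_mult: "act s (f * g) = act s f * act s g"
proof (rule mps_eqI)
  fix n
  have "chi s n = chi s a * chi s (\<lambda>i. n i - a i)" if "a \<le> n" for a
  proof -
    have "n = (\<lambda>i. a i + (n i - a i))" using that by (auto simp: le_fun_def)
    thus ?thesis using chi_add by metis
  qed
  thus "mps_nth (act s (f * g)) n = mps_nth (act s f * act s g) n"
    by (auto simp: mps_nth_mult sum_distrib_left intro!: sum.cong)
qed

lemma act_0: "act s 0 = 0" by (rule mps_eqI) simp

lemma act_hom: "comm_ring_hom (act s)"
  by unfold_locales
     (auto intro!: mps_eqI simp: act_mult[unfolded act_def] mps_nth_1 distrib_left act_mult)

lemma act_act: "act s (act t f) = act (\<lambda>i. s i * t i) f"
  by (rule mps_eqI) (simp add: chi_times)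

lemma act_one: "act (\<lambda>_. 1) f = f"
  by (rule mps_eqI) simp

lemma act_inverse:
  assumes "s \<in> mu_group m" "m > 0"
  shows "act (\<lambda>i. inverse (s i)) (act s f) = f"
  unfolding act_act using mu_group_nonzero[OF assms] act_one by simp

lemma dominant_act:
  assumes "s \<in> mu_group m" "m > 0" "dominant f e"
  shows "dominant (act s f) e"
  using assms chi_nonzero[OF assms(1,2)] by (auto simp: dominant_def)

section \<open>The substitution \<open>X = T^m\<close> and the invariants of the group\<close>

lemma mps_nth_ramify:
  "mps_nth (ramify m f) e = (if \<forall>i. m dvd e i then mps_nth f (\<lambda>i. e i div m) else 0)"
  by (simp add: ramify_def)

lemma mps_nth_ramify_scale:
  assumes "m > 0"
  shows "mps_nth (ramify m f) (\<lambda>i. m * e i) = mps_nth f e"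
  using assms by (simp add: mps_nth_ramify)

lemma mps_nth_ramify_nonzeroE:
  assumes "mps_nth (ramify m f) e \<noteq> 0" "m > 0"
  obtains a where "e = (\<lambda>i. m * a i)" "mps_nth f a \<noteq> 0"
  using assms that[of "\<lambda>i. e i div m"] by (auto simp: mps_nth_ramify split: if_splits)

lemma ramify_mult:
  fixes f g :: "('a::comm_ring_1, 'd::finite) mps"
  assumes m: "m > 0"
  shows "ramify m (f * g) = ramify m f * ramify m g"
proof (rule mps_eqI)
  fix n :: "'d \<Rightarrow> nat"
  show "mps_nth (ramify m (f * g)) n = mps_nth (ramify m f * ramify m g) n"
  proof (cases "\<forall>i. m dvd n i")
    case False
    have "mps_nth (ramify m f * ramify m g) n = 0"
    proof (rule ccontr)
      assume "mps_nth (ramify m f * ramify m g) n \<noteq> 0"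
      then obtain a b where "mps_nth (ramify m f) a \<noteq> 0" "mps_nth (ramify m g) b \<noteq> 0"
        "n = (\<lambda>i. a i + b i)" by (rule mps_nth_mult_nonzeroE)
      with False show False by (auto simp: mps_nth_ramify split: if_splits)
    qed
    with False show ?thesis by (auto simp: mps_nth_ramify)
  next
    case True
    define k where "k = (\<lambda>i. n i div m)"
    have n: "n = (\<lambda>i. m * k i)" using True m by (auto simp: k_def)
    have "mps_nth (ramify m f * ramify m g) n =
        (\<Sum>a\<in>(\<lambda>a i. m * a i) ` {a. a \<le> k}. mps_nth (ramify m f) a * mps_nth (ramify m g) (\<lambda>i. n i - a i))"
      unfolding mps_nth_mult
    proof (rule sum.mono_neutral_right)
      show "(\<lambda>a i. m * a i) ` {a. a \<le> k} \<subseteq> {a. a \<le> n}" by (auto simp: n le_fun_def)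
      show "\<forall>a\<in>{a. a \<le> n} - (\<lambda>a i. m * a i) ` {a. a \<le> k}.
          mps_nth (ramify m f) a * mps_nth (ramify m g) (\<lambda>i. n i - a i) = 0"
      proof
        fix a assume a: "a \<in> {a. a \<le> n} - (\<lambda>a i. m * a i) ` {a. a \<le> k}"
        have "mps_nth (ramify m f) a = 0"
        proof (rule ccontr)
          assume "mps_nth (ramify m f) a \<noteq> 0"
          then obtain b where "a = (\<lambda>i. m * b i)" using m by (rule mps_nth_ramify_nonzeroE)
          with a m show False by (auto simp: n le_fun_def)
        qed
        thus "mps_nth (ramify m f) a * mps_nth (ramify m g) (\<lambda>i. n i - a i) = 0" by simp
      qed
    qed (rule finite_le_fun_nat)
    also have "\<dots> = (\<Sum>a\<in>{a. a \<le> k}. mps_nth f a * mps_nth g (\<lambda>i. k i - a i))"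
      using m by (subst sum.reindex)
        (auto simp: inj_on_def fun_eq_iff n mps_nth_ramify diff_mult_distrib2[symmetric])
    also have "\<dots> = mps_nth (ramify m (f * g)) n"
      unfolding n mps_nth_ramify_scale[OF m] mps_nth_mult ..
    finally show ?thesis ..
  qed
qed

lemma ramify_hom:
  assumes "m > 0"
  shows "inj_comm_ring_hom (ramify m :: ('a::comm_ring_1, 'd::finite) mps \<Rightarrow> _)"
proof
  fix x y :: "('a, 'd) mps"
  show "ramify m (x + y) = ramify m x + ramify m y" by (rule mps_eqI) (auto simp: mps_nth_ramify)
  show "ramify m (x * y) = ramify m x * ramify m y" by (rule ramify_mult[OF assms])
  show "ramify m (0 :: ('a, 'd) mps) = 0" by (rule mps_eqI) (auto simp: mps_nth_ramify)
  show "ramify m (1 :: ('a, 'd) mps) = 1"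
  proof (rule mps_eqI)
    fix e :: "'d \<Rightarrow> nat"
    have "(\<forall>i. m dvd e i) \<and> (\<lambda>i. e i div m) = (\<lambda>_. 0) \<longleftrightarrow> e = (\<lambda>_. 0)"
      using assms by (auto simp: fun_eq_iff dvd_div_eq_0_iff)
    thus "mps_nth (ramify m (1 :: ('a, 'd) mps)) e = mps_nth 1 e"
      unfolding mps_nth_ramify mps_nth_1 by auto
  qed
  show "x = 0" if "ramify m x = 0"
    using that mps_nth_ramify_scale[OF assms, of x] by (auto intro!: mps_eqI)
qed

lemma act_ramify: "s \<in> mu_group m \<Longrightarrow> m > 0 \<Longrightarrow> act s (ramify m f) = ramify m f"
proof (rule mps_eqI)
  fix e assume *: "s \<in> mu_group m" "m > 0"
  show "mps_nth (act s (ramify m f)) e = mps_nth (ramify m f) e"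
  proof (cases "mps_nth (ramify m f) e = 0")
    case False
    then obtain a where "e = (\<lambda>i. m * a i)" using *(2) by (rule mps_nth_ramify_nonzeroE)
    thus ?thesis using chi_multiple[OF *(1)] by simp
  qed simp
qed

lemma mu_group_separating:
  assumes "alg_closed_in TYPE('a::field_char_0)" "m > 0" "\<not> m dvd e i"
  obtains s :: "'d::finite \<Rightarrow> 'a::field_char_0" where "s \<in> mu_group m" "chi s e \<noteq> 1"
proof -
  obtain z :: 'a where z: "z ^ m = 1" "z ^ e i \<noteq> 1"
    using unity_root_separating[OF assms] .
  define s where "s = (\<lambda>j. if j = i then z else 1)"
  have "chi s e = (\<Prod>j\<in>UNIV. if j = i then z ^ e i else 1)"
    unfolding chi_def s_def by (intro prod.cong) auto
  hence "chi s e \<noteq> 1" using z by simp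
  moreover have "s \<in> mu_group m" using z by (auto simp: s_def mu_group_def)
  ultimately show ?thesis using that by blast
qed

text \<open>A term with an exponent not divisible by \<open>m\<close> is scaled nontrivially by some
  group element, so an invariant series has no such term.\<close>

lemma invariant_imp_ramify:
  fixes f :: "('a::field_char_0, 'd::finite) mps"
  assumes "alg_closed_in TYPE('a)" "m > 0" "\<And>s. s \<in> mu_group m \<Longrightarrow> act s f = f"
  shows "ramify m (MPS (\<lambda>e. mps_nth f (\<lambda>i. m * e i))) = f"
proof (rule mps_eqI)
  fix e
  show "mps_nth (ramify m (MPS (\<lambda>e. mps_nth f (\<lambda>i. m * e i)))) e = mps_nth f e"
  proof (cases "\<forall>i. m dvd e i")
    case True
    thus ?thesis by (simp add: mps_nth_ramify)
  next
    case False
    then obtain i where "\<not> m dvd e i" by blast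
    then obtain s :: "'d \<Rightarrow> 'a" where s: "s \<in> mu_group m" "chi s e \<noteq> 1"
      using mu_group_separating[OF assms(1,2)] by blast
    have "chi s e * mps_nth f e = mps_nth f e"
      using assms(3)[OF s(1)] by (metis mps_nth_act)
    hence "mps_nth f e = 0" using s by simp
    thus ?thesis using False by (auto simp: mps_nth_ramify)
  qed
qed

section \<open>Orbit polynomials\<close>

definition orbit :: "nat \<Rightarrow> ('a::field, 'd::finite) mps \<Rightarrow> ('a, 'd) mps set" where
  "orbit m x = (\<lambda>s. act s x) ` mu_group m"

definition orbit_poly :: "nat \<Rightarrow> ('a::field, 'd::finite) mps \<Rightarrow> ('a, 'd) mps poly" where
  "orbit_poly m x = (\<Prod>y\<in>orbit m x. [:- y, 1:])"

lemma finite_orbit: "m > 0 \<Longrightarrow> finite (orbit m x)"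
  by (simp add: orbit_def finite_mu_group)

lemma orbit_self: "x \<in> orbit m x"
  unfolding orbit_def using act_one mu_group_one by (metis image_eqI)

lemma act_in_orbit: "s \<in> mu_group m \<Longrightarrow> act s x \<in> orbit m x"
  by (simp add: orbit_def)

lemma orbitE:
  assumes "y \<in> orbit m x"
  obtains s where "s \<in> mu_group m" "y = act s x"
  using assms by (auto simp: orbit_def)

lemma act_orbit:
  assumes "s \<in> mu_group m" "m > 0"
  shows "bij_betw (act s) (orbit m x) (orbit m x)"
proof (rule bij_betw_byWitness[where f' = "act (\<lambda>i. inverse (s i))"])
  have i: "(\<lambda>i. inverse (s i)) \<in> mu_group m" using assms mu_group_inverse by blast
  show "\<forall>a\<in>orbit m x. act (\<lambda>i. inverse (s i)) (act s a) = a" using act_inverse[OF assms] by blast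
  show "\<forall>a\<in>orbit m x. act s (act (\<lambda>i. inverse (s i)) a) = a"
    using mu_group_nonzero[OF assms] by (simp add: act_act act_one)
  show "act s ` orbit m x \<subseteq> orbit m x"
    using assms by (auto simp: act_act intro!: act_in_orbit mu_group_times elim!: orbitE)
  show "act (\<lambda>i. inverse (s i)) ` orbit m x \<subseteq> orbit m x"
    using i by (auto simp: act_act intro!: act_in_orbit mu_group_times elim!: orbitE)
qed

lemma poly_prod_linear_eq_0_iff:
  "finite S \<Longrightarrow> poly (\<Prod>y\<in>S. [:- y, 1:]) x = 0 \<longleftrightarrow> x \<in> (S :: 'a::idom set)"
  by (auto simp: poly_prod)

lemma monic_prod_linear:
  fixes S :: "'a::idom set"
  shows "degree (\<Prod>y\<in>S. [:- y, 1:]) = card S" "lead_coeff (\<Prod>y\<in>S. [:- y, 1:]) = 1"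
proof -
  show "degree (\<Prod>y\<in>S. [:- y, 1:]) = card S" by (simp add: degree_prod_sum_eq)
  show "lead_coeff (\<Prod>y\<in>S. [:- y, 1:]) = 1" unfolding lead_coeff_prod by simp
qed

lemma monic_eq_prod_linear:
  fixes p :: "'a::idom poly"
  assumes "lead_coeff p = 1" "finite S" "degree p \<le> card S" "\<And>x. x \<in> S \<Longrightarrow> poly p x = 0"
  shows "p = (\<Prod>y\<in>S. [:- y, 1:])"
proof -
  have "p \<noteq> 0" using assms(1) by auto
  have "card S \<le> degree p"
    using card_poly_roots_bound[OF \<open>p \<noteq> 0\<close>] card_mono[OF poly_roots_finite[OF \<open>p \<noteq> 0\<close>], of S] assms(4)
    by fastforce
  hence deg: "degree p = card S" using assms(3) by simp
  show ?thesis
  proof (rule poly_eqI_degree_lead_coeff[where A = S and n = "card S"])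
    have "coeff (\<Prod>y\<in>S. [:- y, 1:]) (card S) = 1"
      using monic_prod_linear[of S] by metis
    moreover have "coeff p (card S) = 1" using deg assms(1) by simp
    ultimately show "coeff p (card S) = coeff (\<Prod>y\<in>S. [:- y, 1:]) (card S)" by simp
  qed (use monic_prod_linear(1)[of S] deg assms poly_prod_linear_eq_0_iff[OF assms(2)] in auto)
qed

lemma poly_ramify_act:
  assumes "s \<in> mu_group m" "m > 0"
  shows "poly (map_poly (ramify m) p) (act s x) = act s (poly (map_poly (ramify m) p) x)"
proof -
  interpret a: comm_ring_hom "act s" by (rule act_hom)
  interpret r: inj_comm_ring_hom "ramify m :: ('b, 'a) mps \<Rightarrow> _" by (rule ramify_hom[OF assms(2)])
  have "map_poly (act s) (map_poly (ramify m) p) = map_poly (ramify m) p"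
    by (rule poly_eqI) (simp add: act_ramify[OF assms])
  thus ?thesis using a.poly_map_poly[of "map_poly (ramify m) p" x] by simp
qed

lemma orbit_roots:
  assumes "m > 0" "poly (map_poly (ramify m) p) x = 0" "y \<in> orbit m x"
  shows "poly (map_poly (ramify m) p) y = 0"
proof -
  from assms(3) obtain s where "s \<in> mu_group m" "y = act s x" by (auto simp: orbit_def)
  thus ?thesis using poly_ramify_act[of s m p x] assms(1,2) by (simp add: act_0)
qed

lemma card_orbit_le_degree:
  fixes p :: "('a::field, 'd::finite) mps poly"
  assumes "m > 0" "p \<noteq> 0" "poly (map_poly (ramify m) p) x = 0"
  shows "card (orbit m x) \<le> degree p"
proof -
  interpret r: inj_comm_ring_hom "ramify m :: ('a, 'd) mps \<Rightarrow> _" by (rule ramify_hom[OF assms(1)])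
  have nz: "map_poly (ramify m) p \<noteq> 0" using assms(2) by simp
  have "card (orbit m x) \<le> card {y. poly (map_poly (ramify m) p) y = 0}"
    by (rule card_mono[OF poly_roots_finite[OF nz]]) (use orbit_roots[OF assms(1,3)] in auto)
  also have "\<dots> \<le> degree (map_poly (ramify m) p)" by (rule card_poly_roots_bound[OF nz])
  finally show ?thesis by simp
qed

lemma monic_eq_orbit_poly:
  fixes p :: "('a::field, 'd::finite) mps poly"
  assumes "m > 0" "lead_coeff p = 1" "poly (map_poly (ramify m) p) x = 0"
    "degree p \<le> card (orbit m x)"
  shows "map_poly (ramify m) p = orbit_poly m x"
  unfolding orbit_poly_def
proof (rule monic_eq_prod_linear)
  interpret r: inj_comm_ring_hom "ramify m :: ('a, 'd) mps \<Rightarrow> _" by (rule ramify_hom[OF assms(1)])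
  show "lead_coeff (map_poly (ramify m) p) = 1" using assms(2) by simp
  show "degree (map_poly (ramify m) p) \<le> card (orbit m x)" using assms(4) by simp
qed (use assms finite_orbit orbit_roots in auto)

text \<open>The group permutes the linear factors, so the coefficients are invariant and come from
  series in \<open>X\<close>.\<close>

lemma orbit_poly_descends:
  fixes x :: "('a::field_char_0, 'd::finite) mps"
  assumes "alg_closed_in TYPE('a)" "m > 0"
  obtains p where "map_poly (ramify m) p = orbit_poly m x" "lead_coeff p = 1"
    "degree p = card (orbit m x)"
proof -
  interpret r: inj_comm_ring_hom "ramify m :: ('a, 'd) mps \<Rightarrow> _" by (rule ramify_hom[OF assms(2)])
  define d where "d f = MPS (\<lambda>e. mps_nth f (\<lambda>i. m * e i))" for f :: "('a, 'd) mps"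
  have d0: "d 0 = 0" by (rule mps_eqI) (simp add: d_def)
  have inv: "map_poly (act s) (orbit_poly m x) = orbit_poly m x" if s: "s \<in> mu_group m" for s
  proof -
    interpret a: comm_ring_hom "act s" by (rule act_hom)
    interpret ap: map_poly_comm_ring_hom "act s" ..
    have "map_poly (act s) (orbit_poly m x) = (\<Prod>y\<in>orbit m x. [:- act s y, 1:])"
      by (simp add: orbit_poly_def ap.hom_prod a.map_poly_pCons_hom a.hom_uminus)
    also have "\<dots> = orbit_poly m x"
      unfolding orbit_poly_def by (rule prod.reindex_bij_betw[OF act_orbit[OF s assms(2)]])
    finally show ?thesis .
  qed
  define p where "p = map_poly d (orbit_poly m x)"
  have p: "map_poly (ramify m) p = orbit_poly m x"
  proof (rule poly_eqI)
    fix n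
    have "act s (coeff (orbit_poly m x) n) = coeff (orbit_poly m x) n" if "s \<in> mu_group m" for s
      using inv[OF that] act_0 by (metis coeff_map_poly)
    from invariant_imp_ramify[OF assms this]
    show "coeff (map_poly (ramify m) p) n = coeff (orbit_poly m x) n"
      by (simp add: p_def coeff_map_poly[where f = d, OF d0]) (simp add: d_def)
  qed
  have "degree p = card (orbit m x)"
    using p monic_prod_linear(1)[of "orbit m x"] r.degree_map_poly_hom[of p]
    by (simp add: orbit_poly_def)
  moreover have "ramify m (lead_coeff p) = 1"
    using p monic_prod_linear(2)[of "orbit m x"] r.hom_lead_coeff[of p]
    by (simp only: orbit_poly_def)
  hence "lead_coeff p = 1" by (metis r.hom_1_iff)
  ultimately show ?thesis using p that by blast
qed

text \<open>One of two factors has the root \<open>x\<close>, hence the whole orbit as roots and the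
  full degree. The other is constant, and a unit because \<open>p\<close> is monic.\<close>

lemma orbit_poly_irreducible:
  fixes p :: "('a::field_char_0, 'd::finite) mps poly"
  assumes "m > 0" "lead_coeff p = 1" "map_poly (ramify m) p = orbit_poly m x"
  shows "irreducible p"
proof -
  interpret r: inj_comm_ring_hom "ramify m :: ('a, 'd) mps \<Rightarrow> _" by (rule ramify_hom[OF assms(1)])
  interpret rp: map_poly_inj_comm_ring_hom "ramify m :: ('a, 'd) mps \<Rightarrow> _" ..
  have deg: "degree p = card (orbit m x)"
    using assms(3) monic_prod_linear(1)[of "orbit m x"] r.degree_map_poly_hom[of p]
    by (simp add: orbit_poly_def)
  have root: "poly (map_poly (ramify m) p) x = 0"
    unfolding assms(3) orbit_poly_def poly_prod_linear_eq_0_iff[OF finite_orbit[OF assms(1)]]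
    by (rule orbit_self)
  have unit: "b dvd 1" if ab: "p = a * b" and a: "poly (map_poly (ramify m) a) x = 0" for a b
  proof -
    have nz: "a \<noteq> 0" "b \<noteq> 0" using ab assms(2) by auto
    have "degree p \<le> degree a" unfolding deg by (rule card_orbit_le_degree[OF assms(1) nz(1) a])
    moreover have "degree p = degree a + degree b" unfolding ab by (rule degree_mult_eq[OF nz])
    ultimately have "degree b = 0" by simp
    moreover have "lead_coeff a * lead_coeff b = 1" using assms(2) unfolding ab lead_coeff_mult .
    ultimately show ?thesis unfolding is_unit_poly_iff
      by (metis degree_eq_zeroE dvd_triv_right lead_coeff_pCons(2) degree_pCons_0 coeff_pCons_0)
  qed
  show ?thesis
  proof (rule irreducibleI)
    show "p \<noteq> 0" using assms(2) by auto
    have "card (orbit m x) > 0" using finite_orbit[OF assms(1)] orbit_self card_gt_0_iff by blast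
    thus "\<not> p dvd 1" using deg by (auto simp: is_unit_poly_iff)
    fix a b assume ab: "p = a * b"
    with root have "poly (map_poly (ramify m) a) x = 0 \<or> poly (map_poly (ramify m) b) x = 0"
      by (simp add: rp.hom_mult)
    thus "a dvd 1 \<or> b dvd 1" using unit[OF ab] unit[of b a] ab by (auto simp: mult.commute)
  qed
qed

text \<open>Division by the descended orbit polynomial leaves a remainder that vanishes at
  \<open>x\<close> but has degree below the size of the orbit, so it is zero.\<close>

lemma irreducible_imp_orbit_poly:
  fixes f :: "('a::field_char_0, 'd::finite) mps poly"
  assumes "alg_closed_in TYPE('a)" "m > 0" "lead_coeff f = 1" "irreducible f"
    "poly (map_poly (ramify m) f) x = 0"
  shows "map_poly (ramify m) f = orbit_poly m x"
proof -
  interpret r: inj_comm_ring_hom "ramify m :: ('a, 'd) mps \<Rightarrow> _" by (rule ramify_hom[OF assms(2)])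
  interpret rp: map_poly_inj_comm_ring_hom "ramify m :: ('a, 'd) mps \<Rightarrow> _" ..
  obtain p where p: "map_poly (ramify m) p = orbit_poly m x" "lead_coeff p = 1"
    "degree p = card (orbit m x)" using orbit_poly_descends[OF assms(1,2)] .
  have p0: "p \<noteq> 0" using p(2) by auto
  \<comment> \<open>The coefficients do not form a field, but \<open>p\<close> is monic, so
    pseudo-division is division with remainder.\<close>
  obtain q s where qs: "pseudo_divmod f p = (q, s)" by fastforce
  from pseudo_divmod[OF p0 qs] p(2) have f: "f = p * q + s" and s: "s = 0 \<or> degree s < degree p"
    by auto
  have "poly (map_poly (ramify m) p) x = 0"
    unfolding p(1) orbit_poly_def poly_prod_linear_eq_0_iff[OF finite_orbit[OF assms(2)]]
    by (rule orbit_self)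
  with assms(5) have "poly (map_poly (ramify m) s) x = 0"
    unfolding f by (simp add: rp.hom_mult rp.hom_add)
  hence "s = 0" using card_orbit_le_degree[OF assms(2), of s x] s p(3) by (metis leD)
  hence f: "f = p * q" using f by simp
  have "card (orbit m x) > 0" using finite_orbit[OF assms(2)] orbit_self card_gt_0_iff by blast
  hence "\<not> p dvd 1" using p(3) by (auto simp: is_unit_poly_iff)
  hence "q dvd 1" using irreducibleD[OF assms(4) f] by blast
  then obtain c where c: "q = [:c:]" by (auto simp: is_unit_poly_iff)
  have "lead_coeff p * c = 1" using assms(3) unfolding f lead_coeff_mult c by simp
  hence "f = p" using p(2) f c by simp
  thus ?thesis using p(1) by simp
qed

section \<open>The resultant with a product of linear factors\<close>

text \<open>A Vandermonde matrix with descending powers: a kernel vector of its transpose is the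
  coefficient vector of a polynomial of degree below \<open>p\<close> with \<open>p\<close> distinct
  roots.\<close>

lemma power_matrix_det_nonzero:
  fixes a :: "nat \<Rightarrow> 'a::idom"
  assumes inj: "inj_on a {..<p}"
  shows "Determinant.det (Matrix.mat p p (\<lambda>(j, l). a l ^ (p - 1 - j))) \<noteq> 0"
proof
  let ?V = "Matrix.mat p p (\<lambda>(j, l). a l ^ (p - 1 - j))"
  assume "Determinant.det ?V = 0"
  hence "Determinant.det (transpose_mat ?V) = 0" by (subst det_transpose[of _ p]) auto
  then obtain v where v: "v \<in> carrier_vec p" "v \<noteq> 0\<^sub>v p" "transpose_mat ?V *\<^sub>v v = 0\<^sub>v p"
    using det_0_iff_vec_prod_zero[of "transpose_mat ?V" p] by auto
  define h where "h = (\<Sum>j<p. monom (vec_index v j) (p - 1 - j))"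
  have coeff: "coeff h (p - 1 - j) = vec_index v j" if "j < p" for j
  proof -
    have "coeff h (p - 1 - j) = (\<Sum>k<p. if k = j then vec_index v j else 0)"
      unfolding h_def coeff_sum by (intro sum.cong) (use that in auto)
    thus ?thesis using that by simp
  qed
  have "poly h (a l) = 0" if l: "l < p" for l
  proof -
    have "vec_index (transpose_mat ?V *\<^sub>v v) l = (\<Sum>j<p. a l ^ (p - 1 - j) * vec_index v j)"
      using l v(1) by (simp add: scalar_prod_def atLeast0LessThan)
    moreover have "poly h (a l) = (\<Sum>j<p. a l ^ (p - 1 - j) * vec_index v j)"
      by (simp add: h_def poly_sum poly_monom mult.commute)
    ultimately show ?thesis using v(3) l by (metis index_zero_vec(1))
  qed
  moreover have "degree h < p" if "p > 0"
    unfolding h_def using that by (intro degree_sum_less) (auto intro: le_less_trans[OF degree_monom_le])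
  ultimately have "h = 0" if "p > 0"
    using that by (intro poly_eqI_degree[where A = "a ` {..<p}"]) (auto simp: card_image[OF inj])
  hence "vec_index v j = 0" if "j < p" for j using coeff[OF that] that by auto
  hence "v = 0\<^sub>v p" using v(1) by (intro eq_vecI) auto
  thus False using v(2) by simp
qed

lemma poly_eq_sum_rev:
  fixes h :: "'a::comm_ring_1 poly"
  assumes "degree h < n"
  shows "(\<Sum>k<n. coeff h (n - 1 - k) * x ^ (n - 1 - k)) = poly h x"
proof -
  have "(\<Sum>k<n. coeff h (n - 1 - k) * x ^ (n - 1 - k)) = (\<Sum>k<n. coeff h k * x ^ k)"
    using sum.nat_diff_reindex[of "\<lambda>k. coeff h k * x ^ k" n] by simp
  also have "\<dots> = (\<Sum>k\<le>degree h. coeff h k * x ^ k)"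
    by (rule sum.mono_neutral_right) (use assms in \<open>auto simp: not_le coeff_eq_0\<close>)
  finally show ?thesis by (simp add: poly_altdef)
qed

text \<open>The Sylvester matrix is multiplied by a block triangular matrix whose right columns
  evaluate polynomials at the roots.\<close>

lemma resultant_prod_linear_seq:
  fixes a :: "nat \<Rightarrow> 'a::idom"
  assumes inj: "inj_on a {..<p}"
  shows "resultant (\<Prod>i<p. [:- a i, 1:]) g = (\<Prod>i<p. poly g (a i))"
proof -
  define f where "f = (\<Prod>i<p. [:- a i, 1:])"
  define q where "q = degree g"
  have degf: "degree f = p" unfolding f_def by (simp add: degree_prod_sum_eq)
  have "lead_coeff f = 1" unfolding f_def lead_coeff_prod by simp
  hence lead: "coeff f p = 1" by (simp add: degf)
  have froot: "poly f (a l) = 0" if "l < p" for l using that by (auto simp: f_def poly_prod)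
  let ?S = "sylvester_mat f g"
  let ?V = "Matrix.mat p p (\<lambda>(j, l). a l ^ (p - 1 - j))"
  \<comment> \<open>The last \<open>p\<close> columns list the powers of \<open>a l\<close> in the
    order of the Sylvester columns, and their lower part is \<open>?V\<close>. Multiplying by such a
    column evaluates each Sylvester row as a polynomial at \<open>a l\<close>; the first
    \<open>q\<close> columns copy those of \<open>?S\<close>.\<close>
  define W where "W = four_block_mat (1\<^sub>m q) (Matrix.mat q p (\<lambda>(j, l). a l ^ (p + q - 1 - j))) (0\<^sub>m p q) ?V"
  have Wc: "W \<in> carrier_mat (p + q) (p + q)" unfolding W_def by (simp add: add.commute[of p q])
  let ?U = "Matrix.mat q q (\<lambda>(i, j). ?S $$ (i, j))"
  let ?L = "Matrix.mat p q (\<lambda>(i, j). ?S $$ (q + i, j))"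
  let ?D = "Matrix.mat p p (\<lambda>(i, l). a l ^ (p - 1 - i) * poly g (a l))"
  let ?G = "Matrix.mat p p (\<lambda>(i, j). if i = j then poly g (a i) else 0)"
  have Sc: "?S \<in> carrier_mat (p + q) (p + q)" using sylvester_carrier_mat[of f g] by (simp add: degf q_def)
  have entry: "?S $$ (i, k) = (if i < q then coeff (monom 1 (q - 1 - i) * f) (p + q - 1 - k)
      else coeff (monom 1 (p + q - 1 - i) * g) (p + q - 1 - k))" if "i < p + q" "k < p + q" for i k
  proof -
    \<comment> \<open>Here the shift and the coefficient index are both one larger than in the
      claim, which cancels in their difference.\<close>
    have "?S $$ (i, k) = (if i < q then coeff (monom 1 (q - i) * f) (p + q - k)
      else coeff (monom 1 (p + q - i) * g) (p + q - k))"
      using sylvester_index_mat2[of i f g k] that by (simp add: degf q_def)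
    moreover have "q - i \<le> p + q - k \<longleftrightarrow> q - 1 - i \<le> p + q - 1 - k"
      "p + q - k - (q - i) = p + q - 1 - k - (q - 1 - i)" if "i < q" using \<open>k < p + q\<close> that by auto
    moreover have "p + q - i \<le> p + q - k \<longleftrightarrow> p + q - 1 - i \<le> p + q - 1 - k"
      "p + q - k - (p + q - i) = p + q - 1 - k - (p + q - 1 - i)" using that by auto
    ultimately show ?thesis by (simp add: coeff_monom_mult)
  qed
  have row: "(\<Sum>k<p + q. ?S $$ (i, k) * x ^ (p + q - 1 - k)) =
      (if i < q then x ^ (q - 1 - i) * poly f x else x ^ (p + q - 1 - i) * poly g x)"
    if i: "i < p + q" for i x
  proof -
    define h where "h = (if i < q then monom 1 (q - 1 - i) * f else monom 1 (p + q - 1 - i) * g)"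
    have "degree h < p + q"
    proof (cases "i < q")
      case True
      have "degree h \<le> (q - 1 - i) + p" unfolding h_def using True
        by (auto intro!: order.trans[OF degree_mult_le] simp: degree_monom_eq degf)
      thus ?thesis using True by simp
    next
      case False
      have "degree h \<le> (p + q - 1 - i) + q" unfolding h_def using False
        by (auto intro!: order.trans[OF degree_mult_le] simp: degree_monom_eq q_def)
      thus ?thesis using False i by simp
    qed
    have "(\<Sum>k<p + q. ?S $$ (i, k) * x ^ (p + q - 1 - k)) =
        (\<Sum>k<p + q. coeff h (p + q - 1 - k) * x ^ (p + q - 1 - k))"
      by (intro sum.cong) (auto simp: entry[OF i] h_def)
    also have "\<dots> = poly h x" by (rule poly_eq_sum_rev) fact
    finally show ?thesis by (simp add: h_def poly_monom)
  qed
  have prod: "?S * W = four_block_mat ?U (0\<^sub>m q p) ?L ?D"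
  proof (rule eq_matI)
    fix i j assume "i < dim_row (four_block_mat ?U (0\<^sub>m q p) ?L ?D)"
      "j < dim_col (four_block_mat ?U (0\<^sub>m q p) ?L ?D)"
    hence ij: "i < p + q" "j < p + q" by auto
    have "(?S * W) $$ (i, j) = (\<Sum>k<p + q. ?S $$ (i, k) * W $$ (k, j))"
      using ij Sc Wc by (auto simp: scalar_prod_def atLeast0LessThan intro!: sum.cong)
    also have "\<dots> = four_block_mat ?U (0\<^sub>m q p) ?L ?D $$ (i, j)"
    proof (cases "j < q")
      case True
      have "(\<Sum>k<p + q. ?S $$ (i, k) * W $$ (k, j)) = (\<Sum>k<p + q. if k = j then ?S $$ (i, j) else 0)"
        by (intro sum.cong) (use True in \<open>auto simp: W_def\<close>)
      thus ?thesis using True ij by auto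
    next
      case False
      define l where "l = j - q"
      have l: "l < p" "j = q + l" using False ij by (auto simp: l_def)
      have "(\<Sum>k<p + q. ?S $$ (i, k) * W $$ (k, j)) = (\<Sum>k<p + q. ?S $$ (i, k) * a l ^ (p + q - 1 - k))"
      proof (intro sum.cong refl)
        fix k assume "k \<in> {..<p + q}"
        moreover have "p - 1 - (k - q) = p + q - 1 - k" if "\<not> k < q" using that by auto
        ultimately show "?S $$ (i, k) * W $$ (k, j) = ?S $$ (i, k) * a l ^ (p + q - 1 - k)"
          using l by (auto simp: W_def)
      qed
      moreover have "p + q - 1 - i = p - 1 - (i - q)" if "\<not> i < q" using that by auto
      ultimately show ?thesis using row[OF ij(1), of "a l"] froot[OF l(1)] ij l by auto
    qed
    finally show "(?S * W) $$ (i, j) = four_block_mat ?U (0\<^sub>m q p) ?L ?D $$ (i, j)" .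
  qed (use Sc Wc in auto)
  have W: "Determinant.det W = Determinant.det ?V"
    unfolding W_def by (subst det_four_block_mat_lower_left_zero[of _ q _ p]) auto
  have "Determinant.det ?U = prod_list (diag_mat ?U)"
  proof (rule det_upper_triangular[of _ q])
    show "upper_triangular ?U"
    proof (rule upper_triangularI)
      fix i j assume *: "j < i" "i < dim_row ?U"
      hence "coeff f (p + q - 1 - j - (q - 1 - i)) = 0" by (intro coeff_eq_0) (auto simp: degf)
      thus "?U $$ (i, j) = 0" using * entry[of i j] by (auto simp: coeff_monom_mult)
    qed
  qed simp
  also have "\<dots> = 1"
  proof -
    have "?S $$ (i, i) = 1" if "i < q" for i
      using entry[of i i] that lead by (simp add: coeff_monom_mult)
    hence "(\<Prod>i = 0..<q. ?U $$ (i, i)) = 1" by (intro prod.neutral) auto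
    thus ?thesis by (simp add: prod_list_diag_prod)
  qed
  finally have U: "Determinant.det ?U = 1" .
  have "?D = ?V * ?G"
  proof (rule eq_matI)
    fix i l assume "i < dim_row (?V * ?G)" "l < dim_col (?V * ?G)"
    hence il: "i < p" "l < p" by auto
    have "(?V * ?G) $$ (i, l) = (\<Sum>k<p. a k ^ (p - 1 - i) * (if k = l then poly g (a k) else 0))"
      using il by (simp add: scalar_prod_def atLeast0LessThan)
    also have "\<dots> = (\<Sum>k<p. if k = l then a l ^ (p - 1 - i) * poly g (a l) else 0)"
      by (intro sum.cong) auto
    finally have "(?V * ?G) $$ (i, l) = (\<Sum>k<p. if k = l then a l ^ (p - 1 - i) * poly g (a l) else 0)" .
    thus "?D $$ (i, l) = (?V * ?G) $$ (i, l)" using il by simp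
  qed auto
  moreover have "Determinant.det ?G = (\<Prod>i<p. poly g (a i))"
    by (subst det_upper_triangular[of _ p])
       (auto simp: prod_list_diag_prod atLeast0LessThan intro!: upper_triangularI)
  ultimately have D: "Determinant.det ?D = Determinant.det ?V * (\<Prod>i<p. poly g (a i))"
    by (simp add: det_mult[of _ p])
  have "Determinant.det ?S * Determinant.det ?V = Determinant.det (?S * W)"
    unfolding W[symmetric] by (rule det_mult[symmetric, OF Sc Wc])
  also have "\<dots> = Determinant.det ?U * Determinant.det ?D"
    unfolding prod by (rule det_four_block_mat_upper_right_zero) auto
  finally have "Determinant.det ?S * Determinant.det ?V = (\<Prod>i<p. poly g (a i)) * Determinant.det ?V"
    unfolding U D by (simp add: mult.commute)
  thus ?thesis using power_matrix_det_nonzero[OF inj] unfolding resultant_def f_def by simp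
qed

lemma resultant_prod_linear:
  fixes S :: "'a::idom set"
  assumes "finite S"
  shows "resultant (\<Prod>y\<in>S. [:- y, 1:]) g = (\<Prod>y\<in>S. poly g y)"
proof -
  obtain a where a: "bij_betw a {..<card S} S"
    using ex_bij_betw_nat_finite[OF assms] by (auto simp: atLeast0LessThan)
  show ?thesis
    unfolding prod.reindex_bij_betw[OF a, symmetric]
    by (rule resultant_prod_linear_seq) (use a in \<open>auto simp: bij_betw_def\<close>)
qed

lemma poly_pderiv_prod_linear:
  fixes S :: "'a::idom set"
  assumes "finite S" "x \<in> S"
  shows "poly (pderiv (\<Prod>y\<in>S. [:- y, 1:])) x = (\<Prod>y\<in>S - {x}. x - y)"
proof -
  have "(\<Prod>y\<in>S. [:- y, 1:]) = [:- x, 1:] * (\<Prod>y\<in>S - {x}. [:- y, 1:])"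
    using assms by (subst prod.remove[of S x]) auto
  hence "pderiv (\<Prod>y\<in>S. [:- y, 1:]) = pderiv ([:- x, 1:] * (\<Prod>y\<in>S - {x}. [:- y, 1:]))"
    by (rule arg_cong)
  thus ?thesis unfolding pderiv_mult by (simp add: pderiv_pCons poly_prod)
qed

section \<open>Descending along ramification\<close>

lemma dominant_ramify_iff:
  assumes "m > 0"
  shows "dominant (ramify m f) q \<longleftrightarrow> (\<exists>e. q = (\<lambda>i. m * e i) \<and> dominant f e)"
proof
  assume d: "dominant (ramify m f) q"
  then obtain e where e: "q = (\<lambda>i. m * e i)" "mps_nth f e \<noteq> 0"
    using assms by (auto simp: dominant_def elim: mps_nth_ramify_nonzeroE)
  have "e \<le> a" if "mps_nth f a \<noteq> 0" for a
  proof -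
    have "mps_nth (ramify m f) (\<lambda>i. m * a i) \<noteq> 0" using that by (simp add: mps_nth_ramify_scale[OF assms])
    hence "q \<le> (\<lambda>i. m * a i)" using d by (simp add: dominant_def)
    thus ?thesis using assms by (auto simp: e(1) le_fun_def)
  qed
  thus "\<exists>e. q = (\<lambda>i. m * e i) \<and> dominant f e" using e by (auto simp: dominant_def)
next
  assume "\<exists>e. q = (\<lambda>i. m * e i) \<and> dominant f e"
  then obtain e where e: "q = (\<lambda>i. m * e i)" "dominant f e" by blast
  thus "dominant (ramify m f) q"
    using assms by (auto simp: dominant_def mps_nth_ramify_scale le_fun_def elim!: mps_nth_ramify_nonzeroE)
qed

lemma ramify_ramify:
  assumes "a > 0" "b > 0"
  shows "ramify a (ramify b f) = ramify (a * b) f"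
proof (rule mps_eqI)
  fix e
  have 1: "a dvd x \<and> b dvd x div a \<longleftrightarrow> a * b dvd x" for x
    using assms by (metis dvd_div_iff_mult dvd_mult_left mult.commute not_gr_zero)
  show "mps_nth (ramify a (ramify b f)) e = mps_nth (ramify (a * b) f) e"
    unfolding mps_nth_ramify using 1 by (auto simp: div_mult2_eq)
qed

lemma map_poly_ramify_ramify:
  fixes p :: "('a::comm_ring_1, 'd::finite) mps poly"
  assumes "a > 0" "b > 0"
  shows "map_poly (ramify a) (map_poly (ramify b) p) = map_poly (ramify (a * b)) p"
proof -
  interpret ra: inj_comm_ring_hom "ramify a :: ('a, 'd) mps \<Rightarrow> _" by (rule ramify_hom[OF assms(1)])
  interpret rb: inj_comm_ring_hom "ramify b :: ('a, 'd) mps \<Rightarrow> _" by (rule ramify_hom[OF assms(2)])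
  interpret rab: inj_comm_ring_hom "ramify (a * b) :: ('a, 'd) mps \<Rightarrow> _"
    by (rule ramify_hom) (use assms in simp)
  show ?thesis by (rule poly_eqI) (simp add: ramify_ramify[OF assms])
qed

lemma is_root_ram_ramify_iff:
  fixes p :: "('a::comm_ring_1, 'd::finite) mps poly"
  assumes "k > 0" "m > 0"
  shows "is_root_ram (k * m) p (ramify k x) \<longleftrightarrow> is_root_ram m p x"
proof -
  interpret r: inj_comm_ring_hom "ramify k :: ('a, 'd) mps \<Rightarrow> _" by (rule ramify_hom[OF assms(1)])
  have "poly (map_poly (ramify (k * m)) p) (ramify k x) = ramify k (poly (map_poly (ramify m) p) x)"
    unfolding map_poly_ramify_ramify[OF assms, symmetric] by simp
  thus ?thesis using assms by (simp add: is_root_ram_def)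
qed

lemma orbit_poly_root:
  assumes "m > 0"
  shows "poly (orbit_poly m x) y = 0 \<longleftrightarrow> y \<in> orbit m x"
  unfolding orbit_poly_def by (rule poly_prod_linear_eq_0_iff[OF finite_orbit[OF assms]])

text \<open>The descended orbit polynomial competes in the minimality, so \<open>degree p\<close> is
  at most the number of conjugates of \<open>x\<close>, all of which are roots.\<close>

lemma minimal_poly_eq_orbit_poly:
  fixes p :: "('a::field_char_0, 'd::finite) mps poly"
  assumes "alg_closed_in TYPE('a)" "lead_coeff p = 1" "is_root_ram m p x"
    "\<And>q. q \<noteq> 0 \<Longrightarrow> is_root_ram m q x \<Longrightarrow> degree p \<le> degree q"
  shows "map_poly (ramify m) p = orbit_poly m x"
proof -
  have m: "m > 0" "poly (map_poly (ramify m) p) x = 0" using assms(3) by (auto simp: is_root_ram_def)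
  obtain q where q: "map_poly (ramify m) q = orbit_poly m x" "lead_coeff q = 1"
    "degree q = card (orbit m x)" using orbit_poly_descends[OF assms(1) m(1)] .
  have "q \<noteq> 0" using q(2) by auto
  moreover have "is_root_ram m q x"
    using m(1) q(1) orbit_poly_root[OF m(1), of x x] orbit_self by (auto simp: is_root_ram_def)
  ultimately have "degree p \<le> card (orbit m x)" using assms(4) q(3) by metis
  thus ?thesis by (rule monic_eq_orbit_poly[OF m(1) assms(2) m(2)])
qed

text \<open>The definition admits roots at any ramification \<open>k\<close>. Over the common
  ramification \<open>k * m\<close> the factorisation of \<open>f\<close> identifies them with
  elements of the orbit, and the group then moves the first root of each pair to
  \<open>x\<close>.\<close>

lemma root_diff_exps_orbit:
  fixes f :: "('a::field_char_0, 'd::finite) mps poly"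
  assumes m: "m > 0" and f: "map_poly (ramify m) f = orbit_poly m x"
  shows "root_diff_exps f =
    {\<lambda>i. of_nat (e i) / of_nat m |e. \<exists>s\<in>mu_group m. dominant (x - act s x) e}" (is "_ = ?R")
proof (intro equalityI subsetI)
  fix lam assume "lam \<in> root_diff_exps f"
  then obtain k \<alpha> \<beta> e where k: "is_root_ram k f \<alpha>" "is_root_ram k f \<beta>" "\<alpha> \<noteq> \<beta>"
      "dominant (\<alpha> - \<beta>) e" "lam = (\<lambda>i. of_nat (e i) / of_nat k)"
    unfolding root_diff_exps_def dominant_iff by blast
  have k0: "k > 0" using k(1) by (auto simp: is_root_ram_def)
  interpret rk: inj_comm_ring_hom "ramify k :: ('a, 'd) mps \<Rightarrow> _" by (rule ramify_hom[OF k0])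
  interpret rkp: map_poly_inj_comm_ring_hom "ramify k :: ('a, 'd) mps \<Rightarrow> _" ..
  interpret rm: inj_comm_ring_hom "ramify m :: ('a, 'd) mps \<Rightarrow> _" by (rule ramify_hom[OF m])
  have fac: "map_poly (ramify (k * m)) f = (\<Prod>y\<in>orbit m x. [:- ramify k y, 1:])"
    unfolding map_poly_ramify_ramify[OF k0 m, symmetric] f orbit_poly_def
    by (simp add: rkp.hom_prod rk.map_poly_pCons_hom rk.hom_uminus)
  have lift: "\<exists>y\<in>orbit m x. ramify m \<gamma> = ramify k y" if "is_root_ram k f \<gamma>" for \<gamma>
  proof -
    have "is_root_ram (k * m) f (ramify m \<gamma>)"
      using is_root_ram_ramify_iff[OF m k0, of f \<gamma>] that by (simp only: mult.commute[of k m])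
    hence "poly (\<Prod>y\<in>orbit m x. [:- ramify k y, 1:]) (ramify m \<gamma>) = 0"
      by (simp add: is_root_ram_def fac)
    thus ?thesis using finite_orbit[OF m, of x] by (auto simp: poly_prod)
  qed
  obtain y1 y2 where y: "y1 \<in> orbit m x" "ramify m \<alpha> = ramify k y1" "y2 \<in> orbit m x" "ramify m \<beta> = ramify k y2"
    using lift k(1,2) by blast
  have "dominant (ramify m (\<alpha> - \<beta>)) (\<lambda>i. m * e i)"
    using k(4) dominant_ramify_iff[OF m] by blast
  moreover have "ramify m (\<alpha> - \<beta>) = ramify k (y1 - y2)" by (simp add: rm.hom_minus rk.hom_minus y)
  ultimately obtain e' where e': "(\<lambda>i. m * e i) = (\<lambda>i. k * e' i)" "dominant (y1 - y2) e'"
    using dominant_ramify_iff[OF k0] by metis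
  from y obtain s1 s2 where s: "s1 \<in> mu_group m" "y1 = act s1 x" "s2 \<in> mu_group m" "y2 = act s2 x"
    by (metis orbitE)
  define s3 where "s3 = (\<lambda>i. inverse (s1 i))"
  have s3: "s3 \<in> mu_group m" using s(1) mu_group_inverse by (auto simp: s3_def)
  interpret a: comm_ring_hom "act s3" by (rule act_hom)
  have "act s3 (y1 - y2) = x - act (\<lambda>i. s3 i * s2 i) x"
    unfolding a.hom_minus s(4) act_act[of s3 s2]
    using act_inverse[OF s(1) m, of x] by (simp only: s(2) s3_def)
  hence "dominant (x - act (\<lambda>i. s3 i * s2 i) x) e'"
    using dominant_act[OF s3 m e'(2)] by simp
  moreover have "(\<lambda>i. s3 i * s2 i) \<in> mu_group m" using s3 s(3) mu_group_times by blast
  moreover have "lam = (\<lambda>i. of_nat (e' i) / of_nat m)"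
  proof
    fix i
    have "(of_nat m :: rat) * of_nat (e i) = of_nat k * of_nat (e' i)"
      using fun_cong[OF e'(1), of i] by (metis of_nat_mult)
    thus "lam i = of_nat (e' i) / of_nat m" unfolding k(5) using m k0 by (simp add: field_simps)
  qed
  ultimately show "lam \<in> ?R" by blast
next
  fix lam assume "lam \<in> ?R"
  then obtain e s where e: "lam = (\<lambda>i. of_nat (e i) / of_nat m)" "s \<in> mu_group m" "dominant (x - act s x) e"
    by blast
  have "is_root_ram m f y" if "y \<in> orbit m x" for y
    using m f that by (simp add: is_root_ram_def orbit_poly_root)
  moreover have "x \<noteq> act s x" using dominant_nonzero[OF e(3)] by auto
  moreover obtain u where "x - act s x = u * mps_monom e" "mps_const_coeff u \<noteq> 0"
    using e(3) by (auto simp: dominant_iff)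
  ultimately show "lam \<in> root_diff_exps f"
    unfolding root_diff_exps_def using orbit_self act_in_orbit[OF e(2)] e(1) by blast
qed

lemma ramify_resultant:
  fixes f g :: "('a::field_char_0, 'd::finite) mps poly"
  assumes m: "m > 0" and f: "map_poly (ramify m) f = orbit_poly m x"
  shows "ramify m (resultant f g) = (\<Prod>y\<in>orbit m x. poly (map_poly (ramify m) g) y)"
proof -
  interpret r: inj_comm_ring_hom "ramify m :: ('a, 'd) mps \<Rightarrow> _" by (rule ramify_hom[OF m])
  show ?thesis
    unfolding r.resultant_hom[symmetric] f orbit_poly_def
    by (rule resultant_prod_linear[OF finite_orbit[OF m]])
qed

lemma deriv_Y_eq_pderiv: "deriv_Y f = pderiv (f :: 'a::idom poly)"
proof (rule poly_eqI)
  fix n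
  show "coeff (deriv_Y f) n = coeff (pderiv f) n"
    by (cases "n < degree f") (auto simp: deriv_Y_def coeff_pderiv nth_default_def coeff_eq_0)
qed

lemma ramify_resultant_pderiv:
  fixes f :: "('a::field_char_0, 'd::finite) mps poly"
  assumes m: "m > 0" and f: "map_poly (ramify m) f = orbit_poly m x"
  shows "ramify m (resultant f (deriv_Y f)) = (\<Prod>y\<in>orbit m x. \<Prod>z\<in>orbit m x - {y}. y - z)"
proof -
  interpret r: inj_comm_ring_hom "ramify m :: ('a, 'd) mps \<Rightarrow> _" by (rule ramify_hom[OF m])
  have "map_poly (ramify m) (pderiv f) = pderiv (map_poly (ramify m) f)"
    by (rule poly_eqI) (simp only: coeff_pderiv r.coeff_map_poly_hom r.hom_mult r.hom_of_nat)
  hence "poly (map_poly (ramify m) (deriv_Y f)) y = (\<Prod>z\<in>orbit m x - {y}. y - z)"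
    if "y \<in> orbit m x" for y
    using poly_pderiv_prod_linear[OF finite_orbit[OF m] that]
    by (simp add: deriv_Y_eq_pderiv f orbit_poly_def)
  thus ?thesis unfolding ramify_resultant[OF m f] by (intro prod.cong) auto
qed

lemma dominant_uminus_iff: "dominant (- f) e \<longleftrightarrow> dominant (f :: ('a::comm_ring_1, 'd::finite) mps) e"
  by (simp add: dominant_def)

lemma dominant_sign_iff:
  "dominant ((- 1) ^ n * f) e \<longleftrightarrow> dominant (f :: ('a::comm_ring_1, 'd::finite) mps) e"
  by (induction n) (auto simp: dominant_uminus_iff)

text \<open>After \<open>X = T^m\<close> the discriminant is, up to sign, the product of all
  differences of distinct conjugates. Units times monomials are closed under products and under
  taking factors, and the group moves each difference to one starting with \<open>x\<close>.\<close>

lemma quasi_ordinary_iff_orbit: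
  fixes f :: "('a::field_char_0, 'd::finite) mps poly"
  assumes m: "m > 0" and f: "map_poly (ramify m) f = orbit_poly m x" "lead_coeff f = 1"
  shows "quasi_ordinary f \<longleftrightarrow> (\<forall>s\<in>mu_group m. act s x \<noteq> x \<longrightarrow> (\<exists>e. dominant (x - act s x) e))"
proof -
  let ?P = "\<Prod>y\<in>orbit m x. \<Prod>z\<in>orbit m x - {y}. y - z"
  have fin: "finite (orbit m x)" "\<And>y. finite (orbit m x - {y})" using finite_orbit[OF m] by auto
  have "quasi_ordinary f \<longleftrightarrow> (\<exists>q. dominant (resultant f (deriv_Y f)) q)"
  proof -
    have "(\<exists>u q. X = u * mps_monom q \<and> mps_const_coeff u \<noteq> 0) \<longleftrightarrow> (\<exists>q. dominant X q)"
      for X :: "('a, 'd) mps" unfolding dominant_iff by blast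
    thus ?thesis unfolding quasi_ordinary_def discriminant_def
      by (simp only: f(2) dominant_sign_iff simp_thms)
  qed
  also have "\<dots> \<longleftrightarrow> (\<exists>q. dominant ?P q)"
    unfolding ramify_resultant_pderiv[OF m f(1), symmetric] dominant_ramify_iff[OF m] by blast
  also have "\<dots> \<longleftrightarrow> (\<forall>s\<in>mu_group m. act s x \<noteq> x \<longrightarrow> (\<exists>e. dominant (x - act s x) e))"
  proof safe
    fix q s assume q: "dominant ?P q" and s: "s \<in> mu_group m" "act s x \<noteq> x"
    have 1: "?P = (\<Prod>z\<in>orbit m x - {x}. x - z) * (\<Prod>y\<in>orbit m x - {x}. \<Prod>z\<in>orbit m x - {y}. y - z)"
      by (rule prod.remove[OF fin(1) orbit_self])
    have "act s x \<in> orbit m x - {x}" using s act_in_orbit[OF s(1)] by auto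
    from prod.remove[OF fin(2) this, of "\<lambda>z. x - z"] 1
    have "dominant ((x - act s x) * ((\<Prod>z\<in>orbit m x - {x} - {act s x}. x - z) *
       (\<Prod>y\<in>orbit m x - {x}. \<Prod>z\<in>orbit m x - {y}. y - z))) q"
      using q by (simp add: mult.assoc)
    thus "\<exists>e. dominant (x - act s x) e" by (rule dominant_factor) blast
  next
    assume *: "\<forall>s\<in>mu_group m. act s x \<noteq> x \<longrightarrow> (\<exists>e. dominant (x - act s x) e)"
    have pair: "\<exists>e. dominant (y - z) e" if "y \<in> orbit m x" "z \<in> orbit m x - {y}" for y z
    proof -
      from that obtain s1 s2 where s: "s1 \<in> mu_group m" "y = act s1 x" "s2 \<in> mu_group m" "z = act s2 x"
        by (metis orbitE DiffD1)
      define s3 where "s3 = (\<lambda>i. inverse (s1 i) * s2 i)"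
      have s3: "s3 \<in> mu_group m"
        using s mu_group_inverse[OF s(1)] mu_group_times by (auto simp: s3_def)
      interpret a: comm_ring_hom "act s1" by (rule act_hom)
      have z: "z = act s1 (act s3 x)"
        unfolding act_act s(4) s3_def using mu_group_nonzero[OF s(1) m] by (simp add: mult.assoc[symmetric])
      have yz: "y - z = act s1 (x - act s3 x)" by (simp add: a.hom_minus s(2) z)
      have "act s3 x \<noteq> x" using that(2) z s(2) by auto
      then obtain e where "dominant (x - act s3 x) e" using * s3 by blast
      thus ?thesis unfolding yz using dominant_act[OF s(1) m] by blast
    qed
    then obtain E where E: "\<And>y z. y \<in> orbit m x \<Longrightarrow> z \<in> orbit m x - {y} \<Longrightarrow> dominant (y - z) (E y z)"
      by metis
    have "dominant ?P (\<lambda>i. \<Sum>y\<in>orbit m x. \<Sum>z\<in>orbit m x - {y}. E y z i)"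
      using E by (intro dominant_prod fin) auto
    thus "\<exists>q. dominant ?P q" by blast
  qed
  finally show ?thesis .
qed

section \<open>Newton polytopes of resultants\<close>

lemma newton_polytope_dominant:
  fixes f :: "('a::zero, 'd::finite) mps"
  assumes "dominant f e"
  shows "newton_polytope f = {z. \<forall>i. real (e i) \<le> vec_nth z i}"
proof -
  have U: "(\<Union>a\<in>{a. mps_nth f a \<noteq> 0}. {z. \<forall>i. real (a i) \<le> vec_nth z i}) = {z. \<forall>i. real (e i) \<le> vec_nth z i}"
  proof (intro equalityI subsetI)
    fix z assume "z \<in> (\<Union>a\<in>{a. mps_nth f a \<noteq> 0}. {z. \<forall>i. real (a i) \<le> vec_nth z i})"
    then obtain a where "mps_nth f a \<noteq> 0" "\<forall>i. real (a i) \<le> vec_nth z i" by blast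
    moreover from this assms have "e \<le> a" by (auto simp: dominant_def)
    ultimately show "z \<in> {z. \<forall>i. real (e i) \<le> vec_nth z i}"
      by (auto simp: le_fun_def intro: order.trans[OF of_nat_mono])
  qed (use assms in \<open>auto simp: dominant_def\<close>)
  have "convex {z :: real ^ 'd. \<forall>i. real (e i) \<le> vec_nth z i}"
  proof (rule convexI)
    fix x y :: "real ^ 'd" and u v :: real
    assume *: "x \<in> {z. \<forall>i. real (e i) \<le> vec_nth z i}" "y \<in> {z. \<forall>i. real (e i) \<le> vec_nth z i}"
      "0 \<le> u" "0 \<le> v" "u + v = 1"
    have "real (e i) \<le> u * vec_nth x i + v * vec_nth y i" for i
    proof -
      have "real (e i) = u * real (e i) + v * real (e i)"
        using *(5) by (metis distrib_right mult_1)
      also have "\<dots> \<le> u * vec_nth x i + v * vec_nth y i"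
        using * by (intro add_mono mult_left_mono) auto
      finally show ?thesis .
    qed
    thus "u *\<^sub>R x + v *\<^sub>R y \<in> {z. \<forall>i. real (e i) \<le> vec_nth z i}" by simp
  qed
  thus ?thesis unfolding newton_polytope_def U by (rule hull_same)
qed

lemma in_newton_polytope:
  assumes "mps_nth f a \<noteq> 0"
  shows "(\<chi> i. real (a i)) \<in> newton_polytope f"
  unfolding newton_polytope_def by (rule hull_inc) (use assms in auto)

text \<open>All conjugates of \<open>x\<close> give the same dominant exponent \<open>e\<close>, so
  the resultant has the dominant exponent \<open>deg f * e / m\<close>, and the normalisation
  cancels \<open>deg f\<close>.\<close>

lemma contA_dominant:
  fixes f g :: "('a::field_char_0, 'd::finite) mps poly"
  assumes m: "m > 0" and f: "map_poly (ramify m) f = orbit_poly m x"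
    and g: "dominant (poly (map_poly (ramify m) g) x) e" "degree g > 0"
  shows "contA f g = {z. \<forall>i. real (e i) / (real m * real (degree g)) \<le> vec_nth z i}"
proof -
  interpret r: inj_comm_ring_hom "ramify m :: ('a, 'd) mps \<Rightarrow> _" by (rule ramify_hom[OF m])
  define D where "D = card (orbit m x)"
  have D0: "D > 0" unfolding D_def using finite_orbit[OF m] orbit_self card_gt_0_iff by blast
  have D: "degree f = D"
    using f monic_prod_linear(1)[of "orbit m x"] r.degree_map_poly_hom[of f]
    by (simp add: orbit_poly_def D_def)
  have "dominant (poly (map_poly (ramify m) g) y) e" if y: "y \<in> orbit m x" for y
  proof -
    from y obtain s where "s \<in> mu_group m" "y = act s x" by (rule orbitE)
    thus ?thesis using poly_ramify_act dominant_act m g(1) by metis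
  qed
  hence "dominant (ramify m (resultant f g)) (\<lambda>i. \<Sum>y\<in>orbit m x. e i)"
    unfolding ramify_resultant[OF m f] by (intro dominant_prod finite_orbit[OF m])
  then obtain e' where e': "\<And>i. D * e i = m * e' i" "dominant (resultant f g) e'"
    unfolding dominant_ramify_iff[OF m] D_def by (auto simp: fun_eq_iff)
  let ?c = "real (degree f) * real (degree g)"
  have c: "?c > 0" using D D0 g(2) by simp
  have e'_eq: "real (e' i) / ?c = real (e i) / (real m * real (degree g))" for i
  proof -
    have "real D * real (e i) = real m * real (e' i)" using e'(1)[of i] by (metis of_nat_mult)
    hence "real (e' i) = real D * real (e i) / real m" using m by (simp add: field_simps)
    thus ?thesis using m D D0 g(2) by (simp add: field_simps)
  qed
  show ?thesis
  proof (intro equalityI subsetI)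
    fix z assume "z \<in> contA f g"
    then obtain y where y: "\<forall>i. real (e' i) \<le> vec_nth y i" "z = (1 / ?c) *\<^sub>R y"
      unfolding contA_def newton_polytope_dominant[OF e'(2)] by blast
    have "real (e' i) / ?c \<le> vec_nth z i" for i
      using y(1) c unfolding y(2) by (simp add: divide_right_mono)
    thus "z \<in> {z. \<forall>i. real (e i) / (real m * real (degree g)) \<le> vec_nth z i}" unfolding e'_eq by simp
  next
    fix z assume "z \<in> {z. \<forall>i. real (e i) / (real m * real (degree g)) \<le> vec_nth z i}"
    hence "real (e' i) / ?c \<le> vec_nth z i" for i unfolding e'_eq by simp
    hence "real (e' i) \<le> vec_nth (?c *\<^sub>R z) i" for i
      using c by (simp add: pos_divide_le_eq mult.commute)
    moreover have "1 / r * r = 1" if "r > 0" for r :: real using that by simp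
    from this[OF c] have "1 / ?c * ?c = 1" .
    hence "z = (1 / ?c) *\<^sub>R (?c *\<^sub>R z)" by (simp only: scaleR_scaleR scaleR_one)
    ultimately show "z \<in> contA f g"
      unfolding contA_def newton_polytope_dominant[OF e'(2)] by blast
  qed
qed

text \<open>The \<open>T_i\<close>-adic order, written as a relation so that the zero series has
  none.\<close>

definition min_coordinate :: "'d \<Rightarrow> ('a::zero, 'd) mps \<Rightarrow> nat \<Rightarrow> bool" where
  "min_coordinate i f n \<longleftrightarrow> (\<exists>a. mps_nth f a \<noteq> 0 \<and> a i = n) \<and> (\<forall>a. mps_nth f a \<noteq> 0 \<longrightarrow> n \<le> a i)"

lemma min_coordinate_ex: "f \<noteq> 0 \<Longrightarrow> \<exists>n. min_coordinate i (f :: ('a::comm_ring_1, 'd::finite) mps) n"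
proof -
  assume "f \<noteq> 0"
  hence "\<exists>n. \<exists>a. mps_nth f a \<noteq> 0 \<and> a i = n" by (auto simp: mps_eq_0_iff)
  from LeastI_ex[OF this] show ?thesis
    unfolding min_coordinate_def by (blast intro: Least_le)
qed

lemma min_coordinate_mult:
  fixes f g :: "('a::idom, 'd::finite) mps"
  assumes "min_coordinate i f n" "min_coordinate i g k"
  shows "min_coordinate i (f * g) (n + k)"
proof -
  have nz: "f \<noteq> 0" "g \<noteq> 0" using assms by (auto simp: min_coordinate_def)
  obtain a b where ab: "mps_nth f a \<noteq> 0" "mps_nth g b \<noteq> 0"
    "\<And>a'. mps_nth f a' \<noteq> 0 \<Longrightarrow> a i \<le> a' i" "\<And>b'. mps_nth g b' \<noteq> 0 \<Longrightarrow> b i \<le> b' i"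
    "mps_nth (f * g) (\<lambda>i. a i + b i) \<noteq> 0"
    by (rule mps_min_coordinate[OF nz, of i]) blast
  have "a i = n" "b i = k" using ab(1-4) assms unfolding min_coordinate_def by (metis le_antisym)+
  hence "\<exists>c. mps_nth (f * g) c \<noteq> 0 \<and> c i = n + k"
    using ab(5) by (intro exI[of _ "\<lambda>i. a i + b i"]) simp
  thus ?thesis using assms
    unfolding min_coordinate_def by (auto elim!: mps_nth_mult_nonzeroE intro!: add_mono)
qed

lemma min_coordinate_prod:
  fixes f :: "'b \<Rightarrow> ('a::idom, 'd::finite) mps"
  assumes "finite A" "\<And>x. x \<in> A \<Longrightarrow> min_coordinate i (f x) n"
  shows "min_coordinate i (\<Prod>x\<in>A. f x) (card A * n)"
  using assms
proof (induction A)
  case empty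
  show ?case by (auto simp: min_coordinate_def mps_nth_1)
next
  case (insert x A)
  thus ?case using min_coordinate_mult[of i "f x" n] by simp
qed

text \<open>The \<open>T_i\<close>-adic order \<open>n\<close> of \<open>g(x)\<close> is the same at
  every conjugate and adds under products, so the resultant has an exponent with \<open>i\<close>-th
  coordinate exactly \<open>n * deg f / m\<close>. The corresponding point of the polytope turns
  containment into a lower bound for \<open>n\<close>.\<close>

lemma contA_subset_imp:
  fixes f g :: "('a::field_char_0, 'd::finite) mps poly"
  assumes m: "m > 0" and f: "map_poly (ramify m) f = orbit_poly m x" and g: "degree g > 0"
    and sub: "contA f g \<subseteq> {z. \<forall>i. v i \<le> vec_nth z i}"
    and a: "mps_nth (poly (map_poly (ramify m) g) x) a \<noteq> 0"
  shows "v i * (real m * real (degree g)) \<le> real (a i)"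
proof -
  interpret r: inj_comm_ring_hom "ramify m :: ('a, 'd) mps \<Rightarrow> _" by (rule ramify_hom[OF m])
  define h where "h = poly (map_poly (ramify m) g) x"
  define D where "D = card (orbit m x)"
  have D0: "D > 0" unfolding D_def using finite_orbit[OF m] orbit_self card_gt_0_iff by blast
  have D: "degree f = D"
    using f monic_prod_linear(1)[of "orbit m x"] r.degree_map_poly_hom[of f]
    by (simp add: orbit_poly_def D_def)
  have "h \<noteq> 0" using a by (auto simp: h_def)
  then obtain n where n: "min_coordinate i h n" using min_coordinate_ex by blast
  have "min_coordinate i (poly (map_poly (ramify m) g) y) n" if y: "y \<in> orbit m x" for y
  proof -
    from y obtain s where s: "s \<in> mu_group m" "y = act s x" by (rule orbitE)
    hence "poly (map_poly (ramify m) g) y = act s h" using poly_ramify_act m by (simp add: h_def)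
    thus ?thesis using n chi_nonzero[OF s(1) m] by (simp add: min_coordinate_def)
  qed
  hence "min_coordinate i (ramify m (resultant f g)) (D * n)"
    unfolding ramify_resultant[OF m f] D_def by (intro min_coordinate_prod finite_orbit[OF m])
  then obtain b where b: "mps_nth (ramify m (resultant f g)) b \<noteq> 0" "b i = D * n"
    by (auto simp: min_coordinate_def)
  from b(1) m obtain c where c: "b = (\<lambda>i. m * c i)" "mps_nth (resultant f g) c \<noteq> 0"
    by (rule mps_nth_ramify_nonzeroE)
  let ?k = "real (degree f) * real (degree g)"
  have "(1 / ?k) *\<^sub>R (\<chi> i. real (c i)) \<in> contA f g"
    unfolding contA_def using in_newton_polytope[OF c(2)] by blast
  hence "v i \<le> real (c i) / ?k" using sub by auto
  moreover have "real m * real (c i) = real D * real n" using b(2) c(1) by (metis of_nat_mult)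
  ultimately have "real m * (v i * (real D * real (degree g))) \<le> real D * real n"
    using D D0 g m by (metis mult_left_mono of_nat_0_le_iff of_nat_0_less_iff pos_le_divide_eq mult_pos_pos)
  hence "real D * (v i * (real m * real (degree g))) \<le> real D * real n"
    by (simp only: mult_ac)
  hence "v i * (real m * real (degree g)) \<le> real n"
    using D0 by (simp only: mult_le_cancel_left_pos of_nat_0_less_iff)
  also have "real n \<le> real (a i)" using n a by (auto simp: min_coordinate_def h_def)
  finally show ?thesis .
qed

section \<open>Characteristic sequences\<close>

lemma sum_over_fibres:
  fixes g :: "'b \<Rightarrow> nat"
  assumes "finite G" "\<And>r. r \<in> G \<Longrightarrow> card {s \<in> G. \<phi> s = \<phi> r} = c"
  shows "(\<Sum>s\<in>G. g (\<phi> s)) = c * (\<Sum>y\<in>\<phi> ` G. g y)"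
proof -
  have "(\<Sum>s\<in>G. g (\<phi> s)) = (\<Sum>y\<in>\<phi> ` G. \<Sum>s\<in>{s \<in> G. \<phi> s = y}. g (\<phi> s))"
    by (rule sum.image_gen[OF assms(1)])
  also have "\<dots> = (\<Sum>y\<in>\<phi> ` G. c * g y)"
  proof (intro sum.cong refl)
    fix y assume "y \<in> \<phi> ` G"
    then obtain r where "r \<in> G" "y = \<phi> r" by blast
    thus "(\<Sum>s\<in>{s \<in> G. \<phi> s = y}. g (\<phi> s)) = c * g y" using assms(2)[of r] by simp
  qed
  finally show ?thesis by (simp add: sum_distrib_left)
qed

lemma card_translate:
  assumes "m > 0" "t \<in> mu_group m"
  shows "card ((\<lambda>s i. t i * s i) ` A) = card A"
  by (rule card_image) (use mu_group_nonzero[OF assms(2,1)] in \<open>auto simp: inj_on_def fun_eq_iff\<close>)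

text \<open>Orbit-stabiliser: the fibres of \<open>act s y\<close> as a function of \<open>s\<close>
  are the cosets of the stabiliser.\<close>

lemma sum_over_orbit:
  assumes m: "m > 0"
  shows "(\<Sum>s\<in>mu_group m. g (act s y)) = card {s \<in> mu_group m. act s y = y} * (\<Sum>z\<in>orbit m y. g z :: nat)"
  unfolding orbit_def
proof (rule sum_over_fibres[OF finite_mu_group[OF m]])
  fix t :: "'a \<Rightarrow> 'b" assume t: "t \<in> mu_group m"
  have "{s \<in> mu_group m. act s y = act t y} = (\<lambda>s i. t i * s i) ` {s \<in> mu_group m. act s y = y}"
  proof (intro equalityI subsetI)
    fix s assume s: "s \<in> {s \<in> mu_group m. act s y = act t y}"
    define s' where "s' = (\<lambda>i. inverse (t i) * s i)"
    have "s' \<in> mu_group m"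
      using s mu_group_inverse[OF t] mu_group_times by (auto simp: s'_def)
    moreover have "act s' y = y"
      unfolding s'_def act_act[symmetric] using s act_inverse[OF t m] by simp
    moreover have "s = (\<lambda>i. t i * s' i)"
      using mu_group_nonzero[OF t m] by (simp add: s'_def mult.assoc[symmetric])
    ultimately show "s \<in> (\<lambda>s i. t i * s i) ` {s \<in> mu_group m. act s y = y}" by blast
  next
    fix s assume "s \<in> (\<lambda>s i. t i * s i) ` {s \<in> mu_group m. act s y = y}"
    thus "s \<in> {s \<in> mu_group m. act s y = act t y}"
      using mu_group_times[OF t] by (auto simp: act_act[symmetric])
  qed
  thus "card {s \<in> mu_group m. act s y = act t y} = card {s \<in> mu_group m. act s y = y}"
    using card_translate[OF m t] by simp
qed

text \<open>Plays the role of the Galois group of \<open>K((T))\<close> over the extension of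
  \<open>K((X))\<close> by the first \<open>r\<close> characteristic monomials.\<close>

definition char_stab :: "nat \<Rightarrow> (nat \<Rightarrow> 'd::finite \<Rightarrow> nat) \<Rightarrow> nat \<Rightarrow> ('d \<Rightarrow> 'a::field) set" where
  "char_stab m lam r = {s \<in> mu_group m. \<forall>i<r. chi s (lam i) = 1}"

lemma char_stabD: "s \<in> char_stab m lam r \<Longrightarrow> s \<in> mu_group m"
  by (simp add: char_stab_def)

lemma char_stab_0: "char_stab m lam 0 = mu_group m"
  by (auto simp: char_stab_def)

text \<open>The terms of \<open>x\<close> at the exponents \<open>lam 0 < lam 1 < \<dots>\<close> are those where the conjugates of \<open>x\<close>
  separate: an element of the group fixing the first \<open>r\<close> of them fixes every term of \<open>x\<close> not divisible by the
  next one. Levels are counted from \<open>0\<close>: for the characteristic \<open>h\<^sub>1 < h\<^sub>2 < \<dots>\<close> of \<open>f\<close>, the exponent \<open>lam j\<close> is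
  \<open>m h\<^sub>j\<^sub>+\<^sub>1\<close>, and \<open>F r\<close> below is \<open>f\<^sub>r\<^sub>+\<^sub>1\<close>.\<close>

locale char_seq =
  fixes m :: nat and x :: "('a::field_char_0, 'd::finite) mps" and len :: nat
    and lam :: "nat \<Rightarrow> 'd \<Rightarrow> nat"
  assumes alg: "alg_closed_in TYPE('a)" and m: "m > 0"
    and lam_mono: "i < j \<Longrightarrow> j < len \<Longrightarrow> lam i < lam j"
    and lam_supp: "j < len \<Longrightarrow> mps_nth x (lam j) \<noteq> 0"
    and fixed: "r \<le> len \<Longrightarrow> (s :: 'd \<Rightarrow> 'a) \<in> char_stab m lam r \<Longrightarrow> mps_nth x e \<noteq> 0 \<Longrightarrow>
      (r < len \<Longrightarrow> \<not> lam r \<le> e) \<Longrightarrow> chi s e = 1"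
    and moved: "r < len \<Longrightarrow> \<exists>s \<in> char_stab m lam r. chi (s :: 'd \<Rightarrow> 'a) (lam r) \<noteq> 1"
begin

abbreviation H :: "nat \<Rightarrow> ('d \<Rightarrow> 'a) set" where "H \<equiv> char_stab m lam"

lemma lam_le: "i \<le> j \<Longrightarrow> j < len \<Longrightarrow> lam i \<le> lam j"
  using lam_mono[of i j] by (cases "i = j") auto

lemma lam_not_le: "i < j \<Longrightarrow> j < len \<Longrightarrow> \<not> lam j \<le> lam i"
  using lam_mono[of i j] by auto

section \<open>Truncations of the root and their conjugates\<close>

text \<open>At \<open>r = len\<close> nothing is cut off: \<open>x\<close> counts as its own last
  truncation, in accordance with the convention \<open>f_{s+1} = f\<close>.\<close>

definition tau :: "nat \<Rightarrow> ('a, 'd) mps" where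
  "tau r = MPS (\<lambda>e. if r < len \<and> lam r \<le> e then 0 else mps_nth x e)"

lemma mps_nth_tau: "mps_nth (tau r) e = (if r < len \<and> lam r \<le> e then 0 else mps_nth x e)"
  by (simp add: tau_def)

lemma tau_len: "tau len = x"
  by (rule mps_eqI) (simp add: mps_nth_tau)

text \<open>Locates where \<open>x\<close> parts from the conjugate of \<open>tau r\<close> by
  \<open>s\<close>: at the first characteristic term that \<open>s\<close> moves or, if there is
  none before \<open>lam r\<close>, at \<open>lam r\<close>, where \<open>tau r\<close> itself
  leaves \<open>x\<close>.\<close>

definition level :: "nat \<Rightarrow> ('d \<Rightarrow> 'a) \<Rightarrow> nat" where
  "level r s = (LEAST j. j = r \<or> chi s (lam j) \<noteq> 1)"

lemma level_le: "level r s \<le> r"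
  unfolding level_def by (rule Least_le) simp

lemma level_less: "level r s < r \<Longrightarrow> chi s (lam (level r s)) \<noteq> 1"
  using LeastI[of "\<lambda>j. j = r \<or> chi s (lam j) \<noteq> 1" r] unfolding level_def by auto

lemma level_stab: "s \<in> mu_group m \<Longrightarrow> s \<in> H (level r s)"
  unfolding char_stab_def level_def using not_less_Least by blast

lemma level_eq_iff: "s \<in> mu_group m \<Longrightarrow> level r s = r \<longleftrightarrow> s \<in> H r"
proof
  assume "s \<in> mu_group m" "level r s = r"
  thus "s \<in> H r" using level_stab by metis
next
  assume "s \<in> H r"
  thus "level r s = r" using level_less[of r s] level_le[of r s]
    by (force simp: char_stab_def)
qed

lemma level_mono: "level r s \<le> level (Suc r) s"
proof (cases "level (Suc r) s = Suc r")
  case True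
  thus ?thesis using level_le[of r s] by simp
next
  case False
  hence "level (Suc r) s < Suc r" using level_le[of "Suc r" s] by simp
  hence "chi s (lam (level (Suc r) s)) \<noteq> 1" by (rule level_less)
  thus ?thesis unfolding level_def[of r] by (intro Least_le) auto
qed

text \<open>The terms at \<open>lam i\<close> with \<open>i < r\<close> survive the truncation and
  detect \<open>H r\<close>; conversely, the surviving terms are exactly those that
  \<open>fixed\<close> makes invariant under \<open>H r\<close>.\<close>

lemma act_tau_eq_iff:
  assumes "r \<le> len" "s \<in> mu_group m"
  shows "act s (tau r) = tau r \<longleftrightarrow> s \<in> H r"
proof
  assume eq: "act s (tau r) = tau r"
  have "chi s (lam i) = 1" if "i < r" for i
  proof -
    have "mps_nth (tau r) (lam i) = mps_nth x (lam i)"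
      using lam_not_le[OF that] by (auto simp: mps_nth_tau)
    moreover have "mps_nth x (lam i) \<noteq> 0" using lam_supp that assms(1) by simp
    moreover have "chi s (lam i) * mps_nth (tau r) (lam i) = mps_nth (tau r) (lam i)"
      using eq by (metis mps_nth_act)
    ultimately show ?thesis by simp
  qed
  thus "s \<in> H r" using assms by (simp add: char_stab_def)
next
  assume s: "s \<in> H r"
  show "act s (tau r) = tau r"
  proof (rule mps_eqI)
    fix e
    show "mps_nth (act s (tau r)) e = mps_nth (tau r) e"
      using fixed[OF assms(1) s, of e] by (cases "mps_nth x e = 0") (auto simp: mps_nth_tau)
  qed
qed

text \<open>If \<open>s\<close> fixes \<open>tau r\<close>, the difference is the part of
  \<open>x\<close> cut from \<open>tau r\<close> but kept in \<open>tau k\<close>, which starts at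
  \<open>lam r\<close>. Otherwise, with \<open>j = level r s\<close>, the element \<open>s\<close>
  lies in \<open>H j\<close>, so all terms not above \<open>lam j\<close> cancel by
  \<open>fixed\<close>, while the one at \<open>lam j\<close> is moved.\<close>

lemma dominant_tau_diff:
  assumes "r \<le> k" "k \<le> len" "s \<in> mu_group m" "level r s < k"
  shows "dominant (tau k - act s (tau r)) (lam (level r s))"
proof -
  define j where "j = level r s"
  have jk: "j < k" "j \<le> r" using assms(4) level_le by (auto simp: j_def)
  have sj: "s \<in> H j" unfolding j_def by (rule level_stab[OF assms(3)])
  have xj: "mps_nth x (lam j) \<noteq> 0" using lam_supp jk assms by simp
  show ?thesis
  proof (cases "j = r")
    case True
    hence "s \<in> H r" using sj by simp
    hence "act s (tau r) = tau r" using act_tau_eq_iff[of r s] assms by simp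
    hence c: "mps_nth (tau k - act s (tau r)) e =
        (if lam r \<le> e \<and> \<not> (k < len \<and> lam k \<le> e) then mps_nth x e else 0)" for e
      using lam_le[of r k] assms jk True by (auto simp: mps_nth_tau)
    have "\<not> (k < len \<and> lam k \<le> lam r)" using lam_not_le[of r k] jk True by auto
    thus ?thesis using xj unfolding j_def[symmetric] True dominant_def c by auto
  next
    case False
    hence jr: "j < r" using jk by simp
    have cj: "chi s (lam j) \<noteq> 1" using level_less[of r s] jr by (simp add: j_def)
    have "\<not> (r < len \<and> lam r \<le> lam j)" "\<not> (k < len \<and> lam k \<le> lam j)"
      using lam_not_le[of j r] lam_not_le[of j k] jr jk by auto
    hence "mps_nth (tau k - act s (tau r)) (lam j) \<noteq> 0"
      using xj cj by (auto simp: mps_nth_tau)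
    moreover have "lam j \<le> e" if nz: "mps_nth (tau k - act s (tau r)) e \<noteq> 0" for e
    proof (rule ccontr)
      assume nle: "\<not> lam j \<le> e"
      have "\<not> (r < len \<and> lam r \<le> e)" "\<not> (k < len \<and> lam k \<le> e)"
        using nle lam_le[of j r] lam_le[of j k] jr jk by (auto intro: order.trans)
      hence c: "mps_nth (tau k - act s (tau r)) e = (1 - chi s e) * mps_nth x e"
        by (auto simp: mps_nth_tau algebra_simps)
      hence "mps_nth x e \<noteq> 0" using nz by auto
      hence "chi s e = 1" using fixed[of j s e] sj nle jk assms by auto
      thus False using nz c by simp
    qed
    ultimately show ?thesis unfolding j_def[symmetric] dominant_def by blast
  qed
qed

section \<open>The substitution of \<open>tau k\<close> plus a multiple of
  \<open>T^(lam k)\<close>\<close>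

text \<open>The value of \<open>Z\<close> for which the substitution returns
  \<open>x\<close>.\<close>

definition zx :: "nat \<Rightarrow> ('a, 'd) mps" where
  "zx k = MPS (\<lambda>e. mps_nth x (\<lambda>i. e i + lam k i))"

lemma x_decomp:
  assumes "k < len"
  shows "x = tau k + mps_monom (lam k) * zx k"
proof (rule mps_eqI)
  fix e
  have "lam k \<le> e \<Longrightarrow> (\<lambda>i. e i - lam k i + lam k i) = e" by (auto simp: le_fun_def)
  thus "mps_nth x e = mps_nth (tau k + mps_monom (lam k) * zx k) e"
    using assms by (auto simp: mps_nth_tau mult.commute[of "mps_monom _"] mps_nth_monom_mult zx_def)
qed

lemma zx_const: "mps_const_coeff (zx k) = mps_nth x (lam k)"
  by (simp add: mps_const_coeff_def zx_def)

text \<open>After \<open>Y = tau k + T^(lam k) Z\<close>, the polynomial is \<open>T^e\<close> times a lift of \<open>c Z^j\<close>.\<close>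

definition expands :: "nat \<Rightarrow> ('a, 'd) mps poly \<Rightarrow> ('d \<Rightarrow> nat) \<Rightarrow> 'a \<Rightarrow> nat \<Rightarrow> bool" where
  "expands k p e c j \<longleftrightarrow> c \<noteq> 0 \<and> (\<exists>q. pcompose p [:tau k, mps_monom (lam k):] = Polynomial.smult (mps_monom e) q \<and>
     map_poly mps_const_coeff q = monom c j)"

lemma expands_1: "expands k 1 (\<lambda>_. 0) 1 0"
  unfolding expands_def by (auto simp: mps_monom_0 pcompose_1 intro!: exI[of _ 1])

lemma expands_mult:
  assumes "expands k p e c j" "expands k p' e' c' j'"
  shows "expands k (p * p') (\<lambda>i. e i + e' i) (c * c') (j + j')"
proof -
  interpret cc: comm_ring_hom "mps_const_coeff :: ('a, 'd) mps \<Rightarrow> 'a" by (rule mps_const_coeff_hom)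
  interpret ccp: map_poly_comm_ring_hom "mps_const_coeff :: ('a, 'd) mps \<Rightarrow> 'a" ..
  from assms obtain q q' where q:
    "pcompose p [:tau k, mps_monom (lam k):] = Polynomial.smult (mps_monom e) q" "map_poly mps_const_coeff q = monom c j"
    "pcompose p' [:tau k, mps_monom (lam k):] = Polynomial.smult (mps_monom e') q'" "map_poly mps_const_coeff q' = monom c' j'"
    by (auto simp: expands_def)
  have "pcompose (p * p') [:tau k, mps_monom (lam k):] = Polynomial.smult (mps_monom (\<lambda>i. e i + e' i)) (q * q')"
    by (simp add: pcompose_mult q(1,3) mps_monom_mult[symmetric] mult_ac)
  moreover have "map_poly mps_const_coeff (q * q') = monom (c * c') (j + j')"
    by (simp add: ccp.hom_mult q(2,4) mult_monom)
  ultimately show ?thesis using assms by (auto simp: expands_def)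
qed

lemma expands_power:
  assumes "expands k p e c j"
  shows "expands k (p ^ n) (\<lambda>i. n * e i) (c ^ n) (n * j)"
  using expands_mult[OF assms] expands_1[of k] by (induction n) auto

lemma expands_prod:
  assumes "finite A" "\<And>y. y \<in> A \<Longrightarrow> expands k (p y) (e y) (c y) (j y)"
  shows "expands k (\<Prod>y\<in>A. p y) (\<lambda>i. \<Sum>y\<in>A. e y i) (\<Prod>y\<in>A. c y) (\<Sum>y\<in>A. j y)"
  using assms expands_1[of k] by (induction A) (auto intro: expands_mult)

text \<open>At \<open>Z = zx k\<close> the reduction is evaluated at the nonzero coefficient of
  \<open>x\<close> at \<open>lam k\<close>, where a single monomial \<open>c Z^j\<close> cannot
  vanish.\<close>

lemma expands_dominant:
  assumes "expands k p e c j" "k < len"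
  shows "\<exists>q. poly p x = mps_monom e * q \<and> mps_const_coeff q \<noteq> 0"
proof -
  interpret cc: comm_ring_hom "mps_const_coeff :: ('a, 'd) mps \<Rightarrow> 'a" by (rule mps_const_coeff_hom)
  from assms obtain q where q: "c \<noteq> 0"
    "pcompose p [:tau k, mps_monom (lam k):] = Polynomial.smult (mps_monom e) q" "map_poly mps_const_coeff q = monom c j"
    by (auto simp: expands_def)
  have "poly p x = poly (pcompose p [:tau k, mps_monom (lam k):]) (zx k)"
    by (subst x_decomp[OF assms(2)]) (simp add: poly_pcompose mult.commute)
  hence "poly p x = mps_monom e * poly q (zx k)" by (simp add: q(2))
  moreover have "mps_const_coeff (poly q (zx k)) = c * mps_nth x (lam k) ^ j"
    by (simp only: cc.poly_map_poly[symmetric] q(3) poly_monom zx_const)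
  ultimately show ?thesis using q(1) lam_supp[OF assms(2)] by auto
qed

lemma expands_dominant':
  assumes "expands k p e c j" "k < len"
  shows "dominant (poly p x) e"
  using expands_dominant[OF assms] unfolding dominant_iff by (auto simp: mult.commute)

text \<open>The root \<open>tau k\<close> itself gives \<open>T^(lam k) Z\<close>. In every other
  case the constant term of the factor has exponent \<open>lam j\<close> with \<open>j < k\<close>,
  and after division by \<open>T^(lam j)\<close> the coefficient of \<open>Z\<close> is a
  nonconstant monomial, so only a constant survives reduction.\<close>

lemma expands_linear:
  assumes "r \<le> k" "k < len" "s \<in> mu_group m"
  shows "\<exists>c. expands k [:- act s (tau r), 1:] (lam (level r s)) c
           (if r = k \<and> act s (tau r) = tau k then 1 else 0)"
proof -
  have pc: "pcompose [:- act s (tau r), 1:] [:tau k, mps_monom (lam k):] =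
      [:tau k - act s (tau r), mps_monom (lam k):]"
    by (simp add: pcompose_pCons)
  show ?thesis
  proof (cases "level r s = k")
    case True
    hence rk: "r = k" using level_le[of r s] assms by simp
    hence "s \<in> H k" using True level_eq_iff[OF assms(3)] by simp
    hence eq: "act s (tau k) = tau k" using act_tau_eq_iff[of k s] assms by simp
    have "[:tau k - act s (tau r), mps_monom (lam k):] = Polynomial.smult (mps_monom (lam k)) [:0, 1:]"
      by (simp add: rk eq)
    moreover have "map_poly mps_const_coeff [:0, 1 :: ('a, 'd) mps:] = monom 1 1"
      by (rule poly_eqI) (auto simp: coeff_map_poly coeff_pCons split: nat.splits)
    ultimately show ?thesis
      unfolding expands_def pc
      by (intro exI[of _ "1 :: 'a"] conjI exI[of _ "[:0, 1:]"]) (auto simp: True[unfolded rk] rk eq)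
  next
    case False
    hence lt: "level r s < k" using level_le[of r s] assms by simp
    define j where "j = level r s"
    obtain u where u: "tau k - act s (tau r) = u * mps_monom (lam j)" "mps_const_coeff u \<noteq> 0"
      using dominant_tau_diff[of r k s] assms lt unfolding j_def dominant_iff by auto
    define w where "w = (\<lambda>i. lam k i - lam j i)"
    have le: "lam j \<le> lam k" using lam_le[of j k] lt assms by (simp add: j_def)
    hence lk: "lam k = (\<lambda>i. lam j i + w i)" by (auto simp: w_def le_fun_def)
    have w0: "w \<noteq> (\<lambda>_. 0)" using lam_mono[of j k] lt assms lk by (auto simp: j_def)
    have "[:tau k - act s (tau r), mps_monom (lam k):] = Polynomial.smult (mps_monom (lam j)) [:u, mps_monom w:]"
      by (simp add: u(1) lk mps_monom_mult mult.commute add.commute)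
    moreover have "mps_const_coeff (mps_monom w :: ('a, 'd) mps) = 0"
      using w0 by (auto simp: mps_const_coeff_def mps_monom_def)
    hence "map_poly mps_const_coeff [:u, mps_monom w:] = monom (mps_const_coeff u) 0"
      by (intro poly_eqI) (auto simp: coeff_map_poly coeff_pCons split: nat.splits)
    moreover have "\<not> (r = k \<and> act s (tau r) = tau k)"
      using u(1) dominant_nonzero[OF dominant_tau_diff[of r k s]] assms lt by auto
    ultimately show ?thesis
      unfolding expands_def pc j_def[symmetric] using u(2)
      by (intro exI[of _ "mps_const_coeff u"] conjI exI[of _ "[:u, mps_monom w:]"]) auto
  qed
qed

text \<open>Meaningful for conjugates \<open>y\<close> of \<open>tau r\<close> with
  \<open>r < len\<close>, since \<open>x - y\<close> is then dominant.\<close>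

definition d :: "('a, 'd) mps \<Rightarrow> 'd \<Rightarrow> nat" where "d y = (THE e. dominant (x - y) e)"

lemma d_eq:
  assumes "r < len" "s \<in> mu_group m"
  shows "d (act s (tau r)) = lam (level r s)"
proof -
  obtain c j where "expands r [:- act s (tau r), 1:] (lam (level r s)) c j"
    using expands_linear[of r r s] assms by auto
  from expands_dominant'[OF this assms(1)] have "dominant (x - act s (tau r)) (lam (level r s))" by simp
  thus ?thesis unfolding d_def by (intro the_equality) (auto intro: dominant_unique)
qed

section \<open>Degrees of the truncation polynomials and their exponents at the root\<close>

text \<open>The exponent of \<open>F r\<close> at \<open>x\<close>, summed over the linear factors;
  divided by \<open>m\<close>, these are the characteristic generators of the semigroup of the
  quasi-ordinary polynomial.\<close>

definition b :: "nat \<Rightarrow> 'd \<Rightarrow> nat" where "b r i = (\<Sum>y\<in>orbit m (tau r). d y i)"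

definition N :: "nat \<Rightarrow> nat" where "N r = card (orbit m (tau r))"

definition F :: "nat \<Rightarrow> ('a, 'd) mps poly" where
  "F r = (SOME p. map_poly (ramify m) p = orbit_poly m (tau r) \<and> lead_coeff p = 1 \<and> degree p = N r)"

lemma F: "map_poly (ramify m) (F r) = orbit_poly m (tau r)" "lead_coeff (F r) = 1" "degree (F r) = N r"
proof -
  obtain p where p: "map_poly (ramify m) p = orbit_poly m (tau r)" "lead_coeff p = 1"
    "degree p = card (orbit m (tau r))"
    using orbit_poly_descends[OF alg m] .
  hence "\<exists>p. map_poly (ramify m) p = orbit_poly m (tau r) \<and> lead_coeff p = 1 \<and> degree p = N r"
    unfolding N_def by blast
  from someI_ex[OF this] show "map_poly (ramify m) (F r) = orbit_poly m (tau r)"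
    "lead_coeff (F r) = 1" "degree (F r) = N r" unfolding F_def by auto
qed

lemma lead_F: "coeff (F r) (N r) = 1"
  using F(2,3)[of r] by simp

lemma N_pos: "N r > 0"
  unfolding N_def using finite_orbit[OF m] orbit_self card_gt_0_iff by blast

lemma finite_H: "finite (H r)"
  by (rule finite_subset[OF _ finite_mu_group[OF m]]) (auto simp: char_stab_def)

lemma H_pos: "card (H r) > 0"
proof -
  have "(\<lambda>_. 1) \<in> H r" using mu_group_one by (auto simp: char_stab_def)
  thus ?thesis using finite_H card_gt_0_iff by blast
qed

lemma sum_group:
  assumes "r \<le> len"
  shows "(\<Sum>s\<in>mu_group m. g (act s (tau r))) = card (H r) * (\<Sum>y\<in>orbit m (tau r). g y :: nat)"
proof -
  have "{s \<in> mu_group m. act s (tau r) = tau r} = H r"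
    using act_tau_eq_iff[OF assms] char_stabD by blast
  thus ?thesis using sum_over_orbit[OF m, of g "tau r"] by simp
qed

lemma card_group: "r \<le> len \<Longrightarrow> card (mu_group m :: ('d \<Rightarrow> 'a) set) = card (H r) * N r"
  using sum_group[of r "\<lambda>_. 1"] by (simp add: N_def)

lemma N_0: "N 0 = 1"
  using card_group[of 0] H_pos[of 0] by (simp add: char_stab_0)

text \<open>The index of \<open>H (Suc r)\<close> in \<open>H r\<close>, because
  \<open>H (Suc r)\<close> is the kernel of this character on \<open>H r\<close>; hence the factor
  by which the orbit grows from \<open>tau r\<close> to \<open>tau (Suc r)\<close>.\<close>

definition nn :: "nat \<Rightarrow> nat" where "nn r = card ((\<lambda>s. chi s (lam r)) ` H r)"

lemma N_Suc:
  assumes "r < len"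
  shows "N (Suc r) = nn r * N r"
proof -
  have "card {s \<in> H r. chi s (lam r) = chi t (lam r)} = card (H (Suc r))" if t: "t \<in> H r" for t
  proof -
    note tm = char_stabD[OF t]
    have "{s \<in> H r. chi s (lam r) = chi t (lam r)} = (\<lambda>s i. t i * s i) ` H (Suc r)"
    proof (intro equalityI subsetI)
      fix s assume s: "s \<in> {s \<in> H r. chi s (lam r) = chi t (lam r)}"
      define s' where "s' = (\<lambda>i. inverse (t i) * s i)"
      have "s' \<in> H (Suc r)"
        using s t mu_group_inverse[OF tm] mu_group_times chi_nonzero[OF tm m]
        by (auto simp: s'_def char_stab_def chi_times chi_inverse less_Suc_eq)
      moreover have "s = (\<lambda>i. t i * s' i)"
        using mu_group_nonzero[OF tm m] by (simp add: s'_def mult.assoc[symmetric])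
      ultimately show "s \<in> (\<lambda>s i. t i * s i) ` H (Suc r)" by blast
    next
      fix s assume "s \<in> (\<lambda>s i. t i * s i) ` H (Suc r)"
      thus "s \<in> {s \<in> H r. chi s (lam r) = chi t (lam r)}"
        using t mu_group_times by (auto simp: char_stab_def chi_times less_Suc_eq)
    qed
    thus ?thesis using card_translate[OF m tm] by simp
  qed
  from sum_over_fibres[OF finite_H this, of "\<lambda>_. 1"]
  have "card (H r) = card (H (Suc r)) * nn r" by (simp add: nn_def)
  moreover have "card (H r) * N r = card (H (Suc r)) * N (Suc r)"
    using card_group[of r] card_group[of "Suc r"] assms by simp
  ultimately show ?thesis using H_pos[of "Suc r"] by (simp add: mult_ac)
qed

lemma b_group: "r < len \<Longrightarrow> (\<Sum>s\<in>mu_group m. lam (level r s) i) = card (H r) * b r i"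
  unfolding b_def using sum_group[of r "\<lambda>y. d y i"] d_eq[of r] by simp

text \<open>\<open>b r / N r\<close> is the average of \<open>lam (level r s)\<close> over the whole
  group, and for each \<open>s\<close> the level grows with \<open>r\<close>. Summing over the group
  makes orbits of different sizes comparable term by term.\<close>

lemma b_step:
  assumes "Suc r < len"
  shows "N (Suc r) * b r i \<le> N r * b (Suc r) i"
proof -
  let ?G = "mu_group m :: ('d \<Rightarrow> 'a) set"
  have "(\<Sum>s\<in>?G. lam (level r s) i) \<le> (\<Sum>s\<in>?G. lam (level (Suc r) s) i)"
  proof (rule sum_mono)
    fix s :: "'d \<Rightarrow> 'a"
    have "level (Suc r) s < len" using level_le[of "Suc r" s] assms by simp
    from lam_le[OF level_mono this] show "lam (level r s) i \<le> lam (level (Suc r) s) i"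
      by (simp add: le_fun_def)
  qed
  hence "card (H r) * b r i \<le> card (H (Suc r)) * b (Suc r) i"
    using b_group assms by simp
  hence "(card (H (Suc r)) * N (Suc r)) * (card (H r) * b r i) \<le>
      (card (H r) * N r) * (card (H (Suc r)) * b (Suc r) i)"
    using card_group[of r] card_group[of "Suc r"] assms by simp
  hence "(card (H r) * card (H (Suc r))) * (N (Suc r) * b r i) \<le>
      (card (H r) * card (H (Suc r))) * (N r * b (Suc r) i)"
    by (simp only: mult_ac)
  thus ?thesis using H_pos[of r] H_pos[of "Suc r"] by simp
qed

lemma b_mono:
  assumes "r \<le> k" "k < len"
  shows "N k * b r i \<le> N r * b k i"
  using assms
proof (induction k rule: dec_induct)
  case (step k)
  hence "N (Suc k) * (N k * b r i) \<le> N (Suc k) * (N r * b k i)" by simp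
  also have "\<dots> = N r * (N (Suc k) * b k i)" by simp
  also have "\<dots> \<le> N r * (N k * b (Suc k) i)" using b_step step.prems by simp
  finally have "N k * (N (Suc k) * b r i) \<le> N k * (N r * b (Suc k) i)" by (simp only: mult_ac)
  thus ?case using N_pos[of k] by simp
qed simp

text \<open>Conjugates other than \<open>tau r\<close> contribute some \<open>lam j\<close> with
  \<open>j < r\<close>, on which \<open>H r\<close> acts trivially; only
  \<open>d (tau r) = lam r\<close> remains.\<close>

lemma chi_b:
  assumes "r < len" "s \<in> H r"
  shows "chi s (b r) = chi s (lam r)"
proof -
  have fin: "finite (orbit m (tau r))" by (rule finite_orbit[OF m])
  have "chi s (d y) = (if y = tau r then chi s (lam r) else 1)" if y: "y \<in> orbit m (tau r)" for y
  proof -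
    from y obtain t where t: "t \<in> mu_group m" "y = act t (tau r)" by (rule orbitE)
    have "y = tau r \<longleftrightarrow> level r t = r"
      using act_tau_eq_iff[of r t] level_eq_iff[OF t(1), of r] assms t by simp
    moreover have "chi s (lam (level r t)) = 1" if "level r t < r"
      using assms(2) that by (simp add: char_stab_def)
    ultimately show ?thesis using d_eq[OF assms(1) t(1)] t(2) level_le[of r t] by auto
  qed
  hence "(\<Prod>y\<in>orbit m (tau r). chi s (d y)) = (\<Prod>y\<in>orbit m (tau r). if y = tau r then chi s (lam r) else 1)"
    by (intro prod.cong) auto
  also have "\<dots> = chi s (lam r)" using fin orbit_self[of "tau r" m] by simp
  finally show ?thesis using chi_sum[OF fin, of s d] unfolding b_def by simp
qed

lemma chi_b_trivial:
  assumes "r < k" "r < len" "s \<in> H k"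
  shows "chi s (b r) = 1"
proof -
  have "s \<in> H r" using assms by (auto simp: char_stab_def)
  from chi_b[OF assms(2) this] show ?thesis using assms by (simp add: char_stab_def)
qed

lemma expands_F:
  assumes "r \<le> k" "k < len"
  shows "\<exists>c. expands k (map_poly (ramify m) (F r)) (b r) c (if r = k then 1 else 0)"
proof -
  have fin: "finite (orbit m (tau r))" by (rule finite_orbit[OF m])
  have "\<exists>c. expands k [:- y, 1:] (d y) c (if r = k \<and> y = tau k then 1 else 0)"
    if y: "y \<in> orbit m (tau r)" for y
  proof -
    from y obtain t where t: "t \<in> mu_group m" "y = act t (tau r)" by (rule orbitE)
    thus ?thesis using expands_linear[OF assms t(1)] d_eq[of r t] assms by auto
  qed
  then obtain c where c: "\<And>y. y \<in> orbit m (tau r) \<Longrightarrow>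
      expands k [:- y, 1:] (d y) (c y) (if r = k \<and> y = tau k then 1 else 0)"
    by metis
  have "(\<Sum>y\<in>orbit m (tau r). if r = k \<and> y = tau k then 1 else 0) = (if r = k then 1 else 0 :: nat)"
    using fin orbit_self[of "tau r" m] by auto
  moreover have "expands k (\<Prod>y\<in>orbit m (tau r). [:- y, 1:]) (\<lambda>i. \<Sum>y\<in>orbit m (tau r). d y i)
      (\<Prod>y\<in>orbit m (tau r). c y) (\<Sum>y\<in>orbit m (tau r). if r = k \<and> y = tau k then 1 else 0)"
    by (rule expands_prod[OF fin c])
  ultimately show ?thesis unfolding F(1) orbit_poly_def b_def[abs_def] by auto
qed

section \<open>Monic products of every degree and their exponents\<close>

text \<open>The exponents of the \<open>F r\<close> are the mixed radix digits of \<open>t\<close>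
  for the place values \<open>N 0, N 1, ...\<close>. The top digit is unbounded, so
  \<open>Q (Suc r)\<close> has a monic member of every degree.\<close>

primrec Q :: "nat \<Rightarrow> nat \<Rightarrow> ('a, 'd) mps poly" where
  "Q 0 t = 1"
| "Q (Suc r) t = Q r (t mod N r) * F r ^ (t div N r)"

primrec B :: "nat \<Rightarrow> nat \<Rightarrow> 'd \<Rightarrow> nat" where
  "B 0 t = (\<lambda>_. 0)"
| "B (Suc r) t = (\<lambda>i. B r (t mod N r) i + (t div N r) * b r i)"

lemma Q_monic: "lead_coeff (Q r t) = 1"
  by (induction r arbitrary: t) (auto simp: lead_coeff_mult lead_coeff_power F lead_F)

lemma Q_nonzero: "Q r t \<noteq> 0"
  using Q_monic[of r t] by auto

text \<open>The side condition reflects that \<open>Q 0\<close> is constantly \<open>1\<close>; the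
  recursion meets it because \<open>N 0 = 1\<close>.\<close>

lemma degree_Q: "(r = 0 \<Longrightarrow> t = 0) \<Longrightarrow> degree (Q r t) = t"
proof (induction r arbitrary: t)
  case (Suc r)
  have "F r \<noteq> 0" using F(2)[of r] by auto
  moreover have "degree (Q r (t mod N r)) = t mod N r"
    by (rule Suc.IH) (simp add: N_0)
  ultimately show ?case
    by (simp add: degree_mult_eq Q_nonzero degree_power_eq F(3))
qed simp

lemma chi_B: "r \<le> k \<Longrightarrow> r \<le> len \<Longrightarrow> s \<in> H k \<Longrightarrow> chi s (B r t) = 1"
proof (induction r arbitrary: t)
  case (Suc r)
  thus ?case using chi_b_trivial[of r k s] by (simp add: chi_add chi_scale)
qed simp

text \<open>On \<open>H r\<close> only the last digit of \<open>t\<close> is visible, and its character takes \<open>nn r\<close> values.\<close>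

lemma B_separated:
  assumes "r \<le> len" "t < N r" "t' < N r" "\<And>s. s \<in> mu_group m \<Longrightarrow> chi s (B r t) = chi (s :: 'd \<Rightarrow> 'a) (B r t')"
  shows "t = t'"
  using assms
proof (induction r arbitrary: t t')
  case 0
  thus ?case by (simp add: N_0)
next
  case (Suc r)
  have digit: "u div N r \<le> v div N r" if uv: "u < N (Suc r)" "v < N (Suc r)"
    "\<And>s. s \<in> mu_group m \<Longrightarrow> chi s (B (Suc r) u) = chi (s :: 'd \<Rightarrow> 'a) (B (Suc r) v)" for u v
  proof (rule ccontr)
    assume "\<not> u div N r \<le> v div N r"
    then obtain c where c: "u div N r = v div N r + c" "c > 0"
      by (metis less_imp_add_positive not_le)
    have "u div N r < nn r"
      using uv(1) N_Suc[of r] Suc.prems(1) N_pos[of r] by (simp add: less_mult_imp_div_less)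
    hence cn: "c < nn r" using c by simp
    \<comment> \<open>If the top digits differed by \<open>c\<close> with
      \<open>0 < c < nn r\<close>, the \<open>nn r\<close> values of this character on
      \<open>H r\<close> would all be \<open>c\<close>-th roots of unity, of which there are only
      \<open>c\<close>.\<close>
    have "chi s (lam r) ^ c = 1" if s: "s \<in> H r" for s
    proof -
      have sm: "s \<in> mu_group m" using s by (rule char_stabD)
      have "chi s (b r) ^ (v div N r) \<noteq> 0" using chi_nonzero[OF sm m] by simp
      moreover have "chi s (b r) ^ (v div N r) * chi s (b r) ^ c = chi s (b r) ^ (v div N r)"
        using uv(3)[OF sm] s Suc.prems(1) chi_B[of r r s]
        by (simp add: chi_add chi_scale c(1) power_add)
      ultimately show ?thesis
        using chi_b[of r s] s Suc.prems(1) by (metis Suc_le_lessD mult_cancel_left2)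
    qed
    hence "card ((\<lambda>s. chi s (lam r)) ` H r) \<le> card {z :: 'a. z ^ c = 1}"
      by (intro card_mono finite_unity_roots c(2)) auto
    also have "\<dots> = c" by (rule card_unity_roots[OF alg c(2)])
    finally show False using cn by (simp add: nn_def)
  qed
  have dig: "t div N r = t' div N r"
    using digit[of t t'] digit[of t' t] Suc.prems by (metis le_antisym)
  have "t mod N r = t' mod N r"
  proof (rule Suc.IH)
    fix s :: "'d \<Rightarrow> 'a" assume s: "s \<in> mu_group m"
    show "chi s (B r (t mod N r)) = chi s (B r (t' mod N r))"
      using Suc.prems(4)[OF s] chi_nonzero[OF s m, of "b r"] by (simp add: chi_add chi_scale dig)
  qed (use Suc.prems(1) N_pos in auto)
  thus ?case using dig by (metis div_mult_mod_eq)
qed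

text \<open>A factor \<open>F r\<close> has degree \<open>N r\<close> and exponent
  \<open>b r\<close>, where \<open>b r / N r\<close> is at most \<open>b k / N k\<close>; the digits
  weighted by these degrees add up to \<open>t\<close>.\<close>

lemma B_le:
  assumes "r \<le> Suc k" "k < len" "r = 0 \<Longrightarrow> t = 0"
  shows "N k * B r t i \<le> t * b k i"
  using assms
proof (induction r arbitrary: t)
  case (Suc r)
  have "N k * B r (t mod N r) i \<le> (t mod N r) * b k i"
    by (rule Suc.IH) (use Suc.prems N_0 in auto)
  moreover have "(t div N r) * (N k * b r i) \<le> (t div N r) * (N r * b k i)"
    using b_mono[of r k i] Suc.prems by simp
  ultimately have "N k * B r (t mod N r) i + (t div N r) * (N k * b r i) \<le>
      (t mod N r) * b k i + (t div N r) * (N r * b k i)" by (rule add_mono)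
  hence "N k * B (Suc r) t i \<le> (t mod N r) * b k i + (t div N r) * (N r * b k i)"
    by (simp add: distrib_left mult_ac)
  also have "\<dots> = (t mod N r + t div N r * N r) * b k i" by (simp only: algebra_simps)
  finally show ?case by simp
qed simp

text \<open>Factors \<open>F r\<close> with \<open>r < k\<close> reduce to constants and each
  \<open>F k\<close> to a multiple of \<open>Z\<close>, so the power of \<open>Z\<close> is the top
  digit of \<open>t\<close>.\<close>

lemma expands_Q:
  assumes "k < len"
  shows "\<exists>c. expands k (map_poly (ramify m) (Q (Suc k) t)) (B (Suc k) t) c (t div N k)"
proof -
  interpret r: inj_comm_ring_hom "ramify m :: ('a, 'd) mps \<Rightarrow> _" by (rule ramify_hom[OF m])
  interpret rp: map_poly_inj_comm_ring_hom "ramify m :: ('a, 'd) mps \<Rightarrow> _" ..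
  have low: "\<exists>c. expands k (map_poly (ramify m) (Q r t)) (B r t) c 0" if "r \<le> k" for r t
    using that
  proof (induction r arbitrary: t)
    case 0
    show ?case using expands_1[of k] by (auto simp: rp.hom_one)
  next
    case (Suc r)
    then obtain c where c: "expands k (map_poly (ramify m) (Q r (t mod N r))) (B r (t mod N r)) c 0"
      by fastforce
    obtain c' where c': "expands k (map_poly (ramify m) (F r)) (b r) c' 0"
      using expands_F[of r k] Suc.prems assms by auto
    show ?case using expands_mult[OF c expands_power[OF c', of "t div N r"]]
      by (auto simp: rp.hom_mult rp.hom_power)
  qed
  obtain c where c: "expands k (map_poly (ramify m) (Q k (t mod N k))) (B k (t mod N k)) c 0"
    using low by blast
  obtain c' where c': "expands k (map_poly (ramify m) (F k)) (b k) c' 1"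
    using expands_F[of k k] assms by auto
  show ?thesis using expands_mult[OF c expands_power[OF c', of "t div N k"]]
    by (auto simp: rp.hom_mult rp.hom_power)
qed

end

section \<open>Expansions without cancellation\<close>

lemma mps_nth_mult_lowest:
  fixes f u :: "('a::comm_ring_1, 'd::finite) mps"
  assumes "\<And>a. a \<le> e \<Longrightarrow> a \<noteq> e \<Longrightarrow> mps_nth f a = 0"
  shows "mps_nth (f * u) e = mps_nth f e * mps_const_coeff u"
proof -
  have "mps_nth (f * u) e = (\<Sum>a\<in>{a. a \<le> e}. if a = e then mps_nth f e * mps_const_coeff u else 0)"
    unfolding mps_nth_mult by (intro sum.cong) (use assms in \<open>auto simp: mps_const_coeff_def\<close>)
  also have "\<dots> = mps_nth f e * mps_const_coeff u"
    by (subst sum.delta) (auto simp: finite_le_fun_nat)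
  finally show ?thesis .
qed

lemma sum_lowest_coeff:
  fixes X u :: "'b \<Rightarrow> ('a::idom, 'd::finite) mps"
  assumes "finite A" "t0 \<in> A" "mps_nth (X t0) e \<noteq> 0" "mps_const_coeff (u t0) \<noteq> 0"
    and disj: "\<And>t t' e. t \<in> A \<Longrightarrow> t' \<in> A \<Longrightarrow> mps_nth (X t) e \<noteq> 0 \<Longrightarrow> mps_nth (X t') e \<noteq> 0 \<Longrightarrow> t = t'"
    and low: "\<And>t a. t \<in> A \<Longrightarrow> a \<le> e \<Longrightarrow> a \<noteq> e \<Longrightarrow> mps_nth (X t) a = 0"
  shows "mps_nth (\<Sum>t\<in>A. X t * u t) e \<noteq> 0"
proof -
  have "mps_nth (\<Sum>t\<in>A. X t * u t) e = (\<Sum>t\<in>A. if t = t0 then mps_nth (X t0) e * mps_const_coeff (u t0) else 0)"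
    unfolding mps_nth_sum
  proof (intro sum.cong refl)
    fix t assume t: "t \<in> A"
    have "mps_nth (X t * u t) e = mps_nth (X t) e * mps_const_coeff (u t)"
      by (rule mps_nth_mult_lowest) (use low t in auto)
    moreover have "mps_nth (X t) e = 0" if "t \<noteq> t0" using disj[OF t assms(2)] assms(3) that by blast
    ultimately show "mps_nth (X t * u t) e = (if t = t0 then mps_nth (X t0) e * mps_const_coeff (u t0) else 0)"
      by simp
  qed
  thus ?thesis using assms(1-4) by simp
qed

text \<open>An exponent that is minimal among those outside \<open>U\<close> occurs in exactly one \<open>X t\<close>, so it survives in the sum.\<close>

lemma support_in_upper_set:
  fixes X u :: "'b \<Rightarrow> ('a::idom, 'd::finite) mps"
  assumes "finite A" "\<And>t. t \<in> A \<Longrightarrow> mps_const_coeff (u t) \<noteq> 0"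
    and disj: "\<And>t t' e. t \<in> A \<Longrightarrow> t' \<in> A \<Longrightarrow> mps_nth (X t) e \<noteq> 0 \<Longrightarrow> mps_nth (X t') e \<noteq> 0 \<Longrightarrow> t = t'"
    and upper: "\<And>a e. a \<in> U \<Longrightarrow> a \<le> e \<Longrightarrow> e \<in> U"
    and sum: "\<And>e. mps_nth (\<Sum>t\<in>A. X t * u t) e \<noteq> 0 \<Longrightarrow> e \<in> U"
    and "t \<in> A" "mps_nth (X t) e \<noteq> 0"
  shows "e \<in> U"
  using assms(6,7)
proof (induction "\<Sum>i\<in>UNIV. e i" arbitrary: e t rule: less_induct)
  case less
  show ?case
  proof (rule ccontr)
    assume e: "e \<notin> U"
    have "mps_nth (X t') a = 0" if "t' \<in> A" "a \<le> e" "a \<noteq> e" for t' a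
    proof (rule ccontr)
      assume nz: "mps_nth (X t') a \<noteq> 0"
      obtain i where "a i \<noteq> e i" using \<open>a \<noteq> e\<close> by auto
      hence "a i < e i" using \<open>a \<le> e\<close> by (simp add: le_fun_def order.not_eq_order_implies_strict)
      hence "(\<Sum>i\<in>UNIV. a i) < (\<Sum>i\<in>UNIV. e i)"
        using \<open>a \<le> e\<close> by (intro sum_strict_mono_ex1) (auto simp: le_fun_def)
      from less.hyps[OF this \<open>t' \<in> A\<close> nz] have "a \<in> U" .
      with upper \<open>a \<le> e\<close> e show False by blast
    qed
    hence "mps_nth (\<Sum>t\<in>A. X t * u t) e \<noteq> 0"
      by (intro sum_lowest_coeff[of A t X e u, OF assms(1) less.prems])
         (use assms(2) less.prems disj in blast)+
    with sum e show False by blast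
  qed
qed

lemma monic_family_expansion:
  fixes P :: "nat \<Rightarrow> 'a::idom poly"
  assumes "\<And>t. t \<le> n \<Longrightarrow> degree (P t) = t" "\<And>t. t \<le> n \<Longrightarrow> lead_coeff (P t) = 1" "degree p \<le> n"
  shows "\<exists>c. p = (\<Sum>t\<le>n. Polynomial.smult (c t) (P t)) \<and> c n = coeff p n"
  using assms
proof (induction n arbitrary: p)
  case 0
  obtain a where a: "p = [:a:]" using 0(3) by (auto elim: degree_eq_zeroE)
  obtain a' where a': "P 0 = [:a':]" using 0(1)[of 0] by (auto elim: degree_eq_zeroE)
  have "a' = 1" using 0(2)[of 0] a' by simp
  thus ?case using a a' by (intro exI[of _ "\<lambda>_. a"]) simp
next
  case (Suc n)
  define q where "q = p - Polynomial.smult (coeff p (Suc n)) (P (Suc n))"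
  have "coeff (P (Suc n)) (Suc n) = 1" using Suc.prems(1,2)[of "Suc n"] by simp
  hence "coeff q (Suc n) = 0" by (simp add: q_def)
  moreover have "degree q \<le> Suc n"
    unfolding q_def by (rule degree_diff_le)
      (use Suc.prems in \<open>auto intro: order.trans[OF degree_smult_le]\<close>)
  ultimately have "degree q \<le> n"
    by (metis coeff_0 le_SucE leading_coeff_0_iff degree_0 le0)
  from Suc.IH[OF _ _ this] Suc.prems obtain c where c: "q = (\<Sum>t\<le>n. Polynomial.smult (c t) (P t))"
    by auto
  have "p = (\<Sum>t\<le>Suc n. Polynomial.smult ((c(Suc n := coeff p (Suc n))) t) (P t))"
    using c by (simp add: q_def algebra_simps)
  thus ?case by (intro exI[of _ "c(Suc n := coeff p (Suc n))"]) simp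
qed

context char_seq begin

lemma B_0: "B r 0 = (\<lambda>_. 0)"
  by (induction r) auto

text \<open>\<open>X t\<close> is a series in \<open>T^m\<close> times
  \<open>T^(B (Suc k) t)\<close>, so its exponents lie in one class modulo \<open>m\<close>, and
  \<open>B_separated\<close> distinguishes these classes. The index \<open>N (Suc k)\<close> must
  stay excluded: only \<open>N (Suc k)\<close> characters are trivial on \<open>H (Suc k)\<close>,
  so its class is taken already.\<close>

lemma expansion_at:
  assumes k: "k < len" and g: "lead_coeff g = 1"
  obtains X q c where
    "pcompose (map_poly (ramify m) g) [:tau k, mps_monom (lam k):] =
       (\<Sum>t\<le>degree g. Polynomial.smult (X t) (q t))"
    "\<And>t. map_poly mps_const_coeff (q t) = monom (c t) (t div N k)" "\<And>t. c t \<noteq> 0"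
    "X (degree g) = mps_monom (B (Suc k) (degree g))"
    "\<And>t t' e. t < N (Suc k) \<Longrightarrow> t' < N (Suc k) \<Longrightarrow> mps_nth (X t) e \<noteq> 0 \<Longrightarrow> mps_nth (X t') e \<noteq> 0 \<Longrightarrow> t = t'"
proof -
  interpret r: inj_comm_ring_hom "ramify m :: ('a, 'd) mps \<Rightarrow> _" by (rule ramify_hom[OF m])
  interpret rp: map_poly_inj_comm_ring_hom "ramify m :: ('a, 'd) mps \<Rightarrow> _" ..
  obtain a where a: "g = (\<Sum>t\<le>degree g. Polynomial.smult (a t) (Q (Suc k) t))" "a (degree g) = 1"
  proof -
    have "degree (Q (Suc k) t) = t" for t by (rule degree_Q) simp
    from monic_family_expansion[of "degree g" "Q (Suc k)" g, OF this Q_monic order.refl]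
    obtain a where a: "g = (\<Sum>t\<le>degree g. Polynomial.smult (a t) (Q (Suc k) t)) \<and> a (degree g) = lead_coeff g"
      by (rule exE)
    show thesis
    proof (rule that[of a])
      show "g = (\<Sum>t\<le>degree g. Polynomial.smult (a t) (Q (Suc k) t))" using a by (rule conjunct1)
      show "a (degree g) = 1" using conjunct2[OF a] g by (rule trans)
    qed
  qed
  have "\<forall>t. \<exists>c q. c \<noteq> 0 \<and> pcompose (map_poly (ramify m) (Q (Suc k) t)) [:tau k, mps_monom (lam k):] =
      Polynomial.smult (mps_monom (B (Suc k) t)) q \<and> map_poly mps_const_coeff q = monom c (t div N k)"
    using expands_Q[OF k] unfolding expands_def by blast
  then obtain c q where cq: "\<And>t. c t \<noteq> 0"
    "\<And>t. pcompose (map_poly (ramify m) (Q (Suc k) t)) [:tau k, mps_monom (lam k):] =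
      Polynomial.smult (mps_monom (B (Suc k) t)) (q t)"
    "\<And>t. map_poly mps_const_coeff (q t) = monom (c t) (t div N k)"
    by metis
  define X where "X t = ramify m (a t) * mps_monom (B (Suc k) t)" for t
  have "map_poly (ramify m) g =
      (\<Sum>t\<le>degree g. Polynomial.smult (ramify m (a t)) (map_poly (ramify m) (Q (Suc k) t)))"
    by (subst a(1)) (simp only: rp.hom_sum r.map_poly_hom_smult)
  hence "pcompose (map_poly (ramify m) g) [:tau k, mps_monom (lam k):] =
       (\<Sum>t\<le>degree g. Polynomial.smult (X t) (q t))"
    by (simp add: pcompose_sum pcompose_smult cq(2) X_def del: Q.simps B.simps)
  moreover have "X (degree g) = mps_monom (B (Suc k) (degree g))" by (simp add: X_def a(2))
  moreover have "t = t'" if t: "t < N (Suc k)" "t' < N (Suc k)" "mps_nth (X t) e \<noteq> 0" "mps_nth (X t') e \<noteq> 0"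
    for t t' e
  proof (rule B_separated[OF _ t(1,2)])
    fix s :: "'d \<Rightarrow> 'a" assume s: "s \<in> mu_group m"
    have "chi s e = chi s (B (Suc k) u)" if "mps_nth (X u) e \<noteq> 0" for u
    proof -
      from that obtain v w where "mps_nth (ramify m (a u)) v \<noteq> 0"
        "mps_nth (mps_monom (B (Suc k) u) :: ('a, 'd) mps) w \<noteq> 0" and e: "e = (\<lambda>i. v i + w i)"
        unfolding X_def by (rule mps_nth_mult_nonzeroE)
      moreover from this(1) m obtain v' where "v = (\<lambda>i. m * v' i)" by (rule mps_nth_ramify_nonzeroE)
      ultimately show ?thesis
        by (simp add: e chi_add chi_multiple[OF s] mps_monom_def split: if_splits)
    qed
    thus "chi s (B (Suc k) t) = chi s (B (Suc k) t')" using t(3,4) by metis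
  qed (use k in simp)
  ultimately show ?thesis using that cq(1,3) by blast
qed

lemma poly_via_expansion:
  assumes "k < len" "pcompose p [:tau k, mps_monom (lam k):] = (\<Sum>t\<in>A. Polynomial.smult (X t) (q t))"
  shows "poly p x = (\<Sum>t\<in>A. X t * poly (q t) (zx k))"
proof -
  have "poly p x = poly (pcompose p [:tau k, mps_monom (lam k):]) (zx k)"
    by (subst x_decomp[OF assms(1)]) (simp add: poly_pcompose mult.commute)
  thus ?thesis unfolding assms(2) by (simp add: poly_sum)
qed

lemma const_coeff_poly_zx:
  assumes "map_poly mps_const_coeff q = monom c j"
  shows "mps_const_coeff (poly q (zx k)) = c * mps_nth x (lam k) ^ j"
proof -
  interpret cc: comm_ring_hom "mps_const_coeff :: ('a, 'd) mps \<Rightarrow> 'a" by (rule mps_const_coeff_hom)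
  show ?thesis by (simp only: cc.poly_map_poly[symmetric] assms poly_monom zx_const)
qed

section \<open>Consequences of a lower bound for the exponents of \<open>g\<close> at the
  root\<close>

text \<open>Since nothing minimal cancels, the bound on \<open>g(x)\<close> forces every
  \<open>X t\<close> into the upper set \<open>U\<close>. For the top term \<open>T^E\<close> this
  bounds \<open>E\<close> from below and \<open>B_le\<close> bounds it from above, so
  \<open>E\<close> is the least element of \<open>U\<close> and survives in
  \<open>g(x)\<close>.\<close>

lemma low_degree:
  assumes k: "k < len" and g: "lead_coeff g = 1" "degree g < N (Suc k)"
    and supp: "\<And>a i. mps_nth (poly (map_poly (ramify m) g) x) a \<noteq> 0 \<Longrightarrow> degree g * b k i \<le> N k * a i"
  shows "\<exists>e. (\<forall>i. N k * e i = degree g * b k i) \<and> mps_nth (poly (map_poly (ramify m) g) x) e \<noteq> 0"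
proof -
  define n where "n = degree g"
  obtain X q c where X:
    "pcompose (map_poly (ramify m) g) [:tau k, mps_monom (lam k):] =
       (\<Sum>t\<le>n. Polynomial.smult (X t) (q t))"
    "\<And>t. map_poly mps_const_coeff (q t) = monom (c t) (t div N k)" "\<And>t. c t \<noteq> 0"
    "X n = mps_monom (B (Suc k) n)"
    "\<And>t t' e. t < N (Suc k) \<Longrightarrow> t' < N (Suc k) \<Longrightarrow> mps_nth (X t) e \<noteq> 0 \<Longrightarrow> mps_nth (X t') e \<noteq> 0 \<Longrightarrow> t = t'"
    using expansion_at[OF k g(1)] unfolding n_def by blast
  define E where "E = B (Suc k) n"
  have sum: "poly (map_poly (ramify m) g) x = (\<Sum>t\<le>n. X t * poly (q t) (zx k))"
    by (rule poly_via_expansion[OF k X(1)])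
  have unit: "mps_const_coeff (poly (q t) (zx k)) \<noteq> 0" for t
    using const_coeff_poly_zx[OF X(2)] X(3) lam_supp[OF k] by simp
  have disj: "t = t'" if "t \<in> {..n}" "t' \<in> {..n}" "mps_nth (X t) e \<noteq> 0" "mps_nth (X t') e \<noteq> 0" for t t' e
    using X(5) that g(2) by (auto simp: n_def)
  define U where "U = {a. \<forall>i. n * b k i \<le> N k * a i}"
  have U: "a \<in> U" if "t \<in> {..n}" "mps_nth (X t) a \<noteq> 0" for t a
  proof (rule support_in_upper_set[of "{..n}" "\<lambda>t. poly (q t) (zx k)" X U t a])
    fix a e assume "a \<in> U" "a \<le> e"
    thus "e \<in> U" unfolding U_def le_fun_def by (auto intro: order.trans mult_le_mono2)
  next
    fix e assume "mps_nth (\<Sum>t\<in>{..n}. X t * poly (q t) (zx k)) e \<noteq> 0"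
    hence "mps_nth (poly (map_poly (ramify m) g) x) e \<noteq> 0" unfolding sum .
    from supp[OF this] show "e \<in> U" by (simp add: U_def n_def)
  qed (use unit disj that in auto)
  have XE: "mps_nth (X n) E \<noteq> 0" by (simp add: X(4) E_def mps_monom_def)
  hence "n * b k i \<le> N k * E i" for i using U[of n E] by (simp add: U_def)
  moreover have "N k * E i \<le> n * b k i" for i
    unfolding E_def by (rule B_le) (use k in auto)
  ultimately have E: "N k * E i = n * b k i" for i by (metis le_antisym)
  have "mps_nth (\<Sum>t\<le>n. X t * poly (q t) (zx k)) E \<noteq> 0"
  proof (rule sum_lowest_coeff[of "{..n}" n X E, OF _ _ XE unit disj])
    fix t a assume t: "t \<in> {..n}" and a: "a \<le> E" "a \<noteq> E"
    show "mps_nth (X t) a = 0"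
    proof (rule ccontr)
      assume "mps_nth (X t) a \<noteq> 0"
      hence "N k * E i \<le> N k * a i" for i using U[OF t] by (simp add: U_def E)
      hence "E \<le> a" using N_pos[of k] by (simp add: le_fun_def)
      with a show False by simp
    qed
  qed auto
  thus ?thesis unfolding sum n_def[symmetric] using E by blast
qed

text \<open>The top index \<open>N (Suc k)\<close> shares its class with a lower one, so the top
  term \<open>T^E\<close> is moved to the other side before the argument without cancellation is
  applied. All \<open>X t\<close> are then divisible by \<open>T^E\<close>, and
  \<open>vanish\<close> at \<open>E\<close> says that the reduction of the quotient \<open>G\<close>
  has the coefficient of \<open>x\<close> at \<open>lam k\<close> as a root.\<close>

lemma root_near:
  assumes k: "k < len" and g: "lead_coeff g = 1" "degree g = N (Suc k)"
    and supp: "\<And>a i. mps_nth (poly (map_poly (ramify m) g) x) a \<noteq> 0 \<Longrightarrow> degree g * b k i \<le> N k * a i"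
    and vanish: "\<And>e. (\<And>i. N k * e i = degree g * b k i) \<Longrightarrow> mps_nth (poly (map_poly (ramify m) g) x) e = 0"
  shows "\<exists>z. mps_const_coeff z = mps_nth x (lam k) \<and>
     poly (map_poly (ramify m) g) (tau k + mps_monom (lam k) * z) = 0"
proof -
  interpret cc: comm_ring_hom "mps_const_coeff :: ('a, 'd) mps \<Rightarrow> 'a" by (rule mps_const_coeff_hom)
  interpret ccp: map_poly_comm_ring_hom "mps_const_coeff :: ('a, 'd) mps \<Rightarrow> 'a" ..
  define n where "n = degree g"
  have n: "n = nn k * N k" unfolding n_def g(2) by (rule N_Suc[OF k])
  have nn0: "nn k > 0" using N_pos[of "Suc k"] N_Suc[OF k] by (cases "nn k") auto
  have ndiv: "n div N k = nn k" "n mod N k = 0" using n N_pos[of k] by auto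
  obtain X q c where X:
    "pcompose (map_poly (ramify m) g) [:tau k, mps_monom (lam k):] =
       (\<Sum>t\<le>n. Polynomial.smult (X t) (q t))"
    "\<And>t. map_poly mps_const_coeff (q t) = monom (c t) (t div N k)" "\<And>t. c t \<noteq> 0"
    "X n = mps_monom (B (Suc k) n)"
    "\<And>t t' e. t < N (Suc k) \<Longrightarrow> t' < N (Suc k) \<Longrightarrow> mps_nth (X t) e \<noteq> 0 \<Longrightarrow> mps_nth (X t') e \<noteq> 0 \<Longrightarrow> t = t'"
    using expansion_at[OF k g(1)] unfolding n_def by blast
  define E where "E = B (Suc k) n"
  \<comment> \<open>The lower digits of \<open>n\<close> are zero, so \<open>E\<close> is exactly
    \<open>nn k\<close> times \<open>b k\<close>.\<close>
  have E: "N k * E i = n * b k i" for i by (simp add: E_def ndiv B_0 n)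
  have sum: "poly (map_poly (ramify m) g) x = (\<Sum>t\<le>n. X t * poly (q t) (zx k))"
    by (rule poly_via_expansion[OF k X(1)])
  have split: "{..n} = insert n {..<n}" by auto
  have unit: "mps_const_coeff (poly (q t) (zx k)) \<noteq> 0" for t
    using const_coeff_poly_zx[OF X(2)] X(3) lam_supp[OF k] by simp
  have disj: "t = t'" if "t \<in> {..<n}" "t' \<in> {..<n}" "mps_nth (X t) e \<noteq> 0" "mps_nth (X t') e \<noteq> 0" for t t' e
    using X(5) that g(2) by (auto simp: n_def)
  have U: "E \<le> a" if "t \<in> {..<n}" "mps_nth (X t) a \<noteq> 0" for t a
  proof -
    have "a \<in> {a. E \<le> a}"
    proof (rule support_in_upper_set[of "{..<n}" "\<lambda>t. poly (q t) (zx k)" X "{a. E \<le> a}" t a])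
      fix e assume "mps_nth (\<Sum>t\<in>{..<n}. X t * poly (q t) (zx k)) e \<noteq> 0"
      moreover have "(\<Sum>t\<in>{..<n}. X t * poly (q t) (zx k)) =
          poly (map_poly (ramify m) g) x - poly (q n) (zx k) * mps_monom E"
        unfolding sum split by (simp add: X(4) E_def mult.commute)
      ultimately have "mps_nth (poly (map_poly (ramify m) g) x) e \<noteq> 0 \<or> E \<le> e"
        by (auto simp: mps_nth_monom_mult split: if_splits)
      thus "e \<in> {a. E \<le> a}"
      proof
        assume "mps_nth (poly (map_poly (ramify m) g) x) e \<noteq> 0"
        hence "N k * E i \<le> N k * e i" for i using supp[of e i] by (simp add: n_def[symmetric] E)
        thus ?thesis using N_pos[of k] by (simp add: le_fun_def)
      qed simp
    qed (use unit disj that in auto)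
    thus ?thesis by simp
  qed
  \<comment> \<open>The quotient of \<open>X t\<close> by \<open>T^E\<close>; it is \<open>1\<close>
    for \<open>t = n\<close> because \<open>X n\<close> is \<open>T^E\<close> itself.\<close>
  define y where "y t = (if t = n then 1 else MPS (\<lambda>e. mps_nth (X t) (\<lambda>i. e i + E i)))" for t
  have y: "X t = y t * mps_monom E" if "t \<le> n" for t
    using mps_factor_monom[of "X t" E] U[of t] that X(4) by (auto simp: y_def E_def)
  define G where "G = (\<Sum>t\<le>n. Polynomial.smult (y t) (q t))"
  have pc: "pcompose (map_poly (ramify m) g) [:tau k, mps_monom (lam k):] = Polynomial.smult (mps_monom E) G"
  proof -
    have "(\<Sum>t\<le>n. Polynomial.smult (X t) (q t)) =
        (\<Sum>t\<le>n. Polynomial.smult (mps_monom E) (Polynomial.smult (y t) (q t)))"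
      by (intro sum.cong) (auto simp: y mult.commute)
    thus ?thesis unfolding X(1) G_def by (simp add: smult_sum2)
  qed
  define a where "a = mps_nth x (lam k)"
  have a0: "a \<noteq> 0" unfolding a_def by (rule lam_supp[OF k])
  have red: "map_poly mps_const_coeff G = (\<Sum>t\<le>n. monom (mps_const_coeff (y t) * c t) (t div N k))"
    by (simp add: G_def ccp.hom_sum cc.map_poly_hom_smult X(2) smult_monom)
  \<comment> \<open>The constant coefficient of \<open>y t\<close> is the coefficient of
    \<open>X t\<close> at \<open>E\<close>, and by disjointness of supports it is nonzero for at
    most one \<open>t < n\<close>.\<close>
  have "\<exists>\<beta> j. j < nn k \<and> (\<Sum>t<n. monom (mps_const_coeff (y t) * c t) (t div N k)) = monom \<beta> j"
  proof (cases "\<exists>t0<n. mps_const_coeff (y t0) \<noteq> 0")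
    case False
    thus ?thesis using nn0 by (intro exI[of _ 0]) auto
  next
    case True
    then obtain t0 where t0: "t0 < n" "mps_const_coeff (y t0) \<noteq> 0" by blast
    have "(\<Sum>t<n. monom (mps_const_coeff (y t) * c t) (t div N k)) =
       (\<Sum>t<n. if t = t0 then monom (mps_const_coeff (y t0) * c t0) (t0 div N k) else 0)"
    proof (intro sum.cong refl)
      fix t assume t: "t \<in> {..<n}"
      have "mps_const_coeff (y t) = mps_nth (X t) E" "mps_const_coeff (y t0) = mps_nth (X t0) E"
        using t t0 by (auto simp: y_def mps_const_coeff_def)
      hence "mps_const_coeff (y t) = 0" if "t \<noteq> t0"
        using disj[of t t0 E] t t0 that by (metis lessThan_iff)
      thus "monom (mps_const_coeff (y t) * c t) (t div N k) =
          (if t = t0 then monom (mps_const_coeff (y t0) * c t0) (t0 div N k) else 0)"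
        by simp
    qed
    hence "(\<Sum>t<n. monom (mps_const_coeff (y t) * c t) (t div N k)) =
        monom (mps_const_coeff (y t0) * c t0) (t0 div N k)" using t0 by simp
    moreover have "t0 div N k < nn k" using t0(1) n by (simp add: less_mult_imp_div_less)
    ultimately show ?thesis by blast
  qed
  then obtain \<beta> j where j: "j < nn k"
    "(\<Sum>t<n. monom (mps_const_coeff (y t) * c t) (t div N k)) = monom \<beta> j" by blast
  have P: "map_poly mps_const_coeff G = monom (c n) (nn k) + monom \<beta> j"
    unfolding red split using j(2) by (simp add: y_def ndiv)
  have "poly (map_poly (ramify m) g) x = poly G (zx k) * mps_monom E"
  proof -
    have "poly (map_poly (ramify m) g) x =
        poly (pcompose (map_poly (ramify m) g) [:tau k, mps_monom (lam k):]) (zx k)"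
      by (subst x_decomp[OF k]) (simp add: poly_pcompose mult.commute)
    thus ?thesis by (simp add: pc mult.commute)
  qed
  moreover have "mps_nth (poly (map_poly (ramify m) g) x) E = 0"
    using vanish[of E] E by (simp add: n_def)
  ultimately have "mps_const_coeff (poly G (zx k)) = 0"
    by (simp add: mps_nth_monom_mult mps_const_coeff_def)
  hence root: "poly (map_poly mps_const_coeff G) a = 0"
    by (simp only: a_def zx_const[symmetric] cc.poly_map_poly)
  hence r1: "c n * a ^ nn k + \<beta> * a ^ j = 0" by (simp add: P poly_monom)
  have "poly (pderiv (map_poly mps_const_coeff G)) a \<noteq> 0"
  proof
    assume "poly (pderiv (map_poly mps_const_coeff G)) a = 0"
    \<comment> \<open>Multiplying the derivative by \<open>a\<close> makes it comparable with
      \<open>r1\<close>. Eliminating \<open>\<beta>\<close> leaves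
      \<open>(nn k - j) * (c n * a ^ nn k)\<close>, nonzero in characteristic zero since
      \<open>j < nn k\<close>.\<close>
    hence "a * (of_nat (nn k) * c n * a ^ (nn k - 1) + of_nat j * \<beta> * a ^ (j - 1)) = 0"
      by (simp add: P pderiv_add pderiv_monom poly_monom mult_ac)
    moreover have "a * (of_nat i * \<gamma> * a ^ (i - 1)) = of_nat i * (\<gamma> * a ^ i)" for i \<gamma>
      by (cases i) (auto simp: mult_ac)
    ultimately have "of_nat (nn k) * (c n * a ^ nn k) + of_nat j * (\<beta> * a ^ j) = 0"
      by (simp only: distrib_left)
    moreover have "\<beta> * a ^ j = - (c n * a ^ nn k)" using r1 by (simp add: add_eq_0_iff)
    ultimately have "(of_nat (nn k) - of_nat j) * (c n * a ^ nn k) = 0" by (simp add: algebra_simps)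
    thus False using j(1) X(3) a0 by simp
  qed
  with root obtain z where z: "poly G z = 0" "mps_const_coeff z = a" by (rule mps_hensel)
  have "poly (map_poly (ramify m) g) (tau k + mps_monom (lam k) * z) =
      poly (pcompose (map_poly (ramify m) g) [:tau k, mps_monom (lam k):]) z"
    by (simp add: poly_pcompose mult.commute)
  thus ?thesis using z by (auto simp: pc a_def)
qed

section \<open>Roots that share the first characteristic terms of \<open>x\<close>\<close>

text \<open>Nothing is known about the terms of the lifted root beyond \<open>lam k\<close>. Its
  nonzero terms at \<open>lam 0, ..., lam k\<close> put the stabiliser inside
  \<open>H (Suc k)\<close>, and the bound on the orbit forces equality by orbit-stabiliser; hence
  \<open>H (Suc k)\<close> fixes all the unknown terms too.\<close>

lemma truncated_char_seq:
  assumes k: "k < len" and z: "mps_const_coeff z = mps_nth x (lam k)"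
    and card: "card (orbit m (tau k + mps_monom (lam k) * z)) \<le> N (Suc k)"
  shows "char_seq m (tau k + mps_monom (lam k) * z) (Suc k) lam"
    "card (orbit m (tau k + mps_monom (lam k) * z)) = N (Suc k)"
proof -
  define y where "y = tau k + mps_monom (lam k) * z"
  have y_nth: "mps_nth y e = (if lam k \<le> e then mps_nth z (\<lambda>i. e i - lam k i) else mps_nth x e)" for e
    using k by (auto simp: y_def mps_nth_tau mult.commute[of "mps_monom _"] mps_nth_monom_mult)
  have y_lam: "mps_nth y (lam j) \<noteq> 0" if "j \<le> k" for j
  proof (cases "j = k")
    case True
    thus ?thesis using z lam_supp[OF k] by (simp add: y_nth mps_const_coeff_def)
  next
    case False
    thus ?thesis using that lam_not_le[of j k] k lam_supp[of j] by (simp add: y_nth)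
  qed
  let ?S = "{s \<in> mu_group m. act s y = y} :: ('d \<Rightarrow> 'a) set"
  have sub: "?S \<subseteq> H (Suc k)"
  proof
    fix s assume s: "s \<in> ?S"
    have "chi s (lam i) = 1" if "i < Suc k" for i
    proof -
      have "chi s (lam i) * mps_nth y (lam i) = mps_nth y (lam i)"
        using s by (metis (mono_tags, lifting) mem_Collect_eq mps_nth_act)
      thus ?thesis using y_lam[of i] that by simp
    qed
    thus "s \<in> H (Suc k)" using s by (simp add: char_stab_def)
  qed
  have e: "card (H (Suc k)) * N (Suc k) = card ?S * card (orbit m y)"
    using sum_over_orbit[OF m, of "\<lambda>_. 1" y] card_group[of "Suc k"] k by simp
  have le: "card ?S \<le> card (H (Suc k))" by (rule card_mono[OF finite_H sub])
  have "card (H (Suc k)) * N (Suc k) \<le> card ?S * N (Suc k)"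
    unfolding e using card by (simp add: y_def)
  hence eq: "card ?S = card (H (Suc k))" using le N_pos[of "Suc k"] by simp
  hence S: "?S = H (Suc k)" by (rule card_subset_eq[OF finite_H sub])
  show "card (orbit m (tau k + mps_monom (lam k) * z)) = N (Suc k)"
    using e H_pos[of "Suc k"] unfolding eq by (simp add: y_def)
  show "char_seq m (tau k + mps_monom (lam k) * z) (Suc k) lam"
    unfolding y_def[symmetric]
  proof
    show "alg_closed_in TYPE('a)" by (rule alg)
    show "m > 0" by (rule m)
    show "lam i < lam j" if "i < j" "j < Suc k" for i j using lam_mono[of i j] that k by simp
    show "mps_nth y (lam j) \<noteq> 0" if "j < Suc k" for j using y_lam that by simp
    show "\<exists>s\<in>char_stab m lam r. chi (s :: 'd \<Rightarrow> 'a) (lam r) \<noteq> 1" if "r < Suc k" for r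
      using moved[of r] that k by simp
    fix r e and s :: "'d \<Rightarrow> 'a"
    assume r: "r \<le> Suc k" "s \<in> char_stab m lam r" "mps_nth y e \<noteq> 0" "r < Suc k \<Longrightarrow> \<not> lam r \<le> e"
    show "chi s e = 1"
    proof (cases "r = Suc k")
      case True
      hence "act s y = y" using r(2) S by blast
      hence "chi s e * mps_nth y e = mps_nth y e" by (metis mps_nth_act)
      thus ?thesis using r(3) by simp
    next
      case False
      hence rk: "r \<le> k" using r(1) by simp
      have nle: "\<not> lam r \<le> e" using r(4) rk by simp
      hence "\<not> lam k \<le> e" using lam_le[OF rk k] by (meson order.trans)
      hence "mps_nth x e \<noteq> 0" using r(3) by (simp add: y_nth)
      thus ?thesis using fixed[of r s e] r(2) rk k nle by simp
    qed
  qed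
qed

text \<open>The difference of \<open>x\<close> and a distinct conjugate starts at
  \<open>lam (level len s)\<close>, and \<open>moved\<close> ensures that every level below
  \<open>len\<close> is reached.\<close>

lemma orbit_poly_characteristic:
  assumes p: "map_poly (ramify m) p = orbit_poly m x" "lead_coeff p = 1"
  shows "quasi_ordinary p" "irreducible p"
    "root_diff_exps p = (\<lambda>j i. of_nat (lam j i) / of_nat m) ` {..<len}"
proof -
  have dom: "dominant (x - act s x) (lam (level len s))" if "s \<in> mu_group m" "level len s < len" for s
    using dominant_tau_diff[of len len s] that by (simp add: tau_len)
  have triv: "act s x = x" if "s \<in> mu_group m" "\<not> level len s < len" for s
    using act_tau_eq_iff[of len s] level_eq_iff[of s len] level_le[of len s] that by (simp add: tau_len)
  show "quasi_ordinary p"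
    unfolding quasi_ordinary_iff_orbit[OF m p] using dom triv by blast
  show "irreducible p" by (rule orbit_poly_irreducible[OF m p(2,1)])
  show "root_diff_exps p = (\<lambda>j i. of_nat (lam j i) / of_nat m) ` {..<len}"
    unfolding root_diff_exps_orbit[OF m p(1)]
  proof (intro equalityI subsetI)
    fix v :: "'d \<Rightarrow> rat" assume "v \<in> {\<lambda>i. of_nat (e i) / of_nat m |e. \<exists>s\<in>mu_group m. dominant (x - act s x) e}"
    then obtain e s where e: "v = (\<lambda>i. of_nat (e i) / of_nat m :: rat)" "s \<in> mu_group m"
      "dominant (x - act s x) e" by blast
    have "level len s < len" using triv[OF e(2)] dominant_nonzero[OF e(3)] by fastforce
    moreover from this have "e = lam (level len s)" using dom[OF e(2)] e(3) dominant_unique by blast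
    ultimately show "v \<in> (\<lambda>j i. of_nat (lam j i) / of_nat m) ` {..<len}" using e(1) by blast
  next
    fix v :: "'d \<Rightarrow> rat" assume "v \<in> (\<lambda>j i. of_nat (lam j i) / of_nat m) ` {..<len}"
    then obtain j where j: "j < len" "v = (\<lambda>i. of_nat (lam j i) / of_nat m)" by blast
    obtain s :: "'d \<Rightarrow> 'a" where s: "s \<in> H j" "chi s (lam j) \<noteq> 1" using moved[OF j(1)] by blast
    have "level len s = j"
      unfolding level_def
    proof (rule Least_equality)
      fix i assume "i = len \<or> chi s (lam i) \<noteq> 1"
      thus "j \<le> i" using s(1) j(1) by (force simp: char_stab_def not_less[symmetric])
    qed (use s in simp)
    hence "dominant (x - act s x) (lam j)" using dom[of s] char_stabD[OF s(1)] j(1) by simp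
    thus "v \<in> {\<lambda>i. of_nat (e i) / of_nat m |e. \<exists>s\<in>mu_group m. dominant (x - act s x) e}"
      using char_stabD[OF s(1)] j(2) by blast
  qed
qed

text \<open>Makes the degrees \<open>N k\<close> strictly increasing, so that
  \<open>low_degree\<close> covers polynomials of degree \<open>N k\<close> at level
  \<open>k\<close>.\<close>

lemma nn_ge_2:
  assumes "k < len"
  shows "nn k \<ge> 2"
proof -
  obtain s :: "'d \<Rightarrow> 'a" where s: "s \<in> H k" "chi s (lam k) \<noteq> 1" using moved[OF assms] by blast
  have "(\<lambda>_. 1) \<in> H k" using mu_group_one by (auto simp: char_stab_def)
  hence "{1, chi s (lam k)} \<subseteq> (\<lambda>s. chi s (lam k)) ` H k" using s(1) by force
  from card_mono[OF _ this] show ?thesis using finite_H s(2) by (simp add: nn_def)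
qed

text \<open>Keeps the origin out of the orthant of level \<open>k\<close>, which rules out constant
  \<open>g\<close>.\<close>

lemma b_nonzero:
  assumes "k < len"
  shows "\<exists>i. b k i > 0"
proof -
  obtain s :: "'d \<Rightarrow> 'a" where s: "chi s (lam k) \<noteq> 1" using moved[OF assms] by blast
  hence "lam k \<noteq> (\<lambda>_. 0)" by auto
  then obtain i where i: "lam k i > 0" by (auto simp: fun_eq_iff)
  have "act (\<lambda>_. 1) (tau k) = tau k" by (rule act_one)
  moreover have "(\<lambda>_. 1) \<in> H k" using mu_group_one by (auto simp: char_stab_def)
  ultimately have "d (tau k) = lam k"
    using d_eq[OF assms mu_group_one] level_eq_iff[OF mu_group_one, of k] by metis
  moreover have "d (tau k) i \<le> b k i"
    unfolding b_def by (rule member_le_sum[OF orbit_self]) (auto simp: finite_orbit[OF m])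
  ultimately show ?thesis using i by (metis less_le_trans)
qed

lemma dominant_F:
  assumes "k < len" "map_poly (ramify m) p = orbit_poly m (tau k)"
  shows "dominant (poly (map_poly (ramify m) p) x) (b k)" "degree p = N k"
proof -
  interpret r: inj_comm_ring_hom "ramify m :: ('a, 'd) mps \<Rightarrow> _" by (rule ramify_hom[OF m])
  obtain c where "expands k (map_poly (ramify m) (F k)) (b k) c 1"
    using expands_F[of k k] assms(1) by auto
  from expands_dominant'[OF this assms(1)]
  show "dominant (poly (map_poly (ramify m) p) x) (b k)" unfolding F(1) assms(2) .
  show "degree p = N k" using F(1)[of k] F(3)[of k] assms(2) by (metis r.degree_map_poly_hom)
qed

end

section \<open>Logarithmic distances from a quasi-ordinary polynomial\<close>

context char_seq begin

text \<open>The logarithmic distance from \<open>f\<close> to \<open>F k\<close>: the factor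
  \<open>m\<close> undoes the ramification, and \<open>N k\<close> is the degree of
  \<open>F k\<close>.\<close>

definition orthant :: "nat \<Rightarrow> (real ^ 'd) set" where
  "orthant k = {z. \<forall>i. real (b k i) / (real m * real (N k)) \<le> vec_nth z i}"

lemma contA_F:
  assumes "map_poly (ramify m) f = orbit_poly m x" "k < len" "map_poly (ramify m) p = orbit_poly m (tau k)"
  shows "contA f p = orthant k"
  using contA_dominant[OF m assms(1) dominant_F(1)[OF assms(2,3)]] dominant_F(2)[OF assms(2,3)] N_pos[of k]
  by (simp add: orthant_def)

lemma contA_eq_orthant:
  assumes f: "map_poly (ramify m) f = orbit_poly m x" and g: "degree g > 0"
    and supp: "\<And>a i. mps_nth (poly (map_poly (ramify m) g) x) a \<noteq> 0 \<Longrightarrow> degree g * b k i \<le> N k * a i"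
    and e: "\<And>i. N k * e i = degree g * b k i" "mps_nth (poly (map_poly (ramify m) g) x) e \<noteq> 0"
  shows "contA f g = orthant k"
proof -
  have "e \<le> a" if "mps_nth (poly (map_poly (ramify m) g) x) a \<noteq> 0" for a
  proof -
    have "N k * e i \<le> N k * a i" for i using supp[OF that] e(1) by simp
    thus ?thesis using N_pos[of k] by (simp add: le_fun_def)
  qed
  hence "dominant (poly (map_poly (ramify m) g) x) e" using e(2) by (simp add: dominant_def)
  from contA_dominant[OF m f this g]
  have "contA f g = {z. \<forall>i. real (e i) / (real m * real (degree g)) \<le> vec_nth z i}" .
  moreover have "real (e i) / (real m * real (degree g)) = real (b k i) / (real m * real (N k))" for i
  proof -
    have "real (N k) * real (e i) = real (degree g) * real (b k i)" using e(1)[of i] by (metis of_nat_mult)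
    thus ?thesis using m g N_pos[of k] by (simp add: field_simps)
  qed
  ultimately show ?thesis by (simp add: orthant_def)
qed

lemma support_of_contA:
  assumes f: "map_poly (ramify m) f = orbit_poly m x" and g: "degree g > 0"
    and sub: "contA f g \<subseteq> orthant k" and a: "mps_nth (poly (map_poly (ramify m) g) x) a \<noteq> 0"
  shows "degree g * b k i \<le> N k * a i"
proof -
  have "real (b k i) / (real m * real (N k)) * (real m * real (degree g)) \<le> real (a i)"
    by (rule contA_subset_imp[OF m f g sub[unfolded orthant_def] a])
  hence "real (degree g) * real (b k i) \<le> real (N k) * real (a i)"
    using m N_pos[of k] by (simp add: field_simps)
  thus ?thesis by (metis of_nat_le_iff of_nat_mult)
qed

lemma degree_pos_of_contA:
  fixes f g :: "('a, 'd) mps poly"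
  assumes "k < len" "lead_coeff g = 1" "contA f g \<subseteq> orthant k"
  shows "degree g > 0"
proof (rule ccontr)
  assume "\<not> degree g > 0"
  hence deg: "degree g = 0" by simp
  hence "g = 1" using assms(2) by (metis coeff_pCons_0 degree_eq_zeroE one_pCons)
  hence "(\<chi> i. 0) \<in> newton_polytope (resultant f g)"
    using in_newton_polytope[of "1 :: ('a, 'd) mps" "\<lambda>_. 0"] by (simp add: mps_nth_1)
  \<comment> \<open>With \<open>1 / 0 = 0\<close> the scaling by the degree of the constant
    \<open>g\<close> collapses the polytope to the origin.\<close>
  hence "0 \<in> contA f g" unfolding contA_def deg by force
  with assms(3) have "real (b k i) / (real m * real (N k)) \<le> 0" for i by (auto simp: orthant_def)
  hence "b k i = 0" for i using m N_pos[of k]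
    by (metis divide_le_0_iff mult_pos_pos not_less of_nat_0_less_iff gr0I)
  thus False using b_nonzero[OF assms(1)] by simp
qed

lemma contact_above_level:
  assumes f: "map_poly (ramify m) f = orbit_poly m x" and k: "k < len"
    and fk: "map_poly (ramify m) fk = orbit_poly m (tau k)"
    and g: "lead_coeff g = 1" "degree g \<le> N (Suc k)" and cont: "contA f g \<subset> contA f fk"
  shows "degree g = N (Suc k)" "quasi_ordinary g" "irreducible g"
    "root_diff_exps g = (\<lambda>j i. of_nat (lam j i) / of_nat m) ` {..k}"
proof -
  have fk_eq: "contA f fk = orthant k" by (rule contA_F[OF f k fk])
  have sub: "contA f g \<subseteq> orthant k" using cont fk_eq by blast
  have pos: "degree g > 0" by (rule degree_pos_of_contA[OF k g(1) sub])
  note supp = support_of_contA[OF f pos sub]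
  \<comment> \<open>Strictness enters here: if the extreme exponent occurred, it would be dominant
    in \<open>g(x)\<close> and the two distances would coincide.\<close>
  have vanish: "mps_nth (poly (map_poly (ramify m) g) x) e = 0"
    if "\<And>i. N k * e i = degree g * b k i" for e
  proof (rule ccontr)
    assume "mps_nth (poly (map_poly (ramify m) g) x) e \<noteq> 0"
    hence "contA f g = orthant k" using supp that by (intro contA_eq_orthant[OF f pos])
    with cont fk_eq show False by blast
  qed
  show deg: "degree g = N (Suc k)"
  proof (rule ccontr)
    assume "degree g \<noteq> N (Suc k)"
    hence "degree g < N (Suc k)" using g(2) by simp
    hence "\<exists>e. (\<forall>i. N k * e i = degree g * b k i) \<and> mps_nth (poly (map_poly (ramify m) g) x) e \<noteq> 0"
      using supp by (intro low_degree[OF k g(1)])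
    with vanish show False by blast
  qed
  have "\<exists>z. mps_const_coeff z = mps_nth x (lam k) \<and>
      poly (map_poly (ramify m) g) (tau k + mps_monom (lam k) * z) = 0"
  proof (rule root_near[OF k g(1) deg])
    show "mps_nth (poly (map_poly (ramify m) g) x) e = 0"
      if "\<And>i. N k * e i = degree g * b k i" for e by (rule vanish) (rule that)
  qed (rule supp)
  then obtain z where z: "mps_const_coeff z = mps_nth x (lam k)"
    "poly (map_poly (ramify m) g) (tau k + mps_monom (lam k) * z) = 0" by blast
  define y where "y = tau k + mps_monom (lam k) * z"
  have "g \<noteq> 0" using g(1) by auto
  hence card: "card (orbit m y) \<le> N (Suc k)"
    using card_orbit_le_degree[OF m, of g y] z(2) deg by (simp add: y_def)
  note y = truncated_char_seq[OF k z(1) card[unfolded y_def], folded y_def]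
  interpret y: char_seq m y "Suc k" lam by (rule y(1))
  have "map_poly (ramify m) g = orbit_poly m y"
    by (rule monic_eq_orbit_poly[OF m g(1)]) (use z(2) deg y(2) in \<open>simp_all add: y_def\<close>)
  from y.orbit_poly_characteristic[OF this g(1)]
  show "quasi_ordinary g" "irreducible g"
    "root_diff_exps g = (\<lambda>j i. of_nat (lam j i) / of_nat m) ` {..k}"
    by (simp_all add: lessThan_Suc_atMost)
qed

text \<open>The degree \<open>N k\<close> is below \<open>N (Suc k)\<close>, so
  \<open>low_degree\<close> always produces the extreme exponent, and the containment cannot be
  strict.\<close>

lemma contact_at_next_level:
  assumes f: "map_poly (ramify m) f = orbit_poly m x" and k: "k < len"
    and p: "map_poly (ramify m) p = orbit_poly m (tau k)"
    and g: "lead_coeff g = 1" "degree g = N k" and cont: "contA f g \<subseteq> contA f p"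
  shows "contA f g = contA f p"
proof -
  have p_eq: "contA f p = orthant k" by (rule contA_F[OF f k p])
  have sub: "contA f g \<subseteq> orthant k" using cont p_eq by blast
  have pos: "degree g > 0" using g(2) N_pos by simp
  note supp = support_of_contA[OF f pos sub]
  have "degree g < N (Suc k)"
    using nn_ge_2[OF k] N_Suc[OF k] N_pos[of k] g(2) by simp
  hence "\<exists>e. (\<forall>i. N k * e i = degree g * b k i) \<and> mps_nth (poly (map_poly (ramify m) g) x) e \<noteq> 0"
    using supp by (intro low_degree[OF k g(1)])
  then obtain e where "\<And>i. N k * e i = degree g * b k i"
    "mps_nth (poly (map_poly (ramify m) g) x) e \<noteq> 0" by blast
  hence "contA f g = orthant k" using supp by (intro contA_eq_orthant[OF f pos])
  thus ?thesis by (simp add: p_eq)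
qed

end

section \<open>From the data of the theorem to a characteristic sequence\<close>

lemma scaled_exponents_le_iff:
  assumes "m > 0"
  shows "(\<lambda>i. of_nat (a i) / of_nat m :: rat) \<le> (\<lambda>i. of_nat (b i) / of_nat m) \<longleftrightarrow> a \<le> b"
  using assms by (simp add: le_fun_def divide_le_cancel)

lemma trunc_ram_ramify:
  fixes y :: "('a::comm_ring_1, 'd::finite) mps"
  assumes "q > 0"
  shows "trunc_ram (q * m) h (ramify q y) = ramify q (trunc_ram m h y)"
proof (rule mps_eqI)
  fix e
  show "mps_nth (trunc_ram (q * m) h (ramify q y)) e = mps_nth (ramify q (trunc_ram m h y)) e"
  proof (cases "\<forall>i. q dvd e i")
    case True
    have "(of_nat (e i) / of_nat (q * m) :: rat) = of_nat (e i div q) / of_nat m" for i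
    proof -
      obtain c where "e i = q * c" using True by (meson dvdE)
      thus ?thesis using assms by simp
    qed
    thus ?thesis by (simp only: trunc_ram_def mps_nth_ramify mps.sel if_distrib) (simp add: True)
  qed (auto simp: trunc_ram_def mps_nth_ramify)
qed

lemma trunc_ram_act: "trunc_ram m h (act s y) = act s (trunc_ram m h y)"
  by (rule mps_eqI) (simp add: trunc_ram_def)

lemma orbit_act:
  assumes "m > 0" "s \<in> mu_group m"
  shows "orbit m (act s y) = orbit m y"
proof (intro equalityI subsetI)
  fix z assume "z \<in> orbit m (act s y)"
  thus "z \<in> orbit m y" using assms by (auto simp: act_act intro!: act_in_orbit mu_group_times elim!: orbitE)
next
  fix z assume "z \<in> orbit m y"
  then obtain t where t: "t \<in> mu_group m" "z = act t y" by (rule orbitE)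
  have "z = act (\<lambda>i. t i * inverse (s i)) (act s y)"
    unfolding act_act t(2) using mu_group_nonzero[OF assms(2,1)] by (simp add: mult.assoc)
  thus "z \<in> orbit m (act s y)"
    using t(1) assms(2) by (auto intro!: act_in_orbit mu_group_times mu_group_inverse)
qed

text \<open>The definition supplies its own ramification and its own root of \<open>f\<close> for
  each \<open>r\<close>. Allowing all multiples of \<open>m\<close> lets two such choices be
  compared over a common ramification.\<close>

lemma is_f_r_orbit_poly:
  fixes f p :: "('a::field_char_0, 'd::finite) mps poly"
  assumes "alg_closed_in TYPE('a)" "is_f_r f hs r p"
  obtains m y where "m > 0" "is_root_ram m f y"
    "\<And>q. q > 0 \<Longrightarrow> map_poly (ramify (q * m)) p =
       orbit_poly (q * m) (trunc_ram (q * m) (hs ! (r - 1)) (ramify q y))"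
proof -
  from assms(2) obtain m y where y: "lead_coeff p = 1" "is_root_ram m f y"
    "is_root_ram m p (trunc_ram m (hs ! (r - 1)) y)"
    "\<And>q. q \<noteq> 0 \<Longrightarrow> is_root_ram m q (trunc_ram m (hs ! (r - 1)) y) \<Longrightarrow> degree p \<le> degree q"
    unfolding is_f_r_def by blast
  have m: "m > 0" using y(2) by (simp add: is_root_ram_def)
  have "map_poly (ramify (q * m)) p = orbit_poly (q * m) (trunc_ram (q * m) (hs ! (r - 1)) (ramify q y))"
    if q: "q > 0" for q
    unfolding trunc_ram_ramify[OF q]
    by (rule minimal_poly_eq_orbit_poly[OF assms(1) y(1)])
       (use y(3,4) in \<open>simp_all add: is_root_ram_ramify_iff[OF q m]\<close>)
  thus ?thesis using that m y(2) by blast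
qed

text \<open>If \<open>x - act s x\<close> has dominant exponent \<open>lam j\<close>, then
  \<open>s\<close> fixes all terms of \<open>x\<close> not above \<open>lam j\<close> and moves the
  one at \<open>lam j\<close>. Elements \<open>S j\<close> realising the entries of
  \<open>hs\<close> thus give \<open>moved\<close>. For \<open>fixed\<close>, quasi-ordinarity
  assigns such a \<open>j\<close> to every \<open>s\<close> that moves \<open>x\<close>, and
  membership in \<open>H r\<close> forces \<open>r \<le> j\<close>.\<close>

lemma char_seq_of_characteristic:
  fixes f :: "('a::field_char_0, 'd::finite) mps poly"
  assumes alg: "alg_closed_in TYPE('a)" and m: "m > 0" and f: "map_poly (ramify m) f = orbit_poly m x"
    and qo: "quasi_ordinary f" and hs: "has_characteristic f hs"
  obtains lam where "char_seq m x (length hs) lam"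
    "\<And>j. j < length hs \<Longrightarrow> hs ! j = (\<lambda>i. of_nat (lam j i) / of_nat m)"
proof -
  let ?len = "length hs"
  have exps: "set hs = {\<lambda>i. of_nat (e i) / of_nat m |e. \<exists>s\<in>mu_group m. dominant (x - act s x) e}"
    using hs root_diff_exps_orbit[OF m f] by (simp add: has_characteristic_def)
  have "\<forall>j. \<exists>e s. j < ?len \<longrightarrow> hs ! j = (\<lambda>i. of_nat (e i) / of_nat m) \<and> s \<in> mu_group m \<and>
      dominant (x - act s x) e"
  proof
    fix j
    show "\<exists>e s. j < ?len \<longrightarrow> hs ! j = (\<lambda>i. of_nat (e i) / of_nat m) \<and> s \<in> mu_group m \<and>
      dominant (x - act s x) e"
      using nth_mem[of j hs] unfolding exps by (cases "j < ?len") auto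
  qed
  then obtain lam S where lam: "\<And>j. j < ?len \<Longrightarrow> hs ! j = (\<lambda>i. of_nat (lam j i) / of_nat m)"
    "\<And>j. j < ?len \<Longrightarrow> S j \<in> mu_group m" "\<And>j. j < ?len \<Longrightarrow> dominant (x - act (S j) x) (lam j)"
    by metis
  have mono: "lam i < lam j" if "i < j" "j < ?len" for i j
  proof -
    have "hs ! i < hs ! j" using hs that by (auto simp: has_characteristic_def sorted_wrt_iff_nth_less)
    thus ?thesis using lam(1)[of i] lam(1)[of j] that
      by (simp add: less_le_not_le scaled_exponents_le_iff[OF m])
  qed
  have nz: "mps_nth x (lam j) \<noteq> 0" "chi (S j) (lam j) \<noteq> 1" if "j < ?len" for j
    using lam(3)[OF that] by (auto simp: dominant_def)
  have low: "chi s e = 1" if "dominant (x - act s x) (lam j)" "mps_nth x e \<noteq> 0" "\<not> lam j \<le> e" for s e j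
  proof -
    have "mps_nth (x - act s x) e = 0" using that(1,3) by (auto simp: dominant_def)
    hence "(1 - chi s e) * mps_nth x e = 0" by (simp add: algebra_simps)
    thus ?thesis using that(2) by simp
  qed
  have not_le: "\<not> lam j \<le> lam i" if "i < j" "j < ?len" for i j using mono[OF that] by auto
  have "char_seq m x ?len lam"
  proof
    show "\<exists>s\<in>char_stab m lam r. chi (s :: 'd \<Rightarrow> 'a) (lam r) \<noteq> 1" if r: "r < ?len" for r
    proof -
      have "chi (S r) (lam i) = 1" if "i < r" for i
        using low[OF lam(3)[OF r], of "lam i"] nz(1)[of i] not_le[OF that r] that r by simp
      thus ?thesis using nz(2)[OF r] lam(2)[OF r] by (auto simp: char_stab_def)
    qed
    fix r e and s :: "'d \<Rightarrow> 'a"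
    assume r: "r \<le> ?len" and s: "s \<in> char_stab m lam r" and e: "mps_nth x e \<noteq> 0"
      and nle: "r < ?len \<Longrightarrow> \<not> lam r \<le> e"
    have sm: "s \<in> mu_group m" by (rule char_stabD[OF s])
    show "chi s e = 1"
    proof (cases "act s x = x")
      case True
      hence "chi s e * mps_nth x e = mps_nth x e" by (metis mps_nth_act)
      thus ?thesis using e by simp
    next
      case False
      have "lead_coeff f = 1" using qo by (simp add: quasi_ordinary_def)
      then obtain e' where e': "dominant (x - act s x) e'"
        using quasi_ordinary_iff_orbit[OF m f] qo sm False by blast
      hence "(\<lambda>i. of_nat (e' i) / of_nat m) \<in> set hs" unfolding exps using sm by blast
      then obtain j where j: "j < ?len" "(\<lambda>i. of_nat (e' i) / of_nat m) = hs ! j"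
        by (metis in_set_conv_nth)
      have "e' = lam j"
        using j(2) scaled_exponents_le_iff[OF m, of e' "lam j"] scaled_exponents_le_iff[OF m, of "lam j" e']
        unfolding lam(1)[OF j(1)] by (intro antisym) simp_all
      hence dom: "dominant (x - act s x) (lam j)" using e' by simp
      hence "chi s (lam j) \<noteq> 1" by (auto simp: dominant_def)
      hence "\<not> j < r" using s by (auto simp: char_stab_def)
      hence rj: "r \<le> j" by simp
      have "lam r \<le> lam j" using mono[of r j] rj j(1) by (cases "r = j") auto
      hence "\<not> lam j \<le> e" using nle rj j(1) by (auto intro: order.trans)
      from low[OF dom e this] show ?thesis .
    qed
  qed (use alg m mono nz(1) in auto)
  thus ?thesis using that lam(1) by blast
qed

lemma (in char_seq) trunc_ram_eq_tau:
  assumes "r < len"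
  shows "trunc_ram m (\<lambda>i. of_nat (lam r i) / of_nat m) x = tau r"
  by (rule mps_eqI) (simp add: trunc_ram_def mps_nth_tau scaled_exponents_le_iff[OF m] assms)

theorem theorem4p4:
  fixes f g fk fk1 :: "('a::field_char_0, 'd::finite) mps poly"
    and hs :: "('d \<Rightarrow> rat) list" and k :: nat
  assumes alg_closed: "\<forall>p :: 'a poly. degree p > 0 \<longrightarrow> (\<exists>x. poly p x = 0)"
    and f_qo: "quasi_ordinary f" and f_irr: "irreducible f" and f_w: "weierstrass f"
    and f_char: "has_characteristic f hs"
    and k: "1 \<le> k" "k \<le> length hs"
    and fk: "is_f_r f hs k fk"
    and fk1: "(k < length hs \<and> is_f_r f hs (k + 1) fk1) \<or> (k = length hs \<and> fk1 = f)"
    and g_w: "weierstrass g"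
    and deg_g: "degree g \<le> degree fk1"
    and cont: "contA f g \<subset> contA f fk"
  shows "quasi_ordinary g \<and> irreducible g \<and> has_characteristic g (take k hs) \<and>
         degree g = degree fk1 \<and>
         (k \<le> length hs - 1 \<and> contA f g \<subseteq> contA f fk1 \<longrightarrow> contA f g = contA f fk1)"
proof -
  have alg: "alg_closed_in TYPE('a)" using alg_closed by (simp add: alg_closed_in_def)
  have lead: "lead_coeff f = 1" "lead_coeff g = 1"
    using f_qo g_w by (simp_all add: quasi_ordinary_def weierstrass_def)
  obtain m1 y1 where y1: "m1 > 0" "is_root_ram m1 f y1"
    "\<And>q. q > 0 \<Longrightarrow> map_poly (ramify (q * m1)) fk =
       orbit_poly (q * m1) (trunc_ram (q * m1) (hs ! (k - 1)) (ramify q y1))"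
    using is_f_r_orbit_poly[OF alg fk] by blast
  have orb: "map_poly (ramify m) f = orbit_poly m y" if "is_root_ram m f y" for m y
    using irreducible_imp_orbit_poly[OF alg _ lead(1) f_irr] that by (simp add: is_root_ram_def)
  \<comment> \<open>\<open>fk\<close> and \<open>fk1\<close> may come with different ramifications
    and different roots of \<open>f\<close>; both are expressed here through truncations of a single
    \<open>x\<close>.\<close>
  obtain m x where m: "m > 0" and x: "map_poly (ramify m) f = orbit_poly m x"
    "map_poly (ramify m) fk = orbit_poly m (trunc_ram m (hs ! (k - 1)) x)"
    "map_poly (ramify m) fk1 = orbit_poly m (if k < length hs then trunc_ram m (hs ! k) x else x)"
  proof (cases "k < length hs")
    case False
    hence "fk1 = f" using fk1 by simp
    moreover have "map_poly (ramify m1) f = orbit_poly m1 (ramify 1 y1)"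
    proof -
      have "ramify 1 y1 = y1" by (rule mps_eqI) (simp add: mps_nth_ramify)
      thus ?thesis using orb[OF y1(2)] by simp
    qed
    ultimately show ?thesis using that[of m1 "ramify 1 y1"] y1(1) y1(3)[of 1] False by simp
  next
    case True
    hence "is_f_r f hs (k + 1) fk1" using fk1 by simp
    then obtain m2 y2 where y2: "m2 > 0" "is_root_ram m2 f y2"
      "\<And>q. q > 0 \<Longrightarrow> map_poly (ramify (q * m2)) fk1 =
         orbit_poly (q * m2) (trunc_ram (q * m2) (hs ! (k + 1 - 1)) (ramify q y2))"
      using is_f_r_orbit_poly[OF alg] by blast
    define m where "m = m2 * m1"
    have m0: "m > 0" using y1(1) y2(1) by (simp add: m_def)
    have m': "m = m1 * m2" by (simp add: m_def)
    define x where "x = ramify m2 y1"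
    have f: "map_poly (ramify m) f = orbit_poly m x"
      by (rule orb) (simp add: m_def x_def is_root_ram_ramify_iff[OF y2(1) y1(1)] y1(2))
    have "is_root_ram m f (ramify m1 y2)"
      unfolding m' is_root_ram_ramify_iff[OF y1(1) y2(1)] by (rule y2(2))
    \<comment> \<open>Over the common ramification the two roots are conjugate, and truncations of
      conjugate roots have the same orbit.\<close>
    hence "ramify m1 y2 \<in> orbit m x"
      using orbit_poly_root[OF m0, of x] by (simp add: is_root_ram_def f)
    then obtain s where s: "s \<in> mu_group m" "ramify m1 y2 = act s x" by (rule orbitE)
    have "map_poly (ramify m) fk1 = orbit_poly m (act s (trunc_ram m (hs ! k) x))"
      using y2(3)[OF y1(1)] unfolding m'[symmetric] s(2) trunc_ram_act by simp
    hence "map_poly (ramify m) fk1 = orbit_poly m (trunc_ram m (hs ! k) x)"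
      unfolding orbit_poly_def orbit_act[OF m0 s(1)] .
    thus ?thesis using that[of m x] m0 f y1(3)[OF y2(1)] True by (simp add: m_def x_def)
  qed
  obtain lam where lam: "char_seq m x (length hs) lam"
    "\<And>j. j < length hs \<Longrightarrow> hs ! j = (\<lambda>i. of_nat (lam j i) / of_nat m)"
    using char_seq_of_characteristic[OF alg m x(1) f_qo f_char] by blast
  interpret char_seq m x "length hs" lam by (rule lam(1))
  \<comment> \<open>Levels count from \<open>0\<close>: \<open>k'\<close> is the level of
    \<open>fk\<close>, and \<open>k\<close> that of \<open>fk1\<close>.\<close>
  define k' where "k' = k - 1"
  have k': "k' < length hs" "k = Suc k'" using k by (auto simp: k'_def)
  have fk_tau: "map_poly (ramify m) fk = orbit_poly m (tau k')"
    using x(2) trunc_ram_eq_tau[OF k'(1)] lam(2)[OF k'(1)] by (simp add: k'_def)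
  have fk1_tau: "map_poly (ramify m) fk1 = orbit_poly m (tau k)"
    using x(3) trunc_ram_eq_tau[of k] lam(2)[of k] tau_len k(2) by (cases "k < length hs") auto
  interpret r: inj_comm_ring_hom "ramify m :: ('a, 'd) mps \<Rightarrow> _" by (rule ramify_hom[OF m])
  have deg_fk1: "degree fk1 = N (Suc k')"
    using fk1_tau F(1)[of k] F(3)[of k] k'(2) by (metis r.degree_map_poly_hom)
  note main = contact_above_level[OF x(1) k'(1) fk_tau lead(2) deg_g[unfolded deg_fk1] cont]
  have "set (take k hs) = (\<lambda>j. hs ! j) ` {..<k}"
    using nth_image[OF k(2)] by (simp add: atLeast0LessThan)
  also have "\<dots> = (\<lambda>j i. of_nat (lam j i) / of_nat m) ` {..<k}"
    using lam(2) k(2) by (intro image_cong) auto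
  also have "\<dots> = root_diff_exps g" using main(4) k'(2) by (simp add: lessThan_Suc_atMost)
  finally have "has_characteristic g (take k hs)"
    using f_char by (simp add: has_characteristic_def sorted_wrt_take)
  \<comment> \<open>As \<open>hs\<close> is nonempty, the truncated subtraction gives
    \<open>k < length hs\<close>, the condition under which \<open>tau k\<close> is a proper
    level.\<close>
  moreover have "contA f g = contA f fk1" if "k \<le> length hs - 1" "contA f g \<subseteq> contA f fk1"
    using contact_at_next_level[OF x(1) _ fk1_tau lead(2) _ that(2)] that(1) main(1) k'(2) k by simp
  ultimately show ?thesis using main(1-3) deg_fk1 by simp
qed

end
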